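(* Let $\alpha>0$ and let $U$ be a domain in the three-dimensional extended hyperbolic space $\mathbb{K}^3$ which is $C^{1,\alpha}$-transversal to $\partial\mathbb{H}^3$. Then the volume of $U$ is invariant under hyperbolic isometries: for every hyperbolic isometry $g$, $\mu(gU)=\mu(U)$.
   Context: $\mathbb{K}^3=\{1\}\times\mathbb{R}^3\cong\mathbb{R}^3$ is the affine (Kleinian) model of the three-dimensional extended hyperbolic space, which is the projectivization of Minkowski space $\mathbb{R}^{3,1}$ ($\mathbb{R}^4$ with $\langle x,y\rangle=-x_0y_0+x_1y_1+x_2y_2+x_3y_3$): $\mathbb{H}^3$ is the open unit ball, the Lorentzian part $\mathbb{L}^3$ is the exterior of the closed unit ball, and $\partial\mathbb{H}^3$ is the unit sphere. For $\epsilon>0$ put $d_\epsilon=1-\epsilon i$ and $$dV_\epsilon=\frac{d_\epsilon\,dx_1\,dx_2\,dx_3}{(d_\epsilon^2-|x|^2)^{2}},$$ a complex-valued density on $\mathbb{K}^3$. The volume of a domain $U\subset\mathbb{K}^3$, possibly crossing $\partial\mathbb{H}^3$, is $\mu(U):=\lim_{\epsilon\to0^+}\int_U dV_\epsilon$. Hyperbolic isometries are the projective transformations induced by the linear isometries $O(3,1)$ of $\mathbb{R}^{3,1}$; they are generated by reflections. They act on the extended hyperbolic space, and $gU$ is regarded as a subset of $\mathbb{K}^3$ (up to the measure-zero plane at infinity of the affine chart). Transversality: a domain $U\subset\mathbb{K}^3$ with boundary $U^b$ is $C^{1,\alpha}$-transversal to $\partial\mathbb{H}^3$ if for each point $p\in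 U^b\cap\partial\mathbb{H}^3$ there is a neighborhood $V$ of $p$ such that $U^b\cap V$ is the zero set of a single $C^{1,\alpha}$ function (continuously differentiable with first derivatives Hölder continuous of exponent $\alpha$, with nonvanishing differential on its zero set), and this $C^{1,\alpha}$ surface is transversal to $\partial\mathbb{H}^3$ in the usual sense. *)

theory Defs
  imports "HOL-Analysis.Analysis"
begin

text \<open>
  Minkowski space is modelled as \<^typ>\<open>real \<times> (real^3)\<close> with the time coordinate first, so that
  \<open>x \<mapsto> (1, x)\<close> is the affine chart of its projectivization. In the chart, hyperbolic space is
  \<^term>\<open>ball (0::real^3) 1\<close> and its boundary at infinity is \<^term>\<open>sphere (0::real^3) 1\<close>.
\<close>

definition minkowski :: "real \<times> (real^3) \<Rightarrow> real \<times> (real^3) \<Rightarrow> real" where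
  "minkowski X Y = - (fst X * fst Y) + snd X \<bullet> snd Y"

definition lorentz :: "(real \<times> (real^3) \<Rightarrow> real \<times> (real^3)) \<Rightarrow> bool" where
  "lorentz g \<longleftrightarrow> linear g \<and> (\<forall>X Y. minkowski (g X) (g Y) = minkowski X Y)"

text \<open>A point of the projectivization is a line through the origin of Minkowski space.\<close>

definition proj_point :: "real^3 \<Rightarrow> (real \<times> (real^3)) set" where
  "proj_point x = span {(1, x)}"

text \<open>
  The part of \<open>gU\<close> visible in the affine chart; points of \<open>U\<close> sent to the plane at infinity
  contribute nothing.
\<close>

definition isometry_image ::
    "(real \<times> (real^3) \<Rightarrow> real \<times> (real^3)) \<Rightarrow> (real^3) set \<Rightarrow> (real^3) set" where
  "isometry_image g U = {y. \<exists>x\<in>U. g ` proj_point x = proj_point y}"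

definition d_eps :: "real \<Rightarrow> complex" where
  "d_eps \<epsilon> = 1 - of_real \<epsilon> * \<i>"

definition vol_density :: "real \<Rightarrow> real^3 \<Rightarrow> complex" where
  "vol_density \<epsilon> x = d_eps \<epsilon> / ((d_eps \<epsilon>)\<^sup>2 - of_real ((norm x)\<^sup>2))\<^sup>2"

definition approx_volume :: "(real^3) set \<Rightarrow> real \<Rightarrow> complex" where
  "approx_volume U \<epsilon> = (LINT x:U|lborel. vol_density \<epsilon> x)"

text \<open>
  \<^const>\<open>Lim\<close> is unspecified where there is no limit, so existence of the limit is a separate
  predicate.
\<close>

definition has_ext_volume :: "(real^3) set \<Rightarrow> bool" where
  "has_ext_volume U \<longleftrightarrow> (\<exists>v. (approx_volume U \<longlongrightarrow> v) (at_right 0))"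

definition ext_volume :: "(real^3) set \<Rightarrow> complex" where
  "ext_volume U = Lim (at_right 0) (approx_volume U)"

text \<open>\<open>F\<close> is of class \<open>C\<^sup>1\<^sup>,\<^sup>\<alpha>\<close> on the open set \<open>V\<close>, with gradient \<open>G\<close>.\<close>

definition C1_holder_on ::
    "real \<Rightarrow> (real^3) set \<Rightarrow> (real^3 \<Rightarrow> real) \<Rightarrow> (real^3 \<Rightarrow> real^3) \<Rightarrow> bool" where
  "C1_holder_on \<alpha> V F G \<longleftrightarrow>
     (\<forall>x\<in>V. GDERIV F x :> G x) \<and> continuous_on V G \<and>
     (\<exists>C. \<forall>x\<in>V. \<forall>y\<in>V. dist (G x) (G y) \<le> C * dist x y powr \<alpha>)"

text \<open>
  In the last conjunct, the kernel of \<open>v \<mapsto> G q \<bullet> v\<close> is the tangent plane at \<open>q\<close> of the zero set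
  of \<open>F\<close>, and the orthogonal complement of \<open>q\<close> is the tangent plane of the unit sphere.
\<close>

definition C1_holder_transversal :: "real \<Rightarrow> (real^3) set \<Rightarrow> bool" where
  "C1_holder_transversal \<alpha> U \<longleftrightarrow>
     (\<forall>p \<in> frontier U \<inter> sphere 0 1. \<exists>V F G.
        open V \<and> p \<in> V \<and> C1_holder_on \<alpha> V F G \<and>
        frontier U \<inter> V = {x\<in>V. F x = 0} \<and>
        (\<forall>x\<in>V. F x = 0 \<longrightarrow> G x \<noteq> 0) \<and>
        (\<forall>q \<in> V \<inter> sphere 0 1. F q = 0 \<longrightarrow>
           {u + v | u v. G q \<bullet> u = 0 \<and> q \<bullet> v = 0} = UNIV))"

end

theory Submission
  imports Defs "HOL-Complex_Analysis.Cauchy_Integral_Theorem"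
begin

text \<open>
  Put \<open>\<rho> x = 1 - x \<bullet> x\<close> and \<open>\<delta> = 1 - d\<^sub>\<epsilon>\<^sup>2 = 2 * \<epsilon> * \<i> + \<epsilon>\<^sup>2\<close>. Up to the factor \<open>d\<^sub>\<epsilon>\<close>, which tends to \<open>1\<close>, the
  approximate volume of \<open>U\<close> is the integral of \<open>1 / (\<rho> - \<delta>)\<^sup>2\<close> over \<open>U\<close>. A Lorentz map acts on the affine chart by
  a projective map \<open>x \<mapsto> num x / lam x\<close> whose denominator \<open>lam\<close> is affine and has no zero on the unit sphere.
  This map divides \<open>\<rho>\<close> by \<open>lam\<^sup>2\<close> and has Jacobian determinant \<open>\<plusminus> 1 / lam\<^sup>4\<close>, so the change of variables turns
  the approximate volume of \<open>g U\<close> into the integral of \<open>1 / (\<rho> - \<delta> * lam\<^sup>2)\<^sup>2\<close> over the same \<open>U\<close>. The theorem thus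
  says that \<open>\<integral>\<^sub>U 1 / (\<rho> - \<delta> * \<lambda>\<^sup>2)\<^sup>2\<close> has a limit which is the same for \<open>\<lambda> = lam\<close> and for \<open>\<lambda> = 1\<close>: the choice of
  the affine gauge \<open>\<lambda>\<close> does not matter (\<open>has_common_limit_one\<close>).

  Away from the sphere this is dominated convergence, since \<open>\<bar>\<rho> - \<delta> * \<lambda>\<^sup>2\<bar> \<ge> \<bar>\<rho>\<bar> / 2\<close>. A partition of unity reduces
  the rest to integrals of \<open>\<phi> / P\<^sup>2\<close> over \<open>U\<close>, with \<open>P = \<rho> - \<delta> * \<lambda>\<^sup>2\<close> and a \<open>C\<^sup>2\<close> bump function \<open>\<phi>\<close> near a point \<open>p\<close>
  of the sphere.

  Suppose first that, near \<open>p\<close>, the domain is a union of straight lines which are transversal to the sphere, one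
  direction \<open>v\<close> in each plane \<open>x $ k = const\<close>. Along each line one integrates by parts twice and replaces
  \<open>\<phi> / P\<^sup>2\<close> by a bounded weight times \<open>Ln (\<i> * P)\<close>. There are no boundary terms, since \<open>\<phi>\<close> has compact support and
  the domain does not cut the lines. The imaginary part of \<open>P\<close> is negative, so \<open>\<i> * P\<close> stays away from the branch
  cut, and a logarithm is integrable across the sphere. Dominated convergence gives a limit that contains only
  \<open>\<rho>\<close> and \<open>\<phi>\<close> (\<open>ruled_limit\<close>).

  A general \<open>U\<close> is compared with such a ruled set. Transversality supplies coordinate planes \<open>x $ k = const\<close> in which
  frontier and sphere cross in one point, and the lines are taken parallel to the tangent of the frontier at that
  crossing (\<open>straightened_at_frontier\<close>). If \<open>u\<close> is the position along the tangent, measured from the crossing, then the two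
  sets differ only at distance \<open>O(\<bar>u\<bar> powr (1 + \<alpha>))\<close> from the tangent line, by the Hoelder condition, while
  \<open>\<bar>\<rho>\<bar> \<ge> H * \<bar>u\<bar>\<close> there, with a constant \<open>H > 0\<close>, by transversality. So \<open>1 / \<rho>\<^sup>2\<close> is integrable over the difference, because
  \<open>\<bar>u\<bar> powr (1 + \<alpha>) / u\<^sup>2\<close> is integrable at \<open>0\<close>, and the difference contributes \<open>\<integral> \<phi> / \<rho>\<^sup>2\<close> for every gauge
  (\<open>straightened_limit\<close>).
\<close>

section \<open>Dominated convergence and slice coordinates\<close>

lemma dominated_convergence_at_right:
  fixes s :: "real \<Rightarrow> 'a \<Rightarrow> 'b::{banach, second_countable_topology}"
  assumes "f \<in> borel_measurable M" "\<And>\<epsilon>. s \<epsilon> \<in> borel_measurable M" "integrable M w"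
    and lim: "AE x in M. ((\<lambda>\<epsilon>. s \<epsilon> x) \<longlongrightarrow> f x) (at_right 0)"
    and bound: "eventually (\<lambda>\<epsilon>. AE x in M. norm (s \<epsilon> x) \<le> w x) (at_right 0)"
  shows "((\<lambda>\<epsilon>. integral\<^sup>L M (s \<epsilon>)) \<longlongrightarrow> integral\<^sup>L M f) (at_right 0)"
  unfolding filterlim_at_right_to_top
  by (rule integral_dominated_convergence_at_top[where w=w])
     (use assms in \<open>simp_all add: filterlim_at_right_to_top eventually_at_right_to_top\<close>)

text \<open>
  The coordinate \<open>s\<close> runs along a line of slope \<open>m z\<close> in the plane \<open>x $ k = z\<close>, and \<open>t\<close> tells which of these parallel lines
  it is. The pair \<open>zt = (z, t)\<close> thus names a line of \<open>real^3\<close>.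
\<close>

definition slice :: "3 \<Rightarrow> 3 \<Rightarrow> 3 \<Rightarrow> (real \<Rightarrow> real) \<Rightarrow> real \<times> real \<Rightarrow> real \<Rightarrow> real^3" where
  "slice i j k m zt s = s *\<^sub>R (axis i 1 + m (fst zt) *\<^sub>R axis j 1) + (snd zt *\<^sub>R axis j 1 + fst zt *\<^sub>R axis k 1)"

lemma UNIV_3_distinct:
  fixes i j k :: 3
  assumes "distinct [i, j, k]"
  shows "UNIV = {i, j, k}"
proof -
  have "card {i, j, k} = CARD(3)" using assms by simp
  then show ?thesis by (metis card_subset_eq finite subset_UNIV)
qed

lemma slice_nth:
  assumes "distinct [i, j, k]"
  shows "slice i j k m zt s $ i = s" "slice i j k m zt s $ j = snd zt + m (fst zt) * s"
    "slice i j k m zt s $ k = fst zt"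
  using assms by (auto simp: slice_def axis_def)

lemma measurable_slice:
  assumes [measurable]: "m \<in> borel_measurable borel"
  shows "(\<lambda>p. slice i j k m (fst p) (snd p)) \<in> borel_measurable borel"
  unfolding slice_def borel_prod[symmetric] by measurable

text \<open>
  For each fixed third coordinate \<open>z\<close> the map \<open>(t, s) \<mapsto> slice i j k m (z, t) s\<close> is a shear of the plane. A shear
  preserves area with no regularity of the slope \<open>m\<close> beyond measurability; the slope will be the tangent slope of
  the frontier, which is only known to be continuous in \<open>z\<close>.
\<close>

lemma lborel_distr_slice:
  assumes m[measurable]: "m \<in> borel_measurable borel" and d: "distinct [i, j, k]"
  shows "distr lborel borel (\<lambda>p. slice i j k m (fst p) (snd p)) = lborel"
proof (rule lborel_eqI[symmetric])
  fix l u :: "real^3"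
  assume lu: "\<And>b. b \<in> Basis \<Longrightarrow> l \<bullet> b \<le> u \<bullet> b"
  have le: "l $ n \<le> u $ n" for n
    using lu[of "axis n 1"] by (simp add: inner_axis)
  let ?I = "\<lambda>n x. indicator {l$n <..< u$n} x :: ennreal"
  have ind: "indicator (box l u) (slice i j k m (z, t) s) = ?I k z * (?I i s * ?I j (t + m z * s))" for z t s
  proof -
    have "x \<in> box l u \<longleftrightarrow> (\<forall>n\<in>{i, j, k}. l $ n < x $ n \<and> x $ n < u $ n)" for x
      unfolding UNIV_3_distinct[OF d, symmetric] by (simp add: mem_box_cart)
    then show ?thesis by (auto simp: indicator_def slice_nth[OF d])
  qed
  note [measurable] = measurable_slice[OF m, unfolded borel_prod[symmetric]]
  have "emeasure (distr lborel borel (\<lambda>p. slice i j k m (fst p) (snd p))) (box l u)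
      = (\<integral>\<^sup>+p. indicator (box l u) (slice i j k m (fst p) (snd p)) \<partial>((lborel \<Otimes>\<^sub>M lborel) \<Otimes>\<^sub>M lborel))"
  proof -
    have "emeasure (distr lborel borel (\<lambda>p. slice i j k m (fst p) (snd p))) (box l u)
      = (\<integral>\<^sup>+x. indicator (box l u) x \<partial>distr lborel borel (\<lambda>p. slice i j k m (fst p) (snd p)))"
      by (rule nn_integral_indicator[symmetric]) simp
    then show ?thesis
      by (subst (asm) nn_integral_distr) (simp_all add: measurable_slice lborel_prod del: nn_integral_indicator)
  qed
  also have "\<dots> = (\<integral>\<^sup>+z. \<integral>\<^sup>+t. \<integral>\<^sup>+s. ?I k z * (?I i s * ?I j (t + m z * s)) \<partial>lborel \<partial>lborel \<partial>lborel)"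
    by (subst lborel.nn_integral_fst[symmetric], simp)
       (subst lborel.nn_integral_fst[symmetric], simp, simp add: ind)
  also have "\<dots> = (\<integral>\<^sup>+z. \<integral>\<^sup>+s. \<integral>\<^sup>+t. ?I k z * (?I i s * ?I j (t + m z * s)) \<partial>lborel \<partial>lborel \<partial>lborel)"
    by (intro nn_integral_cong lborel_pair.Fubini') simp
  also have "\<dots> = (\<integral>\<^sup>+z. \<integral>\<^sup>+s. ?I k z * (?I i s * ennreal (u$j - l$j)) \<partial>lborel \<partial>lborel)"
  proof -
    have "(\<integral>\<^sup>+t. ?I j (t + c) \<partial>lborel) = ennreal (u$j - l$j)" for c
    proof -
      have "(\<integral>\<^sup>+t. ?I j (t + c) \<partial>lborel) = (\<integral>\<^sup>+t. ?I j t \<partial>lborel)"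
        using nn_integral_real_affine[of "\<lambda>t. ?I j t" 1 c] by (simp add: add.commute)
      then show ?thesis using le by simp
    qed
    then show ?thesis by (simp add: nn_integral_cmult)
  qed
  also have "\<dots> = ennreal (u$k - l$k) * (ennreal (u$i - l$i) * ennreal (u$j - l$j))"
    using le by (simp add: nn_integral_cmult nn_integral_multc)
  also have "\<dots> = ennreal (\<Prod>b\<in>Basis. (u - l) \<bullet> b)"
  proof -
    have "(\<Prod>b\<in>Basis. (u - l) \<bullet> b) = (\<Prod>n\<in>UNIV. (u - l) $ n)"
      unfolding Basis_vec_def
      by (subst prod.UNION_disjoint) (auto simp: axis_eq_axis inner_axis)
    also have "\<dots> = (u$k - l$k) * ((u$i - l$i) * (u$j - l$j))"
      using d by (simp add: UNIV_3_distinct[OF d] mult_ac)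
    finally show ?thesis using le by (simp add: ennreal_mult)
  qed
  finally show "emeasure (distr lborel borel (\<lambda>p. slice i j k m (fst p) (snd p))) (box l u)
      = ennreal (\<Prod>b\<in>Basis. (u - l) \<bullet> b)" .
qed simp

lemma nn_integral_slice:
  assumes m: "m \<in> borel_measurable borel" and d: "distinct [i, j, k]" and [measurable]: "f \<in> borel_measurable borel"
  shows "(\<integral>\<^sup>+x. f x \<partial>lborel) = (\<integral>\<^sup>+z. \<integral>\<^sup>+s. \<integral>\<^sup>+t. f (slice i j k m (z, t) s) \<partial>lborel \<partial>lborel \<partial>lborel)"
proof -
  note [measurable] = measurable_slice[OF m, unfolded borel_prod[symmetric]]
  have "(\<integral>\<^sup>+x. f x \<partial>lborel) = (\<integral>\<^sup>+p. f (slice i j k m (fst p) (snd p)) \<partial>((lborel \<Otimes>\<^sub>M lborel) \<Otimes>\<^sub>M lborel))"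
    by (subst lborel_distr_slice[OF m d, symmetric]) (simp add: nn_integral_distr measurable_slice[OF m] lborel_prod)
  also have "\<dots> = (\<integral>\<^sup>+z. \<integral>\<^sup>+t. \<integral>\<^sup>+s. f (slice i j k m (z, t) s) \<partial>lborel \<partial>lborel \<partial>lborel)"
    by (subst lborel.nn_integral_fst[symmetric], simp)
       (subst lborel.nn_integral_fst[symmetric], simp_all)
  also have "\<dots> = (\<integral>\<^sup>+z. \<integral>\<^sup>+s. \<integral>\<^sup>+t. f (slice i j k m (z, t) s) \<partial>lborel \<partial>lborel \<partial>lborel)"
    by (rule nn_integral_cong, rule lborel_pair.Fubini') (simp add: slice_def)
  finally show ?thesis .
qed

lemma integral_slice:
  fixes f :: "real^3 \<Rightarrow> 'b::{banach, second_countable_topology}"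
  assumes m: "m \<in> borel_measurable borel" and d: "distinct [i, j, k]" and f: "integrable lborel f"
  shows "(LINT x|lborel. f x) = (LINT zt|lborel. LINT s|lborel. f (slice i j k m zt s))"
proof -
  note [measurable] = measurable_slice[OF m, unfolded borel_prod[symmetric]] borel_measurable_integrable[OF f]
  let ?T = "\<lambda>p. slice i j k m (fst p) (snd p)"
  have "integrable (distr lborel borel ?T) f"
    using f by (simp add: lborel_distr_slice[OF m d])
  then have int: "integrable (lborel \<Otimes>\<^sub>M lborel) (\<lambda>p. f (?T p))"
    by (simp add: integrable_distr_eq measurable_slice[OF m] lborel_prod)
  have "(LINT x|lborel. f x) = (LINT p|(lborel \<Otimes>\<^sub>M lborel). f (?T p))"
    by (subst lborel_distr_slice[OF m d, symmetric]) (simp add: integral_distr measurable_slice[OF m] lborel_prod)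
  also have "\<dots> = (LINT zt|lborel. LINT s|lborel. f (slice i j k m zt s))"
    using lborel_pair.integral_fst'[OF int] by simp
  finally show ?thesis .
qed

section \<open>Integration by parts twice along a line\<close>

lemma has_vector_derivative_inverse_complex:
  fixes P :: "real \<Rightarrow> complex"
  assumes "(P has_vector_derivative P') (at s)" "P s \<noteq> 0"
  shows "((\<lambda>s. inverse (P s)) has_vector_derivative (- P' * inverse (P s)^2)) (at s)"
  using field_vector_diff_chain_at[OF assms(1) DERIV_inverse[OF assms(2)]]
  by (simp add: o_def power2_eq_square)

text \<open>
  Rotating by \<open>\<i>\<close> moves the lower half plane to the right half plane. Unlike \<open>Ln P\<close>, the function \<open>Ln (\<i> * P)\<close>
  is then still continuous when \<open>P\<close> reaches a nonzero real limit from below.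
\<close>

lemma has_vector_derivative_Ln_rotated:
  fixes P :: "real \<Rightarrow> complex"
  assumes "(P has_vector_derivative P') (at s)" "Im (P s) < 0"
  shows "((\<lambda>s. Ln (\<i> * P s)) has_vector_derivative (P' * inverse (P s))) (at s)"
proof -
  have nz: "\<i> * P s \<notin> \<real>\<^sub>\<le>\<^sub>0" "P s \<noteq> 0"
    using assms(2) by (auto simp: complex_nonpos_Reals_iff)
  have "((\<lambda>w. Ln (\<i> * w)) has_field_derivative inverse (P s)) (at (P s))"
    using nz by (auto intro!: derivative_eq_intros simp: field_simps)
  from field_vector_diff_chain_at[OF assms(1) this]
  show ?thesis by (simp add: o_def)
qed

text \<open>
  The algebra behind the next lemma, with \<open>a\<close> for \<open>1 / P'\<close>, \<open>b\<close> for \<open>1 / P\<close> and \<open>l\<close> for the logarithm.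
\<close>

lemma double_primitive_identity:
  fixes u u1 u2 p a b l q :: complex
  assumes "p * a = 1"
  shows "(u1 * p - u * q) * (a * (a * a)) * (p * b) +
      ((u1 * p - u * q) * (a * (a * (- q * a^2) + - q * a^2 * a) + - q * a^2 * (a * a))
        + (u1 * q + u2 * p - (u * 0 + u1 * q)) * (a * (a * a))) * l
      - (u * a * (- p * b^2) + (u * (- q * a^2) + u1 * a) * b)
      = u * b^2 + (u2 * p^2 - 3 * q * (u1 * p - u * q)) * a^4 * l" (is "?l = ?r")
proof -
  have "?l - ?r = (p * a - 1) * (u1 * a * b * (p * a + 1) - u * q * a^2 * b - u2 * p * a^3 * l + u * b^2)"
    by (simp add: algebra_simps power2_eq_square power3_eq_cube power4_eq_xxxx)
  then show ?thesis using assms by simp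
qed

text \<open>
  With \<open>A = g / P'\<close> one has \<open>(A / P)' = A' / P - g / P\<^sup>2\<close>, and with \<open>B = A' / P'\<close> one has
  \<open>(B * Ln (\<i> * P))' = B' * Ln (\<i> * P) + A' / P\<close>. Hence \<open>B * Ln (\<i> * P) - A / P\<close> differs from a primitive of
  \<open>g / P\<^sup>2\<close> only by a primitive of \<open>B' * Ln (\<i> * P)\<close>. The derivative \<open>P''\<close> is the constant \<open>P2\<close> because \<open>P\<close> will be
  quadratic along straight lines, which keeps \<open>B'\<close> free of third derivatives.
\<close>

lemma vector_derivative_double_primitive:
  fixes g g1 :: "real \<Rightarrow> real" and P P1 :: "real \<Rightarrow> complex" and P2 :: complex
  assumes g: "(g has_real_derivative g1 s) (at s)" and g1: "(g1 has_real_derivative g2) (at s)"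
    and P: "(P has_vector_derivative P1 s) (at s)" and P1: "(P1 has_vector_derivative P2) (at s)"
    and "Im (P s) < 0" "P1 s \<noteq> 0"
  shows "((\<lambda>s. (g1 s * P1 s - g s * P2) * inverse (P1 s)^3 * Ln (\<i> * P s)
             - g s * inverse (P1 s) * inverse (P s)) has_vector_derivative
          (g s / P s^2 + (g2 * P1 s^2 - 3 * P2 * (g1 s * P1 s - g s * P2)) / P1 s^4 * Ln (\<i> * P s))) (at s)"
proof -
  have nz: "P s \<noteq> 0" using \<open>Im (P s) < 0\<close> by auto
  have c: "((\<lambda>s. complex_of_real (g s)) has_vector_derivative of_real (g1 s)) (at s)"
    "((\<lambda>s. complex_of_real (g1 s)) has_vector_derivative of_real g2) (at s)"
    using g g1 by (auto intro!: has_vector_derivative_of_real simp: has_real_derivative_iff_has_vector_derivative)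
  note i1 = has_vector_derivative_inverse_complex[OF P1 \<open>P1 s \<noteq> 0\<close>]
  note i = has_vector_derivative_inverse_complex[OF P nz]
  note L = has_vector_derivative_Ln_rotated[OF P \<open>Im (P s) < 0\<close>]
  note i3 = has_vector_derivative_mult[OF i1 has_vector_derivative_mult[OF i1 i1]]
  note N = has_vector_derivative_diff[OF has_vector_derivative_mult[OF c(2) P1]
      has_vector_derivative_mult[OF c(1) has_vector_derivative_const[of P2]]]
  note T = has_vector_derivative_diff[OF has_vector_derivative_mult[OF has_vector_derivative_mult[OF N i3] L]
      has_vector_derivative_mult[OF has_vector_derivative_mult[OF c(1) i1] i]]
  have fn: "(\<lambda>s. (g1 s * P1 s - g s * P2) * inverse (P1 s)^3 * Ln (\<i> * P s) - g s * inverse (P1 s) * inverse (P s))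
    = (\<lambda>s. (g1 s * P1 s - g s * P2) * (inverse (P1 s) * (inverse (P1 s) * inverse (P1 s))) * Ln (\<i> * P s)
        - g s * inverse (P1 s) * inverse (P s))"
    by (simp add: power3_eq_cube mult.assoc)
  show ?thesis
    unfolding fn
  proof (rule has_vector_derivative_eq_rhs[OF T])
    show "(g1 s * P1 s - g s * P2) * (inverse (P1 s) * (inverse (P1 s) * inverse (P1 s))) * (P1 s * inverse (P s)) +
      ((g1 s * P1 s - g s * P2) * (inverse (P1 s) * (inverse (P1 s) * (- P2 * (inverse (P1 s))\<^sup>2) + - P2 * (inverse (P1 s))\<^sup>2 * inverse (P1 s))
        + - P2 * (inverse (P1 s))\<^sup>2 * (inverse (P1 s) * inverse (P1 s)))
        + (g1 s * P2 + g2 * P1 s - (of_real (g s) * 0 + g1 s * P2)) * (inverse (P1 s) * (inverse (P1 s) * inverse (P1 s)))) * Ln (\<i> * P s)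
      - (g s * inverse (P1 s) * (- P1 s * (inverse (P s))\<^sup>2) + (g s * (- P2 * (inverse (P1 s))\<^sup>2) + g1 s * inverse (P1 s)) * inverse (P s))
      = g s / P s^2 + (g2 * P1 s^2 - 3 * P2 * (g1 s * P1 s - g s * P2)) / P1 s^4 * Ln (\<i> * P s)"
      unfolding divide_inverse power_inverse[symmetric]
      by (rule double_primitive_identity) (use \<open>P1 s \<noteq> 0\<close> in simp)
  qed
qed

text \<open>
  The set \<open>S\<close> allows \<open>P\<close> to degenerate outside a neighbourhood of the support \<open>K\<close> of \<open>g\<close>: there all integrands vanish,
  whatever the value that division by zero gives to the quotients.
\<close>

lemma line_integral_by_parts:
  fixes g g1 g2 :: "real \<Rightarrow> real" and P P1 :: "real \<Rightarrow> complex" and P2 :: complex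
  defines "L \<equiv> \<lambda>s. (g2 s * P1 s^2 - 3 * P2 * (g1 s * P1 s - g s * P2)) / P1 s^4 * Ln (\<i> * P s)"
  assumes g: "\<And>s. (g has_real_derivative g1 s) (at s)" and g1: "\<And>s. (g1 has_real_derivative g2 s) (at s)"
    and g2: "continuous_on UNIV g2"
    and P: "\<And>s. (P has_vector_derivative P1 s) (at s)" and P1: "\<And>s. (P1 has_vector_derivative P2) (at s)"
    and "open S" "compact K" "K \<subseteq> S" and supp: "\<And>s. s \<notin> K \<Longrightarrow> g s = 0"
    and S: "\<And>s. s \<in> S \<Longrightarrow> Im (P s) < 0" "\<And>s. s \<in> S \<Longrightarrow> P1 s \<noteq> 0"
  shows "(LINT s|lborel. g s / P s^2) = - (LINT s|lborel. L s)"
proof -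
  have oK: "open (- K)" using \<open>compact K\<close> by (simp add: compact_imp_closed open_Compl)
  have SK: "S \<union> - K = UNIV" using \<open>K \<subseteq> S\<close> by auto
  have g1z: "g1 s = 0" if "s \<notin> K" for s
  proof -
    have "(g has_real_derivative 0) (at s)"
      by (rule has_field_derivative_transform_within_open[OF _ oK]) (use that supp in auto)
    then show ?thesis using g DERIV_unique by blast
  qed
  have g2z: "g2 s = 0" if "s \<notin> K" for s
  proof -
    have "(g1 has_real_derivative 0) (at s)"
      by (rule has_field_derivative_transform_within_open[OF _ oK]) (use that g1z in auto)
    then show ?thesis using g1 DERIV_unique by blast
  qed
  define T where "T = (\<lambda>s. (g1 s * P1 s - g s * P2) * inverse (P1 s)^3 * Ln (\<i> * P s)
             - g s * inverse (P1 s) * inverse (P s))"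
  let ?f = "\<lambda>s. g s / P s^2"
  have ig: "isCont g s" "isCont g1 s" "isCont P s" "isCont P1 s" for s
    using DERIV_isCont[OF g] DERIV_isCont[OF g1] has_vector_derivative_continuous[OF P]
      has_vector_derivative_continuous[OF P1] by auto
  have cg: "continuous_on X g" "continuous_on X g1" "continuous_on X g2" "continuous_on X P" "continuous_on X P1" for X
    using ig continuous_on_subset[OF g2 subset_UNIV] by (simp_all add: continuous_at_imp_continuous_on)
  have Pnz: "P s \<noteq> 0" "\<i> * P s \<notin> \<real>\<^sub>\<le>\<^sub>0" if "s \<in> S" for s
    using S(1)[OF that] by (auto simp: complex_nonpos_Reals_iff)
  have T': "(T has_vector_derivative (?f s + L s)) (at s)" for s
  proof (cases "s \<in> S")
    case True
    show ?thesis unfolding T_def L_def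
      by (rule vector_derivative_double_primitive[OF g g1 P P1 S(1)[OF True] S(2)[OF True]])
  next
    case False
    then have "s \<in> - K" using SK by auto
    moreover from this have "?f s + L s = 0" by (simp add: L_def supp g1z g2z)
    ultimately show ?thesis
      using has_vector_derivative_transform_within_open[OF has_vector_derivative_const[of 0] oK, of s T]
      by (simp add: T_def supp g1z)
  qed
  have cf: "continuous_on UNIV ?f"
    unfolding SK[symmetric]
  proof (rule continuous_on_open_Un[OF \<open>open S\<close> oK])
    show "continuous_on S ?f" by (intro continuous_intros cg) (use Pnz in auto)
    show "continuous_on (- K) ?f" by (rule continuous_on_eq[of _ "\<lambda>_. 0"]) (auto simp: supp)
  qed
  have cL: "continuous_on UNIV L"
    unfolding SK[symmetric]
  proof (rule continuous_on_open_Un[OF \<open>open S\<close> oK])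
    show "continuous_on S L" unfolding L_def by (intro continuous_intros cg) (use Pnz S in auto)
    show "continuous_on (- K) L" by (rule continuous_on_eq[of _ "\<lambda>_. 0"]) (auto simp: L_def supp g1z g2z)
  qed
  obtain R where R: "\<And>s. s \<in> K \<Longrightarrow> \<bar>s\<bar> < R" "0 < R"
    using compact_imp_bounded[OF \<open>compact K\<close>] by (auto simp: bounded_pos_less)
  have sz: "g s = 0" "L s = 0" if "s \<notin> {-R..R}" for s
  proof -
    have "s \<notin> K" using R(1)[of s] that by auto
    then show "g s = 0" "L s = 0" by (simp_all add: L_def supp g1z g2z)
  qed
  have ind: "indicator {-R..R} s *\<^sub>R ?f s = ?f s" "indicator {-R..R} s *\<^sub>R L s = L s" for s
    using sz[of s] by (auto split: split_indicator)
  have i: "integrable lborel ?f" "integrable lborel L"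
    using borel_integrable_compact[OF compact_Icc continuous_on_subset[OF cf subset_UNIV], of "-R" R]
      borel_integrable_compact[OF compact_Icc continuous_on_subset[OF cL subset_UNIV], of "-R" R]
    by (simp_all only: ind)
  have "(LINT s|lborel. indicator {-R..R} s *\<^sub>R (?f s + L s)) = T R - T (-R)"
  proof (rule integral_FTC_Icc)
    show "- R \<le> R" using R by simp
    show "continuous_on {- R..R} (\<lambda>s. ?f s + L s)"
      by (rule continuous_on_subset[OF continuous_on_add[OF cf cL]]) simp
  qed (rule has_vector_derivative_at_within[OF T'])
  moreover have "R \<notin> K" "- R \<notin> K" using R(1)[of R] R(1)[of "- R"] by auto
  ultimately have "(LINT s|lborel. ?f s + L s) = 0"
    by (simp add: scaleR_add_right ind T_def supp g1z)
  then show ?thesis using Bochner_Integration.integral_add[OF i] by (simp add: eq_neg_iff_add_eq_0)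
qed

section \<open>Integrable singularities on the sphere\<close>

lemma nn_integral_abs_powr_finite:
  fixes \<beta> R :: real
  assumes "\<beta> > -1" "R \<ge> 0"
  shows "(\<integral>\<^sup>+u. ennreal (indicator {-R..R} u * \<bar>u\<bar> powr \<beta>) \<partial>lborel) < \<infinity>"
proof -
  let ?f = "\<lambda>u. ennreal (indicator {0..R} u * u powr \<beta>)"
  have hi: "((\<lambda>u. u powr \<beta>) has_integral (R powr (\<beta>+1) / (\<beta>+1))) {0..R}"
    using has_integral_powr_from_0[OF assms] .
  have fin: "(\<integral>\<^sup>+u. ?f u \<partial>lborel) < \<infinity>"
  proof -
    have "(\<integral>\<^sup>+u. ?f u \<partial>lborel) = ennreal (R powr (\<beta>+1) / (\<beta>+1))"
    proof (rule nn_integral_has_integral_lborel)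
      show "((\<lambda>u. indicator {0..R} u * u powr \<beta>) has_integral (R powr (\<beta>+1) / (\<beta>+1))) UNIV"
      proof -
        have "(\<lambda>u. indicator {0..R} u * u powr \<beta>) = (\<lambda>u. if u \<in> {0..R} then u powr \<beta> else 0)"
          by (auto simp: indicator_def)
        then show ?thesis using hi by (simp only: has_integral_restrict_UNIV)
      qed
    qed (auto simp: indicator_def)
    then show ?thesis by simp
  qed
  have "(\<integral>\<^sup>+u. ennreal (indicator {-R..R} u * \<bar>u\<bar> powr \<beta>) \<partial>lborel) \<le> (\<integral>\<^sup>+u. ?f u + ?f (-u) \<partial>lborel)"
    by (intro nn_integral_mono) (auto simp: indicator_def ennreal_plus[symmetric] simp del: ennreal_plus)
  also have "\<dots> = (\<integral>\<^sup>+u. ?f u \<partial>lborel) + (\<integral>\<^sup>+u. ?f (-u) \<partial>lborel)"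
    by (intro nn_integral_add) auto
  also have "(\<integral>\<^sup>+u. ?f (-u) \<partial>lborel) = (\<integral>\<^sup>+u. ?f u \<partial>lborel)"
    using nn_integral_real_affine[of ?f "-1" 0] by simp
  finally show ?thesis using fin by (simp add: ennreal_add_eq_top less_top order_le_less_trans)
qed

text \<open>
  The bound is uniform in \<open>A\<close> after integration over \<open>t\<close>. For \<open>A \<ge> 0\<close> it separates the two zeros of \<open>A - t\<^sup>2\<close>;
  with an exponent of \<open>-1/2\<close> in place of \<open>-1/4\<close> they could merge into a nonintegrable \<open>1 / \<bar>t\<bar>\<close>.
\<close>

lemma abs_diff_square_powr_le:
  fixes A t :: real
  assumes "t \<noteq> 0"
  defines "b \<equiv> sqrt (max A 0)"
  shows "\<bar>A - t^2\<bar> powr (-1/4) \<le> \<bar>t - b\<bar> powr (-1/2) + \<bar>t + b\<bar> powr (-1/2)"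
proof (cases "A \<ge> 0")
  case True
  then have "\<bar>A - t^2\<bar> = \<bar>t - b\<bar> * \<bar>t + b\<bar>"
    by (simp add: b_def abs_mult[symmetric] algebra_simps power2_eq_square abs_minus_commute)
  moreover have "(x * y) powr (-1/4) \<le> x powr (-1/2) + y powr (-1/2)" if "x \<ge> 0" "y \<ge> 0" for x y :: real
  proof -
    let ?X = "x powr (-1/4)" and ?Y = "y powr (-1/4)"
    have "?X * ?Y \<le> ?X^2 + ?Y^2"
      using sum_squares_bound[of ?X ?Y] mult_nonneg_nonneg[of ?X ?Y, OF powr_ge_zero powr_ge_zero]
      by linarith
    moreover have "?X^2 = x powr (-1/2)" "?Y^2 = y powr (-1/2)"
      by (simp_all add: power2_eq_square powr_add[symmetric])
    ultimately show ?thesis using that by (simp add: powr_mult)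
  qed
  ultimately show ?thesis by simp
next
  case False
  then have "\<bar>A - t^2\<bar> powr (-1/4) \<le> (t^2) powr (-1/4)"
    using assms(1) by (intro powr_mono2') auto
  also have "\<dots> = \<bar>t\<bar> powr (-1/2)"
    using powr_powr[of "\<bar>t\<bar>" 2 "-1/4"] assms(1) by simp
  also have "\<dots> \<le> \<bar>t\<bar> powr (-1/2) + \<bar>t\<bar> powr (-1/2)"
    using powr_ge_zero[of "\<bar>t\<bar>" "-1/2"] by linarith
  finally show ?thesis using False by (simp add: b_def max_def)
qed

text \<open>
  This dominates the logarithmic singularity on the sphere, since \<open>\<bar>ln y\<bar> \<le> y + 4 * y powr (-1/4)\<close>.
\<close>

lemma integrable_shell_powr:
  fixes R :: real
  assumes "R \<ge> 0"
  shows "integrable lborel (\<lambda>x::real^3. indicator (cball 0 R) x * \<bar>1 - x \<bullet> x\<bar> powr (-1/4))"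
proof (rule integrableI_bounded)
  show "(\<lambda>x::real^3. indicator (cball 0 R) x * \<bar>1 - x \<bullet> x\<bar> powr (-1/4)) \<in> borel_measurable lborel"
    using borel_measurable_indicator[OF borel_closed[OF closed_cball]] by measurable
  define J where "J = (\<integral>\<^sup>+u. ennreal (indicator {-1..1} u * \<bar>u\<bar> powr (-1/2)) \<partial>lborel)"
  have J: "J < \<infinity>" unfolding J_def by (rule nn_integral_abs_powr_finite) auto
  have one: "(\<integral>\<^sup>+t. ennreal (indicator {-R..R} t * \<bar>t - b\<bar> powr (-1/2)) \<partial>lborel) \<le> J + ennreal (2 * R)" for b
  proof -
    have "(\<integral>\<^sup>+t. ennreal (indicator {-R..R} t * \<bar>t - b\<bar> powr (-1/2)) \<partial>lborel)
       \<le> (\<integral>\<^sup>+t. ennreal (indicator {-1..1} (t - b) * \<bar>t - b\<bar> powr (-1/2)) + indicator {-R..R} t \<partial>lborel)"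
    proof (intro nn_integral_mono)
      fix t :: real
      have "\<bar>t - b\<bar> powr (-1/2) \<le> 1" if "\<not> \<bar>t - b\<bar> \<le> 1"
        using that powr_mono2'[of "-1/2" 1 "\<bar>t - b\<bar>"] by simp
      then show "ennreal (indicator {-R..R} t * \<bar>t - b\<bar> powr (-1/2))
        \<le> ennreal (indicator {-1..1} (t - b) * \<bar>t - b\<bar> powr (-1/2)) + indicator {-R..R} t"
        by (auto simp: indicator_def)
    qed
    also have "\<dots> = (\<integral>\<^sup>+t. ennreal (indicator {-1..1} (t - b) * \<bar>t - b\<bar> powr (-1/2)) \<partial>lborel) + ennreal (2 * R)"
      using assms by (subst nn_integral_add) auto
    also have "(\<integral>\<^sup>+t. ennreal (indicator {-1..1} (t - b) * \<bar>t - b\<bar> powr (-1/2)) \<partial>lborel) = J"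
      using nn_integral_real_affine[of "\<lambda>t. ennreal (indicator {-1..1} t * \<bar>t\<bar> powr (-1/2))" 1 "-b"]
      by (simp add: J_def)
    finally show ?thesis .
  qed
  define B where "B = (J + ennreal (2 * R)) + (J + ennreal (2 * R))"
  have two: "(\<integral>\<^sup>+t. ennreal (indicator {-R..R} t * \<bar>A - t^2\<bar> powr (-1/4)) \<partial>lborel) \<le> B" for A
  proof -
    let ?b = "sqrt (max A 0)"
    have "(\<integral>\<^sup>+t. ennreal (indicator {-R..R} t * \<bar>A - t^2\<bar> powr (-1/4)) \<partial>lborel)
      \<le> (\<integral>\<^sup>+t. ennreal (indicator {-R..R} t * \<bar>t - ?b\<bar> powr (-1/2)) + ennreal (indicator {-R..R} t * \<bar>t - (-?b)\<bar> powr (-1/2)) \<partial>lborel)"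
    proof (rule nn_integral_mono_AE)
      have "AE t in lborel. t \<noteq> (0::real)" by (rule AE_lborel_singleton)
      then show "AE t in lborel. ennreal (indicator {-R..R} t * \<bar>A - t^2\<bar> powr (-1/4))
        \<le> ennreal (indicator {-R..R} t * \<bar>t - ?b\<bar> powr (-1/2)) + ennreal (indicator {-R..R} t * \<bar>t - (-?b)\<bar> powr (-1/2))"
      proof eventually_elim
        case (elim t)
        then show ?case using abs_diff_square_powr_le[OF elim, of A]
          by (auto simp: indicator_def ennreal_plus[symmetric] simp del: ennreal_plus intro!: ennreal_leI)
      qed
    qed
    also have "\<dots> \<le> B"
      unfolding B_def by (subst nn_integral_add, simp, simp) (intro add_mono one)
    finally show ?thesis .
  qed
  have d: "distinct [1, 2, 3::3]" by simp
  have dot: "x \<bullet> x = (x$3)^2 + (x$1)^2 + (x$2)^2" for x :: "real^3"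
    by (simp add: inner_vec_def sum_3 power2_eq_square)
  have "(\<integral>\<^sup>+(x::real^3). ennreal (norm (indicator (cball 0 R) x * \<bar>1 - x \<bullet> x\<bar> powr (-1/4))) \<partial>lborel)
    \<le> (\<integral>\<^sup>+(x::real^3). ennreal (indicator {-R..R} (x$3)) * (ennreal (indicator {-R..R} (x$1)) *
         ennreal (indicator {-R..R} (x$2) * \<bar>(1 - (x$3)^2 - (x$1)^2) - (x$2)^2\<bar> powr (-1/4))) \<partial>lborel)"
  proof (intro nn_integral_mono)
    fix x :: "real^3"
    have "x $ n \<le> R" "- R \<le> x $ n" if "norm x \<le> R" for n
      using that component_le_norm_cart[of x n] by linarith+
    then show "ennreal (norm (indicator (cball 0 R) x * \<bar>1 - x \<bullet> x\<bar> powr (-1/4)))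
      \<le> ennreal (indicator {-R..R} (x$3)) * (ennreal (indicator {-R..R} (x$1)) *
         ennreal (indicator {-R..R} (x$2) * \<bar>(1 - (x$3)^2 - (x$1)^2) - (x$2)^2\<bar> powr (-1/4)))"
      by (auto simp: indicator_def dot algebra_simps)
  qed
  also have "\<dots> = (\<integral>\<^sup>+z. \<integral>\<^sup>+s. \<integral>\<^sup>+t. ennreal (indicator {-R..R} z) * (ennreal (indicator {-R..R} s) *
         ennreal (indicator {-R..R} t * \<bar>(1 - z^2 - s^2) - t^2\<bar> powr (-1/4))) \<partial>lborel \<partial>lborel \<partial>lborel)"
    by (subst nn_integral_slice[of "\<lambda>_. 0" 1 2 3]) (simp_all add: slice_nth[OF d])
  also have "\<dots> = (\<integral>\<^sup>+z. \<integral>\<^sup>+s. ennreal (indicator {-R..R} z) * (ennreal (indicator {-R..R} s) *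
         (\<integral>\<^sup>+t. ennreal (indicator {-R..R} t * \<bar>(1 - z^2 - s^2) - t^2\<bar> powr (-1/4)) \<partial>lborel)) \<partial>lborel \<partial>lborel)"
    by (simp add: nn_integral_cmult)
  also have "\<dots> \<le> (\<integral>\<^sup>+z. \<integral>\<^sup>+s. ennreal (indicator {-R..R} z) * (ennreal (indicator {-R..R} s) * B) \<partial>lborel \<partial>lborel)"
    by (intro nn_integral_mono mult_left_mono two) auto
  also have "\<dots> = ennreal (2*R) * (ennreal (2*R) * B)"
    using assms by (simp add: nn_integral_cmult nn_integral_multc ennreal_indicator)
  also have "\<dots> < \<infinity>" using J by (simp add: B_def ennreal_mult_less_top)
  finally show "(\<integral>\<^sup>+(x::real^3). ennreal (norm (indicator (cball 0 R) x * \<bar>1 - x \<bullet> x\<bar> powr (-1/4))) \<partial>lborel) < \<infinity>" .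
qed

section \<open>The regularized denominator and test functions\<close>

definition delta_eps :: "real \<Rightarrow> complex" where
  "delta_eps \<epsilon> = 1 - (d_eps \<epsilon>)^2"

text \<open>
  The affine function \<open>a + c \<bullet> x\<close> is the gauge; \<open>a = 1\<close> and \<open>c = 0\<close> give the denominator of the volume density, and
  the denominator of a Lorentz map gives the pulled back density. The functions \<open>den1\<close> and \<open>den2\<close> below are the first two
  derivatives of \<open>den\<close> in the direction \<open>v\<close>.
\<close>

definition den :: "complex \<Rightarrow> real \<Rightarrow> real^3 \<Rightarrow> real^3 \<Rightarrow> complex" where
  "den \<delta> a c x = of_real (1 - x \<bullet> x) - \<delta> * of_real ((a + c \<bullet> x)^2)"

definition den1 :: "complex \<Rightarrow> real \<Rightarrow> real^3 \<Rightarrow> real^3 \<Rightarrow> real^3 \<Rightarrow> complex" where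
  "den1 \<delta> a c x v = of_real (- 2 * (x \<bullet> v)) - \<delta> * of_real (2 * (a + c \<bullet> x) * (c \<bullet> v))"

definition den2 :: "complex \<Rightarrow> real^3 \<Rightarrow> real^3 \<Rightarrow> complex" where
  "den2 \<delta> c v = of_real (- 2 * (v \<bullet> v)) - \<delta> * of_real (2 * (c \<bullet> v)^2)"

abbreviation integrand :: "(real^3 \<Rightarrow> real) \<Rightarrow> real \<Rightarrow> real \<Rightarrow> real^3 \<Rightarrow> real^3 \<Rightarrow> complex" where
  "integrand \<phi> \<epsilon> a c x \<equiv> of_real (\<phi> x) / (den (delta_eps \<epsilon>) a c x)^2"

lemma delta_eps_eq: "delta_eps \<epsilon> = Complex (\<epsilon>^2) (2 * \<epsilon>)"
  by (simp add: delta_eps_def d_eps_def complex_eq_iff power2_eq_square)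

lemma Im_den: "Im (den (delta_eps \<epsilon>) a c x) = - 2 * \<epsilon> * (a + c \<bullet> x)^2"
  by (simp add: den_def delta_eps_eq)

lemma tendsto_delta_eps: "(delta_eps \<longlongrightarrow> 0) (at_right 0)"
proof -
  have "(delta_eps \<longlongrightarrow> delta_eps 0) (at_right 0)"
    unfolding delta_eps_def d_eps_def by (intro tendsto_intros)
  then show ?thesis by (simp add: delta_eps_def d_eps_def)
qed

text \<open>
  If the real part \<open>\<rho> - \<epsilon>\<^sup>2 * \<kappa>\<close> is small compared with \<open>\<rho>\<close>, then \<open>\<epsilon>\<^sup>2 * \<kappa>\<close> is large, and the imaginary part
  \<open>- 2 * \<epsilon> * \<kappa>\<close> is even larger.
\<close>

lemma norm_den_ge:
  assumes "0 < \<epsilon>" "\<epsilon> \<le> 1"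
  shows "\<bar>1 - x \<bullet> x\<bar> / 2 \<le> norm (den (delta_eps \<epsilon>) a c x)"
proof -
  define \<rho> \<kappa> where "\<rho> = 1 - x \<bullet> x" and "\<kappa> = (a + c \<bullet> x)^2"
  have k: "\<kappa> \<ge> 0" by (simp add: \<kappa>_def)
  have RI: "Re (den (delta_eps \<epsilon>) a c x) = \<rho> - \<epsilon>^2 * \<kappa>" "Im (den (delta_eps \<epsilon>) a c x) = - (2 * \<epsilon> * \<kappa>)"
    by (simp_all add: den_def delta_eps_eq \<rho>_def \<kappa>_def)
  have "\<bar>\<rho>\<bar> / 2 \<le> norm (den (delta_eps \<epsilon>) a c x)"
  proof (cases "\<epsilon>^2 * \<kappa> \<le> \<bar>\<rho>\<bar> / 2")
    case True
    then have "\<bar>\<rho>\<bar> / 2 \<le> \<bar>Re (den (delta_eps \<epsilon>) a c x)\<bar>"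
      using k mult_nonneg_nonneg[OF zero_le_power2 k, of \<epsilon>] unfolding RI by linarith
    then show ?thesis using abs_Re_le_cmod order_trans by blast
  next
    case False
    have "\<epsilon>^2 * \<kappa> \<le> \<epsilon> * \<kappa>"
      using assms k by (intro mult_right_mono) (auto simp: power2_eq_square mult_le_cancel_left1)
    then have "\<bar>\<rho>\<bar> / 2 \<le> \<bar>Im (den (delta_eps \<epsilon>) a c x)\<bar>"
      using False k assms unfolding RI by (simp add: abs_mult)
    then show ?thesis using abs_Im_le_cmod order_trans by blast
  qed
  then show ?thesis by (simp add: \<rho>_def)
qed

lemma tendsto_den:
  "((\<lambda>\<epsilon>. den (delta_eps \<epsilon>) a c x) \<longlongrightarrow> of_real (1 - x \<bullet> x)) (at_right 0)"
  unfolding den_def by (rule tendsto_eq_intros tendsto_delta_eps refl)+ simp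

lemma continuous_on_den [continuous_intros]:
  "continuous_on X f \<Longrightarrow> continuous_on X g \<Longrightarrow> continuous_on X (\<lambda>x. den (f x) a c (g x))"
  "continuous_on X f \<Longrightarrow> continuous_on X g \<Longrightarrow> continuous_on X h \<Longrightarrow> continuous_on X (\<lambda>x. den1 (f x) a c (g x) (h x))"
  "continuous_on X f \<Longrightarrow> continuous_on X h \<Longrightarrow> continuous_on X (\<lambda>x. den2 (f x) c (h x))"
  unfolding den_def den1_def den2_def by (intro continuous_intros; assumption)+

lemma den_line_derivative:
  "((\<lambda>s. den \<delta> a c (q + s *\<^sub>R v)) has_vector_derivative den1 \<delta> a c (q + s *\<^sub>R v) v) (at s)"
  "((\<lambda>s. den1 \<delta> a c (q + s *\<^sub>R v) v) has_vector_derivative den2 \<delta> c v) (at s)"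
proof -
  have lin: "((\<lambda>s. c \<bullet> (q + s *\<^sub>R v)) has_real_derivative c \<bullet> v) (at s)" for c
    by (auto intro!: derivative_eq_intros simp: inner_add_right)
  have sq: "((\<lambda>s. (q + s *\<^sub>R v) \<bullet> (q + s *\<^sub>R v)) has_real_derivative 2 * ((q + s *\<^sub>R v) \<bullet> v)) (at s)"
    unfolding inner_add_left inner_add_right
    by (auto intro!: derivative_eq_intros simp: inner_commute algebra_simps)
  have "((\<lambda>s. 1 - (q + s *\<^sub>R v) \<bullet> (q + s *\<^sub>R v)) has_real_derivative - 2 * ((q + s *\<^sub>R v) \<bullet> v)) (at s)"
    by (rule derivative_eq_intros sq refl)+ simp
  moreover have "((\<lambda>s. (a + c \<bullet> (q + s *\<^sub>R v))^2) has_real_derivative 2 * (a + c \<bullet> (q + s *\<^sub>R v)) * (c \<bullet> v)) (at s)"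
    by (rule derivative_eq_intros lin refl)+ simp
  ultimately show "((\<lambda>s. den \<delta> a c (q + s *\<^sub>R v)) has_vector_derivative den1 \<delta> a c (q + s *\<^sub>R v) v) (at s)"
    unfolding den_def den1_def
    by (intro has_vector_derivative_diff has_vector_derivative_mult_right has_vector_derivative_of_real)
       (auto simp: has_real_derivative_iff_has_vector_derivative)
  have "((\<lambda>s. - 2 * ((q + s *\<^sub>R v) \<bullet> v)) has_real_derivative - 2 * (v \<bullet> v)) (at s)"
    using DERIV_cmult[OF lin[of v], of "-2"] by (simp add: inner_commute)
  moreover have "((\<lambda>s. 2 * (a + c \<bullet> (q + s *\<^sub>R v)) * (c \<bullet> v)) has_real_derivative 2 * (c \<bullet> v)^2) (at s)"
    by (rule derivative_eq_intros lin refl)+ (simp add: power2_eq_square)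
  ultimately show "((\<lambda>s. den1 \<delta> a c (q + s *\<^sub>R v) v) has_vector_derivative den2 \<delta> c v) (at s)"
    unfolding den1_def den2_def
    by (intro has_vector_derivative_diff has_vector_derivative_mult_right has_vector_derivative_of_real)
       (auto simp: has_real_derivative_iff_has_vector_derivative)
qed

text \<open>
  Only derivatives along lines are ever taken, so \<open>\<phi>1 x v\<close> and \<open>\<phi>2 x v\<close> are the first two directional derivatives
  at \<open>x\<close>. Continuity in \<open>x\<close> and \<open>v\<close> jointly makes them bounded when both range over compact sets.
\<close>

definition C2_along_lines ::
    "(real^3 \<Rightarrow> real) \<Rightarrow> (real^3 \<Rightarrow> real^3 \<Rightarrow> real) \<Rightarrow> (real^3 \<Rightarrow> real^3 \<Rightarrow> real) \<Rightarrow> bool" where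
  "C2_along_lines \<phi> \<phi>1 \<phi>2 \<longleftrightarrow>
     continuous_on UNIV \<phi> \<and> continuous_on UNIV (\<lambda>(x, v). \<phi>1 x v) \<and> continuous_on UNIV (\<lambda>(x, v). \<phi>2 x v) \<and>
     (\<forall>q v s. ((\<lambda>s. \<phi> (q + s *\<^sub>R v)) has_real_derivative \<phi>1 (q + s *\<^sub>R v) v) (at s) \<and>
              ((\<lambda>s. \<phi>1 (q + s *\<^sub>R v) v) has_real_derivative \<phi>2 (q + s *\<^sub>R v) v) (at s))"

text \<open>
  The factor of \<open>Ln (\<i> * P)\<close> after two integrations by parts in the direction \<open>v\<close>; here \<open>u\<close>, \<open>u1\<close>, \<open>u2\<close> are the
  values of a test function and of its first two derivatives in that direction.
\<close>

definition log_weight :: "complex \<Rightarrow> real \<Rightarrow> real^3 \<Rightarrow> real \<Rightarrow> real \<Rightarrow> real \<Rightarrow> real^3 \<Rightarrow> real^3 \<Rightarrow> complex" where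
  "log_weight \<delta> a c u u1 u2 x v =
     (of_real u2 * (den1 \<delta> a c x v)^2 - 3 * den2 \<delta> c v * (of_real u1 * den1 \<delta> a c x v - of_real u * den2 \<delta> c v))
       / (den1 \<delta> a c x v)^4"

lemma continuous_on_supported:
  fixes f :: "'a::topological_space \<Rightarrow> 'b::real_normed_vector"
  assumes "continuous_on W f" "open W" "closed C" "C \<subseteq> W" "\<And>x. x \<notin> C \<Longrightarrow> f x = 0"
  shows "continuous_on UNIV f"
proof -
  have "continuous_on (W \<union> - C) f"
  proof (rule continuous_on_open_Un)
    show "continuous_on (- C) f" by (rule continuous_on_eq[of _ "\<lambda>_. 0"]) (use assms in auto)
  qed (use assms in auto)
  moreover have "W \<union> - C = UNIV" using assms by auto
  ultimately show ?thesis by simp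
qed

lemma integrable_supported:
  fixes f :: "real^3 \<Rightarrow> 'b::{banach, second_countable_topology}"
  assumes "continuous_on UNIV f" "compact C" "\<And>x. x \<notin> C \<Longrightarrow> f x = 0"
  shows "integrable lborel f"
proof -
  have "(\<lambda>x. indicator C x *\<^sub>R f x) = f" using assms(3) by (auto simp: indicator_def)
  then show ?thesis
    using borel_integrable_compact[OF assms(2) continuous_on_subset[OF assms(1) subset_UNIV]] by simp
qed

lemma C2_along_lines_derivs_vanish:
  assumes "C2_along_lines \<phi> \<phi>1 \<phi>2" "closed C" "\<And>x. x \<notin> C \<Longrightarrow> \<phi> x = 0" "x \<notin> C"
  shows "\<phi>1 x v = 0" "\<phi>2 x v = 0"
proof -
  have op: "open {s. x + s *\<^sub>R v \<notin> C}" for x v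
  proof -
    have "continuous_on UNIV (\<lambda>s. x + s *\<^sub>R v)" by (intro continuous_intros)
    from open_vimage[OF open_Compl[OF assms(2)] this] show ?thesis by (simp add: vimage_def)
  qed
  have one: "\<phi>1 x v = 0" if "x \<notin> C" for x v
  proof -
    have "((\<lambda>s. \<phi> (x + s *\<^sub>R v)) has_real_derivative 0) (at 0)"
      by (rule has_field_derivative_transform_within_open[OF _ op, of "\<lambda>_. 0"]) (use that assms in auto)
    moreover have "((\<lambda>s. \<phi> (x + s *\<^sub>R v)) has_real_derivative \<phi>1 (x + 0 *\<^sub>R v) v) (at 0)"
      using assms(1) unfolding C2_along_lines_def by blast
    ultimately show ?thesis using DERIV_unique by fastforce
  qed
  show "\<phi>1 x v = 0" using one assms by blast
  have "((\<lambda>s. \<phi>1 (x + s *\<^sub>R v) v) has_real_derivative 0) (at 0)"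
    by (rule has_field_derivative_transform_within_open[OF _ op, of "\<lambda>_. 0"]) (use one assms in auto)
  moreover have "((\<lambda>s. \<phi>1 (x + s *\<^sub>R v) v) has_real_derivative \<phi>2 (x + 0 *\<^sub>R v) v) (at 0)"
    using assms(1) unfolding C2_along_lines_def by blast
  ultimately show "\<phi>2 x v = 0" using DERIV_unique by fastforce
qed

lemma integrable_test_div_den:
  assumes "C2_along_lines \<phi> \<phi>1 \<phi>2" "\<epsilon> > 0" "open W" "compact C" "C \<subseteq> W"
    and "\<And>x. x \<notin> C \<Longrightarrow> \<phi> x = 0" "\<And>x. x \<in> W \<Longrightarrow> a + c \<bullet> x \<noteq> 0" "A \<in> sets borel"
  shows "integrable lborel (\<lambda>x. indicator A x *\<^sub>R (integrand \<phi> \<epsilon> a c x))"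
proof -
  have nz: "den (delta_eps \<epsilon>) a c x \<noteq> 0" if "x \<in> W" for x
    using Im_den[of \<epsilon> a c x] assms(2) assms(7)[OF that] by auto
  have "continuous_on UNIV (\<lambda>x. \<phi> x / (den (delta_eps \<epsilon>) a c x)^2)"
  proof (rule continuous_on_supported[OF _ assms(3) compact_imp_closed[OF assms(4)] assms(5)])
    have "continuous_on W \<phi>" using assms(1) unfolding C2_along_lines_def by (blast intro: continuous_on_subset)
    then show "continuous_on W (\<lambda>x. \<phi> x / (den (delta_eps \<epsilon>) a c x)^2)"
      by (intro continuous_intros) (use nz in auto)
  qed (use assms in auto)
  then show ?thesis
    by (intro integrable_mult_indicator integrable_supported[OF _ assms(4)]) (use assms in auto)
qed

section \<open>Ruled sets\<close>

definition slice_dir :: "3 \<Rightarrow> 3 \<Rightarrow> 3 \<Rightarrow> (real \<Rightarrow> real) \<Rightarrow> real^3 \<Rightarrow> real^3" where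
  "slice_dir i j k m x = axis i 1 + m (x $ k) *\<^sub>R axis j 1"

text \<open>
  In each plane \<open>x $ k = const\<close> a ruled set is a union of parallel lines of slope \<open>m (x $ k)\<close>.
\<close>

definition ruled :: "3 \<Rightarrow> 3 \<Rightarrow> 3 \<Rightarrow> (real \<Rightarrow> real) \<Rightarrow> (real \<times> real) set \<Rightarrow> (real^3) set" where
  "ruled i j k m S = {x. (x $ k, x $ j - m (x $ k) * x $ i) \<in> S}"

lemma slice_eq_line:
  assumes "distinct [i, j, k]"
  shows "slice i j k m zt s = slice i j k m zt 0 + s *\<^sub>R slice_dir i j k m (slice i j k m zt t)"
  unfolding slice_dir_def slice_nth(3)[OF assms] by (simp add: slice_def)

lemma measurable_slice_dir:
  assumes [measurable]: "m \<in> borel_measurable borel"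
  shows "slice_dir i j k m \<in> borel_measurable borel"
  unfolding slice_dir_def by measurable

lemma sets_ruled:
  assumes [measurable]: "m \<in> borel_measurable borel" "S \<in> sets borel"
  shows "ruled i j k m S \<in> sets borel"
proof -
  have "(\<lambda>x::real^3. (x $ k, x $ j - m (x $ k) * x $ i)) \<in> borel_measurable borel"
    unfolding borel_prod[symmetric] by measurable
  from measurable_sets[OF this assms(2)] show ?thesis by (simp add: ruled_def vimage_def)
qed

text \<open>
  In slice coordinates the indicator function of a ruled set is constant along every line, so the identity on lines
  can be multiplied by it and integrated.
\<close>

lemma ruled_integral_by_parts:
  fixes m :: "real \<Rightarrow> real"
  assumes C2: "C2_along_lines \<phi> \<phi>1 \<phi>2" and "\<epsilon> > 0" and W: "open W" and C: "compact C" "C \<subseteq> W"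
    and supp: "\<And>x. x \<notin> C \<Longrightarrow> \<phi> x = 0" and nz: "\<And>x. x \<in> W \<Longrightarrow> a + c \<bullet> x \<noteq> 0"
    and nz1: "\<And>x. x \<in> W \<Longrightarrow> den1 (delta_eps \<epsilon>) a c x (slice_dir i j k m x) \<noteq> 0"
    and m: "m \<in> borel_measurable borel" and S: "S \<in> sets borel" and d: "distinct [i, j, k]"
  defines "E \<equiv> \<lambda>x. let v = slice_dir i j k m x in
      log_weight (delta_eps \<epsilon>) a c (\<phi> x) (\<phi>1 x v) (\<phi>2 x v) x v * Ln (\<i> * den (delta_eps \<epsilon>) a c x)"
  assumes int: "integrable lborel (\<lambda>x. indicator (ruled i j k m S) x *\<^sub>R E x)"
  shows "(LINT x|lborel. indicator (ruled i j k m S) x *\<^sub>R (integrand \<phi> \<epsilon> a c x))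
     = - (LINT x|lborel. indicator (ruled i j k m S) x *\<^sub>R E x)"
proof -
  let ?sl = "slice i j k m" and ?d = "delta_eps \<epsilon>"
  have ru: "?sl zt s \<in> ruled i j k m S \<longleftrightarrow> zt \<in> S" for zt s
    by (simp add: ruled_def slice_nth[OF d])
  have ind: "indicator (ruled i j k m S) (?sl zt s) = (indicator S zt :: real)" for zt s
    by (simp add: indicator_def ru)
  have line: "(LINT s|lborel. \<phi> (?sl zt s) / (den ?d a c (?sl zt s))^2) = - (LINT s|lborel. E (?sl zt s))" for zt
  proof -
    define q v where "q = ?sl zt 0" and "v = slice_dir i j k m q"
    have sl: "?sl zt s = q + s *\<^sub>R v" for s
      unfolding q_def v_def by (rule slice_eq_line[OF d])
    have dir: "slice_dir i j k m (q + s *\<^sub>R v) = v" for s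
    proof -
      have "?sl zt s $ k = q $ k" by (simp add: q_def slice_nth[OF d])
      then have "(q + s *\<^sub>R v) $ k = q $ k" unfolding sl .
      then show ?thesis unfolding slice_dir_def by (simp only: v_def slice_dir_def)
    qed
    have cont: "continuous_on UNIV (\<lambda>s. q + s *\<^sub>R v)" by (intro continuous_intros)
    have opW: "open {s. q + s *\<^sub>R v \<in> W}"
      using open_vimage[OF W cont] by (simp add: vimage_def)
    have clC: "closed {s. q + s *\<^sub>R v \<in> C}"
      using closed_vimage[OF compact_imp_closed[OF C(1)] cont] by (simp add: vimage_def)
    obtain R where R: "\<And>x. x \<in> C \<Longrightarrow> norm x \<le> R"
      using compact_imp_bounded[OF C(1)] by (auto simp: bounded_iff)
    have "bounded {s. q + s *\<^sub>R v \<in> C}"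
    proof (rule boundedI)
      fix s assume "s \<in> {s. q + s *\<^sub>R v \<in> C}"
      then have "norm (?sl zt s) \<le> R" using R by (simp add: sl)
      then show "norm s \<le> R"
        using component_le_norm_cart[of "?sl zt s" i] by (simp add: slice_nth[OF d])
    qed
    then have cpC: "compact {s. q + s *\<^sub>R v \<in> C}" using clC by (simp add: compact_eq_bounded_closed)
    have C2': "((\<lambda>s. \<phi> (q + s *\<^sub>R v)) has_real_derivative \<phi>1 (q + s *\<^sub>R v) v) (at s)"
      "((\<lambda>s. \<phi>1 (q + s *\<^sub>R v) v) has_real_derivative \<phi>2 (q + s *\<^sub>R v) v) (at s)" for s
      using C2 unfolding C2_along_lines_def by blast+
    have cont2: "continuous_on UNIV (\<lambda>s. \<phi>2 (q + s *\<^sub>R v) v)"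
    proof -
      have "continuous_on UNIV (\<lambda>(x, v). \<phi>2 x v)" using C2 unfolding C2_along_lines_def by blast
      from continuous_on_compose2[OF this, of UNIV "\<lambda>s. (q + s *\<^sub>R v, v)"]
      show ?thesis by (simp add: cont continuous_on_Pair)
    qed
    have "(LINT s|lborel. \<phi> (q + s *\<^sub>R v) / (den ?d a c (q + s *\<^sub>R v))^2)
      = - (LINT s|lborel. (of_real (\<phi>2 (q + s *\<^sub>R v) v) * (den1 ?d a c (q + s *\<^sub>R v) v)^2
          - 3 * den2 ?d c v * (of_real (\<phi>1 (q + s *\<^sub>R v) v) * den1 ?d a c (q + s *\<^sub>R v) v - of_real (\<phi> (q + s *\<^sub>R v)) * den2 ?d c v))
        / (den1 ?d a c (q + s *\<^sub>R v) v)^4 * Ln (\<i> * den ?d a c (q + s *\<^sub>R v)))"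
    proof (rule line_integral_by_parts[OF C2' cont2 den_line_derivative opW cpC])
      show "{s. q + s *\<^sub>R v \<in> C} \<subseteq> {s. q + s *\<^sub>R v \<in> W}" using C by auto
      show "Im (den ?d a c (q + s *\<^sub>R v)) < 0" if "s \<in> {s. q + s *\<^sub>R v \<in> W}" for s
        using that nz \<open>\<epsilon> > 0\<close> by (simp add: Im_den)
      show "den1 ?d a c (q + s *\<^sub>R v) v \<noteq> 0" if "s \<in> {s. q + s *\<^sub>R v \<in> W}" for s
        using that nz1[of "q + s *\<^sub>R v"] by (simp add: dir)
    qed (use supp in auto)
    then show ?thesis by (simp add: sl E_def Let_def dir log_weight_def)
  qed
  have "(LINT x|lborel. indicator (ruled i j k m S) x *\<^sub>R (\<phi> x / (den ?d a c x)^2))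
     = (LINT zt|lborel. LINT s|lborel. indicator S zt *\<^sub>R (\<phi> (?sl zt s) / (den ?d a c (?sl zt s))^2))"
    by (subst integral_slice[OF m d integrable_test_div_den[OF C2 \<open>\<epsilon> > 0\<close> W C supp nz sets_ruled[OF m S]]])
       (simp_all add: ind)
  also have "\<dots> = (LINT zt|lborel. LINT s|lborel. - (indicator S zt *\<^sub>R E (?sl zt s)))"
    by (simp add: line)
  also have "\<dots> = - (LINT x|lborel. indicator (ruled i j k m S) x *\<^sub>R E x)"
    by (subst integral_slice[OF m d int]) (simp add: ind)
  finally show ?thesis .
qed

lemma abs_ln_le_powr:
  assumes "y > (0::real)"
  shows "\<bar>ln y\<bar> \<le> y + 4 * y powr (-1/4)"
proof -
  have "- ln y = 4 * ln (y powr (-1/4))" using assms by (simp add: ln_powr)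
  also have "\<dots> \<le> 4 * y powr (-1/4)"
    using ln_le_minus_one[of "y powr (-1/4)"] assms by simp
  finally have "- ln y \<le> 4 * y powr (-1/4)" .
  moreover have "ln y \<le> y" using ln_le_minus_one[OF assms] by simp
  moreover have "0 \<le> y powr (-1/4)" by simp
  ultimately show ?thesis using assms by linarith
qed

lemma norm_Ln_le:
  assumes "w \<noteq> 0"
  shows "norm (Ln w) \<le> norm w + 4 * norm w powr (-1/4) + pi"
proof -
  have "norm (Ln w) \<le> \<bar>Re (Ln w)\<bar> + \<bar>Im (Ln w)\<bar>" by (rule cmod_le)
  moreover have "\<bar>Im (Ln w)\<bar> \<le> pi"
    using mpi_less_Im_Ln[OF assms] Im_Ln_le_pi[OF assms] by linarith
  ultimately show ?thesis
    using abs_ln_le_powr[of "norm w"] assms by (simp add: Re_Ln)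
qed

lemma AE_not_on_sphere: "AE x::real^3 in lborel. x \<bullet> x \<noteq> 1"
proof -
  have "sphere (0::real^3) 1 \<in> null_sets lborel"
    using negligible_sphere[of "0::real^3" 1] by (auto simp: null_sets_completion_iff negligible_iff_null_sets)
  from AE_not_in[OF this] show ?thesis
    by eventually_elim (simp add: norm_eq_1)
qed

text \<open>
  The limit no longer mentions the gauge: at \<open>\<delta> = 0\<close> both \<open>den\<close> and its derivatives depend on \<open>x\<close> and \<open>v\<close> alone.
  The weight stays bounded because the derivative \<open>- 2 * (x \<bullet> v)\<close> of \<open>1 - x \<bullet> x\<close> along the lines stays away from
  zero, which is the transversality of the lines to the sphere.
\<close>

lemma ruled_limit:
  fixes m :: "real \<Rightarrow> real"
  assumes C2: "C2_along_lines \<phi> \<phi>1 \<phi>2" and W: "open W" "bounded W" and C: "compact C" "C \<subseteq> W"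
    and supp: "\<And>x. x \<notin> C \<Longrightarrow> \<phi> x = 0" and nz: "\<And>x. x \<in> W \<Longrightarrow> a + c \<bullet> x \<noteq> 0"
    and m: "m \<in> borel_measurable borel" and M: "\<And>z. \<bar>m z\<bar> \<le> M"
    and S: "S \<in> sets borel" and d: "distinct [i, j, k]"
    and c0: "c0 > 0" "\<And>x. x \<in> W \<Longrightarrow> c0 \<le> \<bar>x \<bullet> slice_dir i j k m x\<bar>"
  shows "((\<lambda>\<epsilon>. LINT x|lborel. indicator (ruled i j k m S) x *\<^sub>R (integrand \<phi> \<epsilon> a c x))
    \<longlongrightarrow> - (LINT x|lborel. indicator (ruled i j k m S) x *\<^sub>R (let v = slice_dir i j k m x in
          log_weight 0 0 0 (\<phi> x) (\<phi>1 x v) (\<phi>2 x v) x v * Ln (\<i> * of_real (1 - x \<bullet> x))))) (at_right 0)"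
proof -
  let ?R = "ruled i j k m S"
  define dir where "dir = slice_dir i j k m"
  define w where "w = (\<lambda>\<delta> (x, v). log_weight \<delta> a c (\<phi> x) (\<phi>1 x v) (\<phi>2 x v) x v)"
  define E where "E = (\<lambda>\<epsilon> x. w (delta_eps \<epsilon>) (x, dir x) * Ln (\<i> * den (delta_eps \<epsilon>) a c x))"
  define E0 where "E0 = (\<lambda>x. w 0 (x, dir x) * Ln (\<i> * of_real (1 - x \<bullet> x)))"
  have cphi: "continuous_on UNIV \<phi>" "continuous_on UNIV (\<lambda>(x, v). \<phi>1 x v)" "continuous_on UNIV (\<lambda>(x, v). \<phi>2 x v)"
    using C2 unfolding C2_along_lines_def by auto
  note [measurable] = measurable_slice_dir[OF m, of i j k, folded dir_def] m sets_ruled[OF m S]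
  have Cc: "closed C" using C(1) by (rule compact_imp_closed)
  obtain r where r: "r > 0" "\<And>x. x \<in> W \<Longrightarrow> norm x \<le> r"
    using W(2) by (auto simp: bounded_pos)
  have dir_le: "norm (dir x) \<le> 1 + M" for x
  proof -
    have "norm (dir x) \<le> norm (axis i 1 :: real^3) + \<bar>m (x $ k)\<bar> * norm (axis j 1 :: real^3)"
      unfolding dir_def slice_dir_def by (rule norm_triangle_le) simp
    then show ?thesis using M[of "x $ k"] by (simp add: norm_axis_1)
  qed
  have M0: "M \<ge> 0" using M[of 0] by linarith
  \<comment> \<open>\<open>N\<close> bounds the gauge part of \<open>den1\<close>, so for \<open>norm \<delta> \<le> c0 / (N + 1)\<close> the part \<open>- 2 * (x \<bullet> v)\<close> dominates\<close>
  define N where "N = 2 * (\<bar>a\<bar> + norm c * r) * (norm c * (1 + M))"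
  have N: "N \<ge> 0" using r M0 by (simp add: N_def)
  have g: "\<bar>2 * (a + c \<bullet> x) * (c \<bullet> v)\<bar> \<le> N" if "norm x \<le> r" "norm v \<le> 1 + M" for x v
  proof -
    have "\<bar>c \<bullet> x\<bar> \<le> norm c * r" "\<bar>c \<bullet> v\<bar> \<le> norm c * (1 + M)"
      using that Cauchy_Schwarz_ineq2[of c x] Cauchy_Schwarz_ineq2[of c v]
      by (meson mult_left_mono norm_ge_zero order_trans)+
    then show ?thesis unfolding N_def abs_mult
      by (intro mult_mono) auto
  qed
  define \<eta> where "\<eta> = c0 / (N + 1)"
  have \<eta>: "\<eta> > 0" using c0 N by (simp add: \<eta>_def)
  have den1_nz: "den1 \<delta> a c x v \<noteq> 0" if "norm \<delta> \<le> \<eta>" "norm x \<le> r" "norm v \<le> 1 + M" "c0 \<le> \<bar>x \<bullet> v\<bar>" for \<delta> x v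
  proof
    assume "den1 \<delta> a c x v = 0"
    then have "complex_of_real (- 2 * (x \<bullet> v)) = \<delta> * of_real (2 * (a + c \<bullet> x) * (c \<bullet> v))"
      by (simp add: den1_def)
    then have "\<bar>- 2 * (x \<bullet> v)\<bar> = norm \<delta> * \<bar>2 * (a + c \<bullet> x) * (c \<bullet> v)\<bar>"
      by (metis norm_mult norm_of_real)
    also have "\<dots> \<le> \<eta> * N" using that \<eta> by (intro mult_mono g) auto
    also have "\<dots> \<le> c0" using N c0 by (simp add: \<eta>_def divide_simps)
    finally show False using that c0 by (simp add: abs_mult)
  qed
  \<comment> \<open>the weight is continuous on a compact set of parameters, hence bounded\<close>
  define K where "K = (cball (0::complex) \<eta> \<times> cball (0::real^3) r \<times> cball (0::real^3) (1 + M)) \<inter> {(\<delta>, x, v). c0 \<le> \<bar>x \<bullet> v\<bar>}"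
  have "compact K" unfolding K_def
  proof (intro compact_Int_closed compact_Times compact_cball)
    show "closed {(\<delta>::complex, x::real^3, v). c0 \<le> \<bar>x \<bullet> v\<bar>}"
      unfolding case_prod_beta by (intro closed_Collect_le continuous_intros)
  qed
  have Knz: "den1 (fst p) a c (fst (snd p)) (snd (snd p)) \<noteq> 0" if "p \<in> K" for p
    by (rule den1_nz) (use that in \<open>auto simp: K_def\<close>)
  have "continuous_on K (\<lambda>p. w (fst p) (snd p))"
    unfolding w_def case_prod_beta log_weight_def
    by (intro continuous_intros continuous_on_compose2[OF cphi(1)]
        continuous_on_compose2[OF cphi(2), of K snd, simplified case_prod_beta]
        continuous_on_compose2[OF cphi(3), of K snd, simplified case_prod_beta])
       (use Knz in auto)
  then have bK: "bounded ((\<lambda>p. w (fst p) (snd p)) ` K)"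
    using \<open>compact K\<close> compact_continuous_image compact_imp_bounded by blast
  obtain B where B: "B > 0" "\<And>p. p \<in> K \<Longrightarrow> norm (w (fst p) (snd p)) \<le> B"
    using bK unfolding bounded_pos by blast
  define D where "D = 1 + r^2 + \<eta> * (\<bar>a\<bar> + norm c * r)^2"
  have D: "norm (den \<delta> a c x) \<le> D" if "norm \<delta> \<le> \<eta>" "norm x \<le> r" for \<delta> x
  proof -
    have "\<bar>c \<bullet> x\<bar> \<le> norm c * r"
      using that Cauchy_Schwarz_ineq2[of c x] by (meson mult_left_mono norm_ge_zero order_trans)
    then have "(a + c \<bullet> x)^2 \<le> (\<bar>a\<bar> + norm c * r)^2"
      by (intro abs_le_square_iff[THEN iffD1]) (auto simp: abs_le_iff)
    then have "norm (\<delta> * of_real ((a + c \<bullet> x)^2)) \<le> \<eta> * (\<bar>a\<bar> + norm c * r)^2"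
      using that \<eta> unfolding norm_mult norm_of_real by (intro mult_mono) auto
    moreover have "norm (complex_of_real (1 - x \<bullet> x)) \<le> 1 + r^2"
    proof -
      have "(norm x)^2 \<le> r^2" using that by (intro power_mono) auto
      then have "\<bar>1 - x \<bullet> x\<bar> \<le> 1 + r^2" by (simp add: dot_square_norm abs_le_iff)
      then show ?thesis by (simp only: norm_of_real)
    qed
    ultimately show ?thesis unfolding den_def D_def by (intro norm_triangle_le_diff) linarith
  qed
  have small: "\<forall>\<^sub>F \<epsilon> in at_right 0. 0 < \<epsilon> \<and> \<epsilon> \<le> 1 \<and> norm (delta_eps \<epsilon>) \<le> \<eta>"
  proof -
    have "\<forall>\<^sub>F \<epsilon> in at_right 0. 0 < \<epsilon> \<and> \<epsilon> < (1::real)"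
      by (intro eventually_conj eventually_at_right_less eventually_at_rightI[of 0 1]) auto
    moreover have "\<forall>\<^sub>F \<epsilon> in at_right 0. norm (delta_eps \<epsilon>) < \<eta>"
      using order_tendstoD(2)[OF tendsto_norm[OF tendsto_delta_eps], of \<eta>] \<eta> by simp
    ultimately show ?thesis by eventually_elim auto
  qed
  define dom where "dom = (\<lambda>x::real^3. B * ((D + pi) * indicator (cball 0 r) x + 8 * (indicator (cball 0 r) x * \<bar>1 - x \<bullet> x\<bar> powr (-1/4))))"
  have "integrable lborel (indicator (cball (0::real^3) r) :: _ \<Rightarrow> real)"
    by (rule integrable_real_indicator) (use emeasure_bounded_finite[OF bounded_cball, of "0::real^3" r] in auto)
  then have dom_int: "integrable lborel dom"
    unfolding dom_def
    by (intro integrable_mult_right Bochner_Integration.integrable_add integrable_shell_powr) (use r in auto)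
  have wz: "w \<delta> (x, v) = 0" if "x \<notin> C" for \<delta> x v
    using supp[OF that] C2_along_lines_derivs_vanish[OF C2 Cc supp that, of v]
    by (simp add: w_def log_weight_def)
  have dom_ge: "norm (E \<epsilon> x) \<le> dom x" if e: "0 < \<epsilon>" "\<epsilon> \<le> 1" "norm (delta_eps \<epsilon>) \<le> \<eta>" and x: "x \<bullet> x \<noteq> 1" for \<epsilon> x
  proof (cases "x \<in> C")
    case False
    have "0 \<le> D" using r \<eta> by (auto simp: D_def intro!: add_nonneg_nonneg mult_nonneg_nonneg)
    then show ?thesis using wz[OF False] B(1) by (simp add: E_def dom_def)
  next
    case True
    then have xW: "x \<in> W" using C by auto
    then have xr: "norm x \<le> r" using r by auto
    let ?d = "den (delta_eps \<epsilon>) a c x"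
    have "(delta_eps \<epsilon>, x, dir x) \<in> K"
      using e xr dir_le[of x] c0(2)[OF xW] by (simp add: K_def dir_def)
    from B(2)[OF this] have b: "norm (w (delta_eps \<epsilon>) (x, dir x)) \<le> B" by simp
    have y: "0 < \<bar>1 - x \<bullet> x\<bar> / 2" "\<bar>1 - x \<bullet> x\<bar> / 2 \<le> norm ?d" "?d \<noteq> 0"
      using x norm_den_ge[OF e(1,2), of x a c] by auto
    have "norm (Ln (\<i> * ?d)) \<le> norm ?d + 4 * norm ?d powr (-1/4) + pi"
      using norm_Ln_le[of "\<i> * ?d"] y(3) by (simp add: norm_mult)
    moreover have "norm ?d powr (-1/4) \<le> (\<bar>1 - x \<bullet> x\<bar> / 2) powr (-1/4)"
      using y by (intro powr_mono2') auto
    moreover have "(\<bar>1 - x \<bullet> x\<bar> / 2) powr (-1/4) \<le> 2 * \<bar>1 - x \<bullet> x\<bar> powr (-1/4)"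
    proof -
      have "(\<bar>1 - x \<bullet> x\<bar> / 2) powr (-1/4) = \<bar>1 - x \<bullet> x\<bar> powr (-1/4) * 2 powr (1/4)"
        by (simp add: powr_divide powr_minus field_simps)
      moreover have "(2::real) powr (1/4) \<le> 2 powr 1" by (rule powr_mono) auto
      ultimately show ?thesis
        using mult_right_mono[of "2 powr (1/4)" 2 "\<bar>1 - x \<bullet> x\<bar> powr (-1/4)"] by (simp add: mult.commute)
    qed
    ultimately have "norm (Ln (\<i> * ?d)) \<le> (D + pi) + 8 * \<bar>1 - x \<bullet> x\<bar> powr (-1/4)"
      using D[OF e(3) xr] by linarith
    then have "norm (E \<epsilon> x) \<le> B * ((D + pi) + 8 * \<bar>1 - x \<bullet> x\<bar> powr (-1/4))"
      unfolding E_def norm_mult using b B(1) by (intro mult_mono) auto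
    then show ?thesis using xr by (simp add: dom_def)
  qed
  have phi_m: "(\<lambda>x. \<phi>1 x (dir x)) \<in> borel_measurable borel" "(\<lambda>x. \<phi>2 x (dir x)) \<in> borel_measurable borel"
    "\<phi> \<in> borel_measurable borel"
  proof -
    have p: "(\<lambda>x. (x, dir x)) \<in> borel_measurable borel" unfolding borel_prod[symmetric] by measurable
    show "(\<lambda>x. \<phi>1 x (dir x)) \<in> borel_measurable borel" "(\<lambda>x. \<phi>2 x (dir x)) \<in> borel_measurable borel"
      using measurable_compose[OF p borel_measurable_continuous_onI[OF cphi(2)]]
        measurable_compose[OF p borel_measurable_continuous_onI[OF cphi(3)]] by simp_all
    show "\<phi> \<in> borel_measurable borel" by (rule borel_measurable_continuous_onI[OF cphi(1)])
  qed
  note [measurable] = phi_m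
  have Ln_m [measurable]: "Ln \<in> borel_measurable borel" by (rule Ln_measurable)
  have Em: "E \<epsilon> \<in> borel_measurable borel" "E0 \<in> borel_measurable borel" for \<epsilon>
    unfolding E_def E0_def w_def log_weight_def den1_def den2_def den_def case_prod_conv by measurable
  have lim: "((\<lambda>\<epsilon>. E \<epsilon> x) \<longlongrightarrow> E0 x) (at_right 0)" if x: "x \<bullet> x \<noteq> 1" for x
  proof (cases "x \<in> C")
    case False
    then show ?thesis by (simp add: E_def E0_def wz)
  next
    case True
    then have xW: "x \<in> W" using C by auto
    then have xr: "norm x \<le> r" using r by auto
    have K0: "den1 0 a c x (dir x) \<noteq> 0"
      using den1_nz[of 0 x "dir x"] \<eta> xr dir_le[of x] c0(2)[OF xW] by (simp add: dir_def)
    have t1: "((\<lambda>\<epsilon>. den1 (delta_eps \<epsilon>) a c x v) \<longlongrightarrow> den1 0 a c x v) (at_right 0)" for v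
      unfolding den1_def by (intro tendsto_intros tendsto_delta_eps)
    have t2: "((\<lambda>\<epsilon>. den2 (delta_eps \<epsilon>) c v) \<longlongrightarrow> den2 0 c v) (at_right 0)" for v
      unfolding den2_def by (intro tendsto_intros tendsto_delta_eps)
    have "((\<lambda>\<epsilon>. w (delta_eps \<epsilon>) (x, dir x)) \<longlongrightarrow> w 0 (x, dir x)) (at_right 0)"
      unfolding w_def case_prod_conv log_weight_def
      by (intro tendsto_intros t1 t2) (use K0 in auto)
    moreover have "((\<lambda>\<epsilon>. Ln (\<i> * den (delta_eps \<epsilon>) a c x)) \<longlongrightarrow> Ln (\<i> * of_real (1 - x \<bullet> x))) (at_right 0)"
      using x by (intro tendsto_Ln tendsto_mult tendsto_const tendsto_den) (auto simp: complex_nonpos_Reals_iff)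
    ultimately show ?thesis unfolding E_def E0_def by (rule tendsto_mult)
  qed
  have "((\<lambda>\<epsilon>. LINT x|lborel. indicator ?R x *\<^sub>R E \<epsilon> x) \<longlongrightarrow> (LINT x|lborel. indicator ?R x *\<^sub>R E0 x)) (at_right 0)"
  proof (rule dominated_convergence_at_right[OF _ _ dom_int])
    show "AE x in lborel. ((\<lambda>\<epsilon>. indicator ?R x *\<^sub>R E \<epsilon> x) \<longlongrightarrow> indicator ?R x *\<^sub>R E0 x) (at_right 0)"
      using AE_not_on_sphere by eventually_elim (intro tendsto_scaleR tendsto_const lim)
    show "\<forall>\<^sub>F \<epsilon> in at_right 0. AE x in lborel. norm (indicator ?R x *\<^sub>R E \<epsilon> x) \<le> dom x"
      using small
    proof eventually_elim
      case (elim \<epsilon>)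
      show ?case using AE_not_on_sphere
      proof eventually_elim
        fix x :: "real^3" assume "x \<bullet> x \<noteq> 1"
        with dom_ge[of \<epsilon> x] elim have "norm (E \<epsilon> x) \<le> dom x" by blast
        moreover have "norm (indicator ?R x *\<^sub>R E \<epsilon> x) \<le> norm (E \<epsilon> x)" by (simp add: indicator_def)
        ultimately show "norm (indicator ?R x *\<^sub>R E \<epsilon> x) \<le> dom x" by (rule order_trans[rotated])
      qed
    qed
  qed (use Em in measurable)
  then have "((\<lambda>\<epsilon>. - (LINT x|lborel. indicator ?R x *\<^sub>R E \<epsilon> x)) \<longlongrightarrow> - (LINT x|lborel. indicator ?R x *\<^sub>R E0 x)) (at_right 0)"
    by (rule tendsto_minus)
  moreover have "\<forall>\<^sub>F \<epsilon> in at_right 0. - (LINT x|lborel. indicator ?R x *\<^sub>R E \<epsilon> x) =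
     (LINT x|lborel. indicator ?R x *\<^sub>R (integrand \<phi> \<epsilon> a c x))"
    using small
  proof eventually_elim
    case (elim \<epsilon>)
    have nz1: "den1 (delta_eps \<epsilon>) a c x (slice_dir i j k m x) \<noteq> 0" if "x \<in> W" for x
      using elim r(2)[OF that] dir_le[of x] c0(2)[OF that] by (intro den1_nz) (auto simp: dir_def)
    have Ee: "E \<epsilon> = (\<lambda>x. let v = slice_dir i j k m x in
      log_weight (delta_eps \<epsilon>) a c (\<phi> x) (\<phi>1 x v) (\<phi>2 x v) x v * Ln (\<i> * den (delta_eps \<epsilon>) a c x))"
      by (simp add: E_def w_def dir_def Let_def)
    have int: "integrable lborel (\<lambda>x. indicator ?R x *\<^sub>R E \<epsilon> x)"
    proof (intro integrable_mult_indicator, simp, rule Bochner_Integration.integrable_bound[OF dom_int])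
      show "AE x in lborel. norm (E \<epsilon> x) \<le> norm (dom x)"
        using AE_not_on_sphere
      proof eventually_elim
        fix x :: "real^3" assume "x \<bullet> x \<noteq> 1"
        with dom_ge[of \<epsilon> x] elim have "norm (E \<epsilon> x) \<le> dom x" by blast
        then show "norm (E \<epsilon> x) \<le> norm (dom x)" by (simp add: abs_le_iff)
      qed
    qed (use Em in simp)
    have e: "\<epsilon> > 0" using elim by simp
    show ?case
      using ruled_integral_by_parts[OF C2 e W(1) C supp nz nz1 m S d int[unfolded Ee]] unfolding Ee by simp
  qed
  ultimately have "((\<lambda>\<epsilon>. LINT x|lborel. indicator ?R x *\<^sub>R (integrand \<phi> \<epsilon> a c x))
    \<longlongrightarrow> - (LINT x|lborel. indicator ?R x *\<^sub>R E0 x)) (at_right 0)"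
    by (rule Lim_transform_eventually)
  moreover have "E0 x = (let v = slice_dir i j k m x in
          log_weight 0 0 0 (\<phi> x) (\<phi>1 x v) (\<phi>2 x v) x v * Ln (\<i> * of_real (1 - x \<bullet> x)))" for x
    by (simp add: E0_def w_def dir_def Let_def log_weight_def den1_def den2_def)
  ultimately show ?thesis by simp
qed

section \<open>Perturbations of ruled sets\<close>

definition regularized :: "(real^3) set \<Rightarrow> (real^3 \<Rightarrow> real) \<Rightarrow> real \<Rightarrow> real^3 \<Rightarrow> real \<Rightarrow> complex" where
  "regularized U \<phi> a c \<epsilon> = (LINT x|lborel. indicator U x *\<^sub>R (integrand \<phi> \<epsilon> a c x))"

text \<open>
  On \<open>W\<close> the set \<open>U\<close> agrees with a ruled set, whose lines are uniformly transversal to the sphere, up to a difference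
  on which the limiting density is integrable.
\<close>

definition straightened_on ::
    "(real^3) set \<Rightarrow> (real^3) set \<Rightarrow> 3 \<Rightarrow> 3 \<Rightarrow> 3 \<Rightarrow> (real \<Rightarrow> real) \<Rightarrow> (real \<times> real) set \<Rightarrow> bool" where
  "straightened_on U W i j k m S \<longleftrightarrow>
     distinct [i, j, k] \<and> m \<in> borel_measurable borel \<and> bounded (range m) \<and> S \<in> sets borel \<and>
     (\<exists>c0>0. \<forall>x\<in>W. c0 \<le> \<bar>x \<bullet> slice_dir i j k m x\<bar>) \<and>
     integrable lborel (\<lambda>x. indicator (W \<inter> {x. x \<in> U \<longleftrightarrow> x \<notin> ruled i j k m S}) x / (1 - x \<bullet> x)^2)"

lemma norm_test_div_den_le:
  assumes "0 < \<epsilon>" "\<epsilon> \<le> 1" "\<bar>\<phi> x\<bar> \<le> B" "x \<bullet> x \<noteq> 1"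
  shows "norm (integrand \<phi> \<epsilon> a c x) \<le> 4 * B / (1 - x \<bullet> x)^2"
proof -
  have "0 < \<bar>1 - x \<bullet> x\<bar> / 2" using assms by simp
  have "(\<bar>1 - x \<bullet> x\<bar> / 2)^2 \<le> norm (den (delta_eps \<epsilon>) a c x)^2"
    using norm_den_ge[OF assms(1,2)] by (intro power_mono) auto
  then have "\<bar>\<phi> x\<bar> / norm (den (delta_eps \<epsilon>) a c x)^2 \<le> B / (\<bar>1 - x \<bullet> x\<bar> / 2)^2"
    using assms \<open>0 < \<bar>1 - x \<bullet> x\<bar> / 2\<close> by (intro frac_le) auto
  then show ?thesis by (simp add: norm_divide norm_power power_divide mult.commute)
qed

lemma tendsto_test_div_den:
  assumes "x \<bullet> x \<noteq> 1"
  shows "((\<lambda>\<epsilon>. of_real (\<phi> x) / (den (delta_eps \<epsilon>) a c x)^2) \<longlongrightarrow> of_real (\<phi> x) / (of_real (1 - x \<bullet> x))^2) (at_right 0)"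
proof (rule tendsto_divide[OF tendsto_const tendsto_power[OF tendsto_den]])
  have "1 - x \<bullet> x \<noteq> 0" using assms by simp
  then show "(complex_of_real (1 - x \<bullet> x))^2 \<noteq> 0" unfolding power_eq_0_iff of_real_eq_0_iff by simp
qed

lemma measurable_test_div_den:
  assumes [measurable]: "\<phi> \<in> borel_measurable borel"
  shows "(\<lambda>x. complex_of_real (\<phi> x) / (den \<delta> a c x)^2) \<in> borel_measurable borel"
  unfolding den_def by measurable

text \<open>
  Where \<open>1 / (1 - x \<bullet> x)\<^sup>2\<close> is integrable against \<open>s\<close>, the regularization and its gauge disappear in the limit.
\<close>

lemma tendsto_integral_dominated_by_shell:
  fixes s :: "real^3 \<Rightarrow> real"
  assumes [measurable]: "s \<in> borel_measurable borel" "\<phi> \<in> borel_measurable borel"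
    and \<phi>: "\<And>x. \<bar>\<phi> x\<bar> \<le> B"
    and int: "integrable lborel (\<lambda>x. s x / (1 - x \<bullet> x)^2)"
  shows "((\<lambda>\<epsilon>. LINT x|lborel. s x *\<^sub>R (integrand \<phi> \<epsilon> a c x))
      \<longlongrightarrow> (LINT x|lborel. s x *\<^sub>R (of_real (\<phi> x) / (of_real (1 - x \<bullet> x))^2))) (at_right 0)"
    and "\<forall>\<^sub>F \<epsilon> in at_right 0. integrable lborel (\<lambda>x. s x *\<^sub>R (integrand \<phi> \<epsilon> a c x))"
proof -
  note [measurable] = measurable_test_div_den[OF assms(2)]
  let ?w = "\<lambda>x. norm (4 * B * (s x / (1 - x \<bullet> x)^2))"
  have w: "integrable lborel ?w" by (intro integrable_norm integrable_mult_right int)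
  have bd: "\<forall>\<^sub>F \<epsilon> in at_right 0. AE x in lborel. norm (s x *\<^sub>R (integrand \<phi> \<epsilon> a c x)) \<le> ?w x"
  proof -
    have "\<forall>\<^sub>F \<epsilon> in at_right 0. 0 < \<epsilon> \<and> \<epsilon> < (1::real)"
      by (intro eventually_conj eventually_at_right_less eventually_at_rightI[of 0 1]) auto
    then show ?thesis
    proof eventually_elim
      case (elim \<epsilon>)
      have B: "0 \<le> B" using \<phi>[of 0] by linarith
      show ?case using AE_not_on_sphere
      proof eventually_elim
        fix x :: "real^3" assume "x \<bullet> x \<noteq> 1"
        then have "norm (integrand \<phi> \<epsilon> a c x) \<le> 4 * B / (1 - x \<bullet> x)^2"
          using norm_test_div_den_le[of \<epsilon> \<phi> x B a c] elim \<phi> by auto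
        from mult_left_mono[OF this, of "\<bar>s x\<bar>"] B
        show "norm (s x *\<^sub>R (integrand \<phi> \<epsilon> a c x)) \<le> ?w x"
          by (simp add: abs_mult mult_ac)
      qed
    qed
  qed
  show "((\<lambda>\<epsilon>. LINT x|lborel. s x *\<^sub>R (integrand \<phi> \<epsilon> a c x))
      \<longlongrightarrow> (LINT x|lborel. s x *\<^sub>R (of_real (\<phi> x) / (of_real (1 - x \<bullet> x))^2))) (at_right 0)"
  proof (rule dominated_convergence_at_right[OF _ _ w _ bd])
    show "AE x in lborel. ((\<lambda>\<epsilon>. s x *\<^sub>R (integrand \<phi> \<epsilon> a c x))
        \<longlongrightarrow> s x *\<^sub>R (of_real (\<phi> x) / (of_real (1 - x \<bullet> x))^2)) (at_right 0)"
      using AE_not_on_sphere by eventually_elim (intro tendsto_scaleR tendsto_const tendsto_test_div_den)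
  qed measurable
  show "\<forall>\<^sub>F \<epsilon> in at_right 0. integrable lborel (\<lambda>x. s x *\<^sub>R (integrand \<phi> \<epsilon> a c x))"
    using bd
  proof eventually_elim
    case (elim \<epsilon>)
    show ?case
      by (rule Bochner_Integration.integrable_bound[OF w]) (use elim in \<open>simp_all\<close>)
  qed
qed

lemma C2_along_lines_continuous: "C2_along_lines \<phi> \<phi>1 \<phi>2 \<Longrightarrow> continuous_on X \<phi>"
  unfolding C2_along_lines_def by (blast intro: continuous_on_subset)

lemma supported_bounded:
  assumes "continuous_on UNIV \<phi>" "compact C" "\<And>x. x \<notin> C \<Longrightarrow> \<phi> x = (0::real)"
  obtains B where "\<And>x. \<bar>\<phi> x\<bar> \<le> B" "B > 0"
proof -
  have "bounded (\<phi> ` C)"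
    using compact_continuous_image[OF continuous_on_subset[OF assms(1) subset_UNIV] assms(2)] by (rule compact_imp_bounded)
  then obtain B where B: "B > 0" "\<And>x. x \<in> C \<Longrightarrow> \<bar>\<phi> x\<bar> \<le> B" by (auto simp: bounded_pos)
  then have "\<bar>\<phi> x\<bar> \<le> B" for x using assms(3)[of x] by (cases "x \<in> C") auto
  then show ?thesis using that B by blast
qed

text \<open>
  The limit \<open>L\<close> is chosen before the gauge. It is the sum of the limit for the ruled set and of the absolutely convergent
  integral of \<open>\<phi> x / (1 - x \<bullet> x)\<^sup>2\<close> over the difference, counted with sign.
\<close>

lemma straightened_limit:
  assumes st: "straightened_on U W i j k m S" and C2: "C2_along_lines \<phi> \<phi>1 \<phi>2" and W: "open W" "bounded W"
    and C: "compact C" "C \<subseteq> W" and supp: "\<And>x. x \<notin> C \<Longrightarrow> \<phi> x = 0" and U: "U \<in> sets borel"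
  shows "\<exists>L. \<forall>a c. (\<forall>x\<in>W. a + c \<bullet> x \<noteq> 0) \<longrightarrow> (regularized U \<phi> a c \<longlongrightarrow> L) (at_right 0)"
proof -
  let ?R = "ruled i j k m S"
  define D where "D = W \<inter> {x. x \<in> U \<longleftrightarrow> x \<notin> ?R}"
  define s where "s = (\<lambda>x. indicator D x * (indicator U x - indicator ?R x) :: real)"
  obtain c0 where d: "distinct [i, j, k]" and m: "m \<in> borel_measurable borel" and bm: "bounded (range m)"
    and S: "S \<in> sets borel" and c0: "c0 > 0" "\<And>x. x \<in> W \<Longrightarrow> c0 \<le> \<bar>x \<bullet> slice_dir i j k m x\<bar>"
    and int: "integrable lborel (\<lambda>x. indicator D x / (1 - x \<bullet> x)^2)"
    using st unfolding straightened_on_def D_def by blast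
  obtain M where M: "\<And>z. \<bar>m z\<bar> \<le> M" using bm by (auto simp: bounded_iff)
  have R: "?R \<in> sets borel" by (rule sets_ruled[OF m S])
  have Db: "D \<in> sets borel"
  proof -
    have "D = W \<inter> ((U - ?R) \<union> (?R - U))" by (auto simp: D_def)
    then show ?thesis using U R W by auto
  qed
  note [measurable] = U R Db
  have s_m: "s \<in> borel_measurable borel" unfolding s_def by measurable
  have cphi: "continuous_on UNIV \<phi>" by (rule C2_along_lines_continuous[OF C2])
  obtain B where B: "\<And>x. \<bar>\<phi> x\<bar> \<le> B" using supported_bounded[OF cphi C(1) supp] by blast
  have s_int: "integrable lborel (\<lambda>x. s x / (1 - x \<bullet> x)^2)"
    by (rule Bochner_Integration.integrable_bound[OF int])
       (use s_m in \<open>auto simp: s_def indicator_def intro!: AE_I2\<close>)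
  note lim2 = tendsto_integral_dominated_by_shell[OF s_m borel_measurable_continuous_onI[OF cphi] B s_int]
  have split: "indicator U x *\<^sub>R (\<phi> x / (den \<delta> a c x)^2)
      = indicator ?R x *\<^sub>R (\<phi> x / (den \<delta> a c x)^2) + s x *\<^sub>R (\<phi> x / (den \<delta> a c x)^2)" for \<delta> a c x
  proof (cases "x \<in> C")
    case True
    then have "x \<in> W" using C by auto
    then show ?thesis by (auto simp: s_def D_def indicator_def)
  qed (simp add: supp)
  define L1 where "L1 = - (LINT x|lborel. indicator ?R x *\<^sub>R (let v = slice_dir i j k m x in
          log_weight 0 0 0 (\<phi> x) (\<phi>1 x v) (\<phi>2 x v) x v * Ln (\<i> * of_real (1 - x \<bullet> x))))"
  define L2 where "L2 = (LINT x|lborel. s x *\<^sub>R (of_real (\<phi> x) / (complex_of_real (1 - x \<bullet> x))^2))"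
  show ?thesis
  proof (intro exI[of _ "L1 + L2"] allI impI)
    fix a c assume nz: "\<forall>x\<in>W. a + c \<bullet> x \<noteq> 0"
    have "((\<lambda>\<epsilon>. (LINT x|lborel. indicator ?R x *\<^sub>R (integrand \<phi> \<epsilon> a c x))
          + (LINT x|lborel. s x *\<^sub>R (integrand \<phi> \<epsilon> a c x))) \<longlongrightarrow> L1 + L2) (at_right 0)"
      unfolding L1_def L2_def
      by (intro tendsto_add lim2(1) ruled_limit[OF C2 W C supp _ m M S d c0]) (use nz in auto)
    moreover have "\<forall>\<^sub>F \<epsilon> in at_right 0. (LINT x|lborel. indicator ?R x *\<^sub>R (integrand \<phi> \<epsilon> a c x))
          + (LINT x|lborel. s x *\<^sub>R (integrand \<phi> \<epsilon> a c x)) = regularized U \<phi> a c \<epsilon>"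
      using lim2(2)[of a c] eventually_at_right_less[of 0]
    proof eventually_elim
      case (elim \<epsilon>)
      have i: "integrable lborel (\<lambda>x. indicator ?R x *\<^sub>R (integrand \<phi> \<epsilon> a c x))"
        by (rule integrable_test_div_den[OF C2 elim(2) W(1) C supp _ R]) (use nz in auto)
      show ?case
        unfolding regularized_def split using Bochner_Integration.integral_add[OF i elim(1)] by simp
    qed
    ultimately show "(regularized U \<phi> a c \<longlongrightarrow> L1 + L2) (at_right 0)"
      by (rule Lim_transform_eventually)
  qed
qed

section \<open>Straightening away from the frontier\<close>

lemma straightened_on_subset:
  assumes "straightened_on U W i j k m S" "W' \<subseteq> W" "W' \<in> sets borel"
  shows "straightened_on U W' i j k m S"
proof -
  let ?D = "\<lambda>W. W \<inter> {x. x \<in> U \<longleftrightarrow> x \<notin> ruled i j k m S}"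
  have int: "integrable lborel (\<lambda>x. indicator (?D W) x / (1 - x \<bullet> x)^2)"
    using assms(1) unfolding straightened_on_def by blast
  have "integrable lborel (\<lambda>x. indicator W' x *\<^sub>R (indicator (?D W) x / (1 - x \<bullet> x)^2) :: real)"
    by (rule integrable_mult_indicator[OF _ int]) (use assms(3) in simp)
  moreover have "(\<lambda>x. indicator W' x *\<^sub>R (indicator (?D W) x / (1 - x \<bullet> x)^2) :: real) = (\<lambda>x. indicator (?D W') x / (1 - x \<bullet> x)^2)"
    using assms(2) by (auto simp: indicator_def fun_eq_iff)
  ultimately have "integrable lborel (\<lambda>x. indicator (?D W') x / (1 - x \<bullet> x)^2 :: real)" by (simp only:)
  then show ?thesis using assms(1,2) unfolding straightened_on_def by (blast dest: subsetD)
qed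

lemma third_index: "i \<noteq> j \<Longrightarrow> \<exists>k::3. distinct [i, j, k]"
proof -
  assume "i \<noteq> j"
  have "card {i, j} \<noteq> CARD(3)" using card_insert_le_m1[of 2 "{j}" i] by (simp add: \<open>i \<noteq> j\<close>)
  then obtain k where "k \<notin> {i, j}" by (metis UNIV_eq_I)
  then show ?thesis using \<open>i \<noteq> j\<close> by (intro exI[of _ k]) auto
qed

lemma straightened_off_frontier:
  assumes "norm p = 1" "p \<notin> frontier U"
  obtains r i j k m S where "r > 0" "straightened_on U (ball p r) i j k m S"
proof -
  obtain r0 where r0: "r0 > 0" "ball p r0 \<subseteq> U \<or> ball p r0 \<inter> U = {}"
  proof -
    have "p \<in> interior U \<or> p \<notin> closure U" using assms(2) by (auto simp: frontier_def)
    then show ?thesis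
    proof
      assume "p \<in> interior U"
      then show ?thesis using that by (auto simp: mem_interior)
    next
      assume "p \<notin> closure U"
      then have "p \<in> - closure U" "open (- closure U)" by auto
      then obtain e where "e > 0" "ball p e \<subseteq> - closure U" unfolding open_contains_ball by blast
      then show ?thesis using that[of e] closure_subset[of U] by blast
    qed
  qed
  obtain i where i: "p $ i \<noteq> 0"
    using assms(1) by (metis norm_zero vec_eq_iff zero_index zero_neq_one)
  obtain j where "i \<noteq> j" by (metis exhaust_3 one_neq_zero zero_neq_numeral verit_eq_simplify(10) num1_eq1 card_num1)
  then obtain k where d: "distinct [i, j, k]" using third_index by blast
  define r where "r = min r0 (\<bar>p $ i\<bar> / 2)"
  have r: "r > 0" using r0 i by (simp add: r_def)
  define S :: "(real \<times> real) set" where "S = (if ball p r0 \<subseteq> U then UNIV else {})"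
  have D: "ball p r \<inter> {x. x \<in> U \<longleftrightarrow> x \<notin> ruled i j k (\<lambda>_. 0) S} = {}"
    using r0(2) by (cases "ball p r0 \<subseteq> U") (auto simp: S_def ruled_def r_def disjoint_iff)
  have "\<bar>p $ i\<bar> / 2 \<le> \<bar>x \<bullet> slice_dir i j k (\<lambda>_. 0) x\<bar>" if "x \<in> ball p r" for x
  proof -
    have "\<bar>(p - x) $ i\<bar> \<le> norm (p - x)" by (rule component_le_norm_cart)
    then have "\<bar>p $ i - x $ i\<bar> \<le> \<bar>p $ i\<bar> / 2" using that by (simp add: r_def dist_norm)
    then have "\<bar>p $ i\<bar> / 2 \<le> \<bar>x $ i\<bar>" by linarith
    then show ?thesis by (simp add: slice_dir_def inner_axis)
  qed
  then have "straightened_on U (ball p r) i j k (\<lambda>_. 0) S"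
    unfolding straightened_on_def D using d i by (auto simp: S_def intro!: exI[of _ "\<bar>p $ i\<bar> / 2"])
  then show ?thesis using that r by blast
qed

text \<open>
  In shear coordinates \<open>D\<close> has width of order \<open>\<bar>u\<bar> powr (1 + \<alpha>)\<close> at distance \<open>u\<close> from the centre line \<open>\<xi>\<close>, so the
  integral over the width leaves \<open>\<bar>u\<bar> powr (\<alpha> - 1)\<close>, which is integrable exactly because \<open>\<alpha> > 0\<close>. On the centre
  line itself the integrand is \<open>0\<close>, as division by zero gives \<open>0\<close>.
\<close>

lemma wedge_integrable:
  assumes [measurable]: "m \<in> borel_measurable borel" "\<xi> \<in> borel_measurable borel" "\<beta> \<in> borel_measurable borel" "D \<in> sets borel"
    and d: "distinct [i, j, k]" and "\<alpha> > 0" "C \<ge> 0" "h > 0" "R \<ge> 0" "r \<ge> 0"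
    and D: "\<And>x. x \<in> D \<Longrightarrow> \<bar>x $ k - z0\<bar> \<le> r" "\<And>x. x \<in> D \<Longrightarrow> \<bar>x $ i - \<xi> (x $ k)\<bar> \<le> R"
      "\<And>x. x \<in> D \<Longrightarrow> \<bar>x $ j - m (x $ k) * x $ i - \<beta> (x $ k)\<bar> \<le> C * \<bar>x $ i - \<xi> (x $ k)\<bar> powr (1 + \<alpha>)"
      "\<And>x. x \<in> D \<Longrightarrow> h * \<bar>x $ i - \<xi> (x $ k)\<bar> \<le> \<bar>1 - x \<bullet> x\<bar>"
      "\<And>x. x \<in> D \<Longrightarrow> x $ i = \<xi> (x $ k) \<Longrightarrow> x \<bullet> x = 1"
  shows "integrable lborel (\<lambda>x::real^3. indicator D x / (1 - x \<bullet> x)^2)"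
proof (rule integrableI_bounded)
  show "(\<lambda>x. indicator D x / (1 - x \<bullet> x)^2) \<in> borel_measurable lborel" by measurable
  define A where "A = (\<lambda>z s t. ennreal (indicator {z0 - r..z0 + r} z) * (ennreal (indicator {-R..R} (s - \<xi> z) / (h * (s - \<xi> z))^2)
        * indicator {\<beta> z - C * \<bar>s - \<xi> z\<bar> powr (1 + \<alpha>) .. \<beta> z + C * \<bar>s - \<xi> z\<bar> powr (1 + \<alpha>)} t))"
  have "(\<integral>\<^sup>+(x::real^3). ennreal (norm (indicator D x / (1 - x \<bullet> x)^2)) \<partial>lborel)
     \<le> (\<integral>\<^sup>+(x::real^3). A (x $ k) (x $ i) (x $ j - m (x $ k) * x $ i) \<partial>lborel)"
  proof (intro nn_integral_mono)
    fix x :: "real^3"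
    show "ennreal (norm (indicator D x / (1 - x \<bullet> x)^2)) \<le> A (x $ k) (x $ i) (x $ j - m (x $ k) * x $ i)"
    proof (cases "x \<in> D")
      case False
      then show ?thesis by simp
    next
      case True
      have A: "A (x $ k) (x $ i) (x $ j - m (x $ k) * x $ i) = ennreal (1 / (h * (x $ i - \<xi> (x $ k)))^2)"
        using D(1-3)[OF True] by (auto simp: A_def indicator_def abs_le_iff)
      show ?thesis
      proof (cases "x $ i = \<xi> (x $ k)")
        case True
        then show ?thesis using D(5)[OF \<open>x \<in> D\<close>] by simp
      next
        case False
        then have "0 < (h * (x $ i - \<xi> (x $ k)))^2" using \<open>h > 0\<close> by simp
        moreover have "(h * (x $ i - \<xi> (x $ k)))^2 \<le> (1 - x \<bullet> x)^2"
          using D(4)[OF \<open>x \<in> D\<close>] \<open>h > 0\<close> by (subst abs_le_square_iff[symmetric]) (simp add: abs_mult)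
        ultimately have "1 / (1 - x \<bullet> x)^2 \<le> 1 / (h * (x $ i - \<xi> (x $ k)))^2"
          by (intro frac_le) auto
        then show ?thesis unfolding A using \<open>x \<in> D\<close> by (simp add: ennreal_leI)
      qed
    qed
  qed
  also have "\<dots> = (\<integral>\<^sup>+z. \<integral>\<^sup>+s. \<integral>\<^sup>+t. A z s t \<partial>lborel \<partial>lborel \<partial>lborel)"
  proof (subst nn_integral_slice[OF assms(1) d])
    show "(\<lambda>x. A (x $ k) (x $ i) (x $ j - m (x $ k) * x $ i)) \<in> borel_measurable borel"
    proof -
      have "indicator {a..b} t = (indicator {0..} (t - a) * indicator {0..} (b - t) :: ennreal)" for a b t :: real
        by (simp add: indicator_def)
      then show ?thesis unfolding A_def by simp
    qed
  qed (simp add: slice_nth[OF d])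
  also have "\<dots> \<le> (\<integral>\<^sup>+z. \<integral>\<^sup>+s. indicator {z0 - r..z0 + r} z * (ennreal (2 * C / h^2) * ennreal (indicator {-R..R} (s - \<xi> z) * \<bar>s - \<xi> z\<bar> powr (\<alpha> - 1))) \<partial>lborel \<partial>lborel)"
  proof (intro nn_integral_mono)
    fix z s
    let ?u = "s - \<xi> z"
    let ?b = "C * \<bar>?u\<bar> powr (1 + \<alpha>)"
    have b: "0 \<le> ?b" using \<open>C \<ge> 0\<close> by simp
    have "(\<integral>\<^sup>+t. A z s t \<partial>lborel) = indicator {z0 - r..z0 + r} z *
        (ennreal (indicator {-R..R} ?u / (h * ?u)^2) * ennreal (2 * ?b))"
      unfolding A_def using b by (simp add: nn_integral_cmult ennreal_indicator algebra_simps)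
    also have "ennreal (indicator {-R..R} ?u / (h * ?u)^2) * ennreal (2 * ?b) = ennreal (indicator {-R..R} ?u / (h * ?u)^2 * (2 * ?b))"
      using b by (intro ennreal_mult[symmetric]) auto
    also have "indicator {-R..R} ?u / (h * ?u)^2 * (2 * ?b) = 2 * C / h^2 * (indicator {-R..R} ?u * \<bar>?u\<bar> powr (\<alpha> - 1))"
    proof (cases "?u = 0")
      case False
      have "\<bar>?u\<bar> powr (1 + \<alpha>) = \<bar>?u\<bar> powr (\<alpha> - 1) * \<bar>?u\<bar> powr 2"
        by (simp only: powr_add[symmetric]) simp
      also have "\<bar>?u\<bar> powr 2 = ?u^2" using False by simp
      finally have "\<bar>?u\<bar> powr (1 + \<alpha>) = \<bar>?u\<bar> powr (\<alpha> - 1) * ?u^2" .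
      moreover have "x / (h * ?u)^2 * (2 * (C * (y * ?u^2))) = 2 * C / h^2 * (x * y)" for x y
        using False \<open>h > 0\<close> unfolding power_mult_distrib by (simp add: divide_simps del: right_diff_distrib)
      ultimately show ?thesis by simp
    qed simp
    also have "ennreal (2 * C / h^2 * (indicator {-R..R} ?u * \<bar>?u\<bar> powr (\<alpha> - 1))) = ennreal (2 * C / h^2) * ennreal (indicator {-R..R} ?u * \<bar>?u\<bar> powr (\<alpha> - 1))"
      using \<open>C \<ge> 0\<close> by (intro ennreal_mult) auto
    finally show "(\<integral>\<^sup>+t. A z s t \<partial>lborel) \<le> indicator {z0 - r..z0 + r} z * (ennreal (2 * C / h^2) * ennreal (indicator {-R..R} ?u * \<bar>?u\<bar> powr (\<alpha> - 1)))"
      by simp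
  qed
  also have "\<dots> = (\<integral>\<^sup>+z. indicator {z0 - r..z0 + r} z * (ennreal (2 * C / h^2) * (\<integral>\<^sup>+s. ennreal (indicator {-R..R} s * \<bar>s\<bar> powr (\<alpha> - 1)) \<partial>lborel)) \<partial>lborel)"
  proof -
    have "(\<integral>\<^sup>+s. ennreal (indicator {-R..R} (s - c) * \<bar>s - c\<bar> powr (\<alpha> - 1)) \<partial>lborel)
      = (\<integral>\<^sup>+s. ennreal (indicator {-R..R} s * \<bar>s\<bar> powr (\<alpha> - 1)) \<partial>lborel)" for c
      using nn_integral_real_affine[of "\<lambda>s. ennreal (indicator {-R..R} s * \<bar>s\<bar> powr (\<alpha> - 1))" 1 "-c"] by simp
    then show ?thesis by (simp add: nn_integral_cmult)
  qed
  also have "\<dots> < \<infinity>"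
    using nn_integral_abs_powr_finite[of "\<alpha> - 1" R] assms
    by (simp add: nn_integral_multc ennreal_mult_eq_top_iff less_top[symmetric])
  finally show "(\<integral>\<^sup>+(x::real^3). ennreal (norm (indicator D x / (1 - x \<bullet> x)^2)) \<partial>lborel) < \<infinity>" .
qed

section \<open>Straightening at a transversal frontier point\<close>

text \<open>
  Transversality means that \<open>G\<close> and \<open>p\<close> are linearly independent, so some \<open>2 \<times> 2\<close> minor of them is nonzero, and in
  the corresponding coordinate plane the two tangent lines are still transversal. The slices can therefore be taken
  along coordinate planes, without rotating the picture.
\<close>

lemma transversal_plane:
  fixes p G :: "real^3"
  assumes "norm p = 1" "G \<noteq> 0" "{u + v | u v. G \<bullet> u = 0 \<and> p \<bullet> v = 0} = UNIV"
  obtains i j where "i \<noteq> j" "G $ j \<noteq> 0" "p $ i * G $ j - p $ j * G $ i \<noteq> 0"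
proof -
  have "\<exists>i j. p $ i * G $ j - p $ j * G $ i \<noteq> 0"
  proof (rule ccontr)
    assume "\<not> ?thesis"
    then have eq: "p $ i * G $ j = p $ j * G $ i" for i j by auto
    obtain l where l: "G $ l \<noteq> 0" using assms(2) by (auto simp: vec_eq_iff)
    define t where "t = p $ l / G $ l"
    have p: "p = t *\<^sub>R G"
      using eq[of _ l] l by (simp add: vec_eq_iff t_def field_simps)
    obtain u v where uv: "p = u + v" "G \<bullet> u = 0" "p \<bullet> v = 0" using assms(3) by blast
    have "p \<bullet> p = p \<bullet> u + p \<bullet> v" by (metis uv(1) inner_add_right)
    also have "\<dots> = 0" using uv(2,3) p by (metis add_0_right inner_scaleR_left mult_zero_right)
    finally show False using assms(1) by auto
  qed
  then obtain i j where ij: "p $ i * G $ j - p $ j * G $ i \<noteq> 0" by blast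
  then have "i \<noteq> j" by auto
  show ?thesis
  proof (cases "G $ j = 0")
    case True
    then have "G $ i \<noteq> 0" "p $ j * G $ i - p $ i * G $ j \<noteq> 0" using ij by auto
    then show ?thesis using that[of j i] \<open>i \<noteq> j\<close> by auto
  qed (use that ij \<open>i \<noteq> j\<close> in blast)
qed

text \<open>
  The inverse function theorem applies to \<open>x \<mapsto> (1 - x \<bullet> x, F x, x $ k)\<close>, whose differential at \<open>p\<close> is injective by
  the condition on the minor. The inverse image of the line where the first two components vanish is the curve \<open>\<gamma>\<close> of
  crossings, parametrized by \<open>x $ k\<close>. The two sides of the surface are connected near \<open>p\<close>, being homeomorphic to
  half balls.
\<close>

lemma crossing_chart:
  fixes F :: "real^3 \<Rightarrow> real" and G :: "real^3 \<Rightarrow> real^3"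
  assumes V: "open V" "p \<in> V" and der: "\<And>x. x \<in> V \<Longrightarrow> GDERIV F x :> G x" and G: "continuous_on V G"
    and p: "norm p = 1" "F p = 0" and d: "distinct [i, j, k]" and tr: "p $ i * G p $ j - p $ j * G p $ i \<noteq> 0"
  obtains N \<gamma> \<delta> where "open N" "p \<in> N" "N \<subseteq> V" "\<delta> > 0"
    "connected (N \<inter> {x. F x < 0})" "connected (N \<inter> {x. F x > 0})"
    "continuous_on {p$k - \<delta> <..< p$k + \<delta>} \<gamma>" "\<gamma> (p$k) = p"
    "\<And>z. z \<in> {p$k - \<delta> <..< p$k + \<delta>} \<Longrightarrow> \<gamma> z \<in> N \<and> norm (\<gamma> z) = 1 \<and> F (\<gamma> z) = 0 \<and> \<gamma> z $ k = z"
proof -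
  define f where "f = (\<lambda>x. (1 - x \<bullet> x) *\<^sub>R axis i 1 + F x *\<^sub>R axis j 1 + (x $ k) *\<^sub>R axis k 1 :: real^3)"
  define L where "L = (\<lambda>x h. (- 2 * (x \<bullet> h)) *\<^sub>R axis i 1 + (G x \<bullet> h) *\<^sub>R axis j 1 + (h $ k) *\<^sub>R axis k 1 :: real^3)"
  define f' where "f' = (\<lambda>x. Blinfun (L x))"
  have bl: "bounded_linear (L x)" for x
    unfolding L_def
    by (rule bounded_linear_add[OF bounded_linear_add])
       (rule bounded_linear_scaleR_const bounded_linear_const_mult[OF bounded_linear_inner_right]
          bounded_linear_inner_right bounded_linear_vec_nth)+
  have f'_apply: "blinfun_apply (f' x) = L x" for x
    unfolding f'_def by (rule bounded_linear_Blinfun_apply[OF bl])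
  have fn: "f x $ i = 1 - x \<bullet> x" "f x $ j = F x" "f x $ k = x $ k" for x
    using d by (auto simp: f_def axis_def)
  have Ln: "L x h $ i = - 2 * (x \<bullet> h)" "L x h $ j = G x \<bullet> h" "L x h $ k = h $ k" for x h
    using d by (auto simp: L_def axis_def)
  have vec_eq: "x = y \<longleftrightarrow> x $ i = y $ i \<and> x $ j = y $ j \<and> x $ k = y $ k" for x y :: "real^3"
  proof -
    have "(\<forall>n. x $ n = y $ n) \<longleftrightarrow> (\<forall>n\<in>{i, j, k}. x $ n = y $ n)"
      unfolding UNIV_3_distinct[OF d, symmetric] by simp
    then show ?thesis by (simp add: vec_eq_iff)
  qed
  have dot: "x \<bullet> y = x $ i * y $ i + x $ j * y $ j + x $ k * y $ k" for x y :: "real^3"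
  proof -
    have "x \<bullet> y = (\<Sum>n\<in>{i, j, k}. x $ n * y $ n)"
      unfolding UNIV_3_distinct[OF d, symmetric] by (simp add: inner_vec_def)
    then show ?thesis using d by simp
  qed
  have derf: "(f has_derivative blinfun_apply (f' x)) (at x)" if "x \<in> V" for x
  proof -
    have F: "(F has_derivative (\<lambda>h. G x \<bullet> h)) (at x)"
      using der[OF that] by (simp add: gderiv_def inner_commute)
    have k: "((\<lambda>x. x $ k) has_derivative (\<lambda>h. h $ k)) (at x)"
      by (rule bounded_linear.has_derivative[OF bounded_linear_vec_nth has_derivative_ident])
    have s: "((\<lambda>x::real^3. 1 - x \<bullet> x) has_derivative (\<lambda>h. - 2 * (x \<bullet> h))) (at x)"
      by (auto intro!: derivative_eq_intros simp: inner_commute)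
    show ?thesis unfolding f'_apply f_def L_def
      by (intro has_derivative_add has_derivative_scaleR_left F k s)
  qed
  have contf': "continuous_on V f'"
    by (rule continuous_on_blinfun_componentwise) (unfold f'_apply L_def, intro continuous_intros G)
  have "inj (L p)"
  proof -
    have "h = 0" if "L p h = 0" for h
    proof -
      have "L p h $ i = 0" "L p h $ j = 0" "L p h $ k = 0" using that by simp_all
      then have "h $ k = 0" "p \<bullet> h = 0" "G p \<bullet> h = 0" unfolding Ln by simp_all
      then have e: "h $ k = 0" "p $ i * h $ i + p $ j * h $ j = 0" "G p $ i * h $ i + G p $ j * h $ j = 0"
        unfolding dot by simp_all
      have "(p $ i * G p $ j - p $ j * G p $ i) * h $ i = 0" "(p $ i * G p $ j - p $ j * G p $ i) * h $ j = 0"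
        using e(2,3) by algebra+
      then show ?thesis using tr e(1) by (simp add: vec_eq)
    qed
    then show ?thesis using linear_injective_0[OF bounded_linear.linear[OF bl]] by blast
  qed
  then obtain g0 where g0: "linear g0" "g0 \<circ> L p = id"
    using linear_injective_left_inverse[OF bounded_linear.linear[OF bl]] by blast
  have inv: "Blinfun g0 o\<^sub>L f' p = id_blinfun"
    using g0 by (intro blinfun_eqI)
      (simp add: bounded_linear_Blinfun_apply linear_conv_bounded_linear f'_apply pointfree_idE)
  obtain N0 V' g where N0: "open N0" "N0 \<subseteq> V" "p \<in> N0" "open V'" "f p \<in> V'" "homeomorphism N0 V' f g"
  proof (rule inverse_function_theorem[OF V(1) derf contf' V(2) inv])
    fix U' Va and g :: "real^3 \<Rightarrow> real^3" and g' :: "real^3 \<Rightarrow> real^3 \<Rightarrow> real^3"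
    assume "open U'" "U' \<subseteq> V" "p \<in> U'" "open Va" "f p \<in> Va" "homeomorphism U' Va f g"
    then show ?thesis by (rule that)
  qed
  obtain s where s: "s > 0" "ball (f p) s \<subseteq> V'" using N0(4,5) by (meson open_contains_ball)
  define N where "N = g ` ball (f p) s"
  have gf: "g (f x) = x" if "x \<in> N0" for x using homeomorphism_apply1[OF N0(6) that] .
  have fg: "f (g y) = y" if "y \<in> V'" for y using homeomorphism_apply2[OF N0(6) that] .
  have gN: "g y \<in> N0" if "y \<in> V'" for y using N0(6) that unfolding homeomorphism_def by blast
  have cg: "continuous_on V' g" and cf: "continuous_on N0 f" using N0(6) by (auto simp: homeomorphism_def)
  have N_eq: "N = N0 \<inter> f -` ball (f p) s"
  proof (intro equalityI subsetI)
    fix x assume "x \<in> N"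
    then obtain y where "y \<in> ball (f p) s" "x = g y" by (auto simp: N_def)
    then show "x \<in> N0 \<inter> f -` ball (f p) s" using s(2) gN fg by auto
  next
    fix x assume "x \<in> N0 \<inter> f -` ball (f p) s"
    then have "x = g (f x)" "f x \<in> ball (f p) s" using gf by auto
    then show "x \<in> N" unfolding N_def by (rule image_eqI)
  qed
  have oN: "open N" unfolding N_eq using cf N0(1) by (intro continuous_open_preimage) auto
  have pN: "p \<in> N" using N0(3) s by (simp add: N_eq)
  have side: "N \<inter> {x. P (F x)} = g ` (ball (f p) s \<inter> {y. P (y $ j)})" for P
  proof (intro equalityI subsetI)
    fix x assume x: "x \<in> N \<inter> {x. P (F x)}"
    then have "x = g (f x)" using gf by (simp add: N_eq)
    moreover have "f x \<in> ball (f p) s \<inter> {y. P (y $ j)}" using x by (simp add: N_eq fn(2))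
    ultimately show "x \<in> g ` (ball (f p) s \<inter> {y. P (y $ j)})" by (rule image_eqI)
  next
    fix x assume "x \<in> g ` (ball (f p) s \<inter> {y. P (y $ j)})"
    then obtain y where y: "y \<in> ball (f p) s" "P (y $ j)" "x = g y" by blast
    moreover have "f (g y) = y" using fg y(1) s(2) by auto
    ultimately show "x \<in> N \<inter> {x. P (F x)}" using fn(2)[of "g y"] by (simp add: N_def)
  qed
  have con: "connected (g ` (ball (f p) s \<inter> H))" if "convex H" for H
  proof (rule connected_continuous_image)
    show "continuous_on (ball (f p) s \<inter> H) g" by (rule continuous_on_subset[OF cg]) (use s in auto)
    show "connected (ball (f p) s \<inter> H)" by (intro convex_connected convex_Int convex_ball that)
  qed
  have half: "convex {y::real^3. y $ j < 0}" "convex {y::real^3. y $ j > 0}"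
    using convex_halfspace_lt[of "axis j 1 :: real^3" 0] convex_halfspace_gt[of 0 "axis j 1 :: real^3"] by (simp_all add: inner_axis' inner_real_def)
  define \<gamma> where "\<gamma> = (\<lambda>z. g (z *\<^sub>R axis k 1))"
  have fp: "f p = (p $ k) *\<^sub>R axis k 1"
    using p by (simp add: f_def norm_eq_1)
  have in_ball: "z *\<^sub>R axis k 1 \<in> ball (f p) s" if "z \<in> {p$k - s <..< p$k + s}" for z
  proof -
    have "dist (f p) (z *\<^sub>R axis k 1) = norm ((p $ k - z) *\<^sub>R (axis k 1 :: real^3))"
      by (simp add: fp dist_norm scaleR_diff_left)
    also have "\<dots> = \<bar>p $ k - z\<bar>" by (simp add: norm_axis_1)
    finally show ?thesis using that by (auto simp: abs_less_iff)
  qed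
  show ?thesis
  proof (rule that[of N s \<gamma>])
    show "connected (N \<inter> {x. F x < 0})" unfolding side[of "\<lambda>t. t < 0"] by (rule con[OF half(1)])
    show "connected (N \<inter> {x. F x > 0})" unfolding side[of "\<lambda>t. t > 0"] by (rule con[OF half(2)])
    show "continuous_on {p$k - s <..< p$k + s} \<gamma>"
      unfolding \<gamma>_def by (rule continuous_on_compose2[OF cg]) (use in_ball s in \<open>auto intro!: continuous_intros\<close>)
    show "\<gamma> (p $ k) = p" unfolding \<gamma>_def fp[symmetric] by (rule gf[OF N0(3)])
    show "\<gamma> z \<in> N \<and> norm (\<gamma> z) = 1 \<and> F (\<gamma> z) = 0 \<and> \<gamma> z $ k = z" if z: "z \<in> {p$k - s <..< p$k + s}" for z
    proof -
      have "f (\<gamma> z) = z *\<^sub>R axis k 1" unfolding \<gamma>_def using fg in_ball[OF z] s by auto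
      then have "f (\<gamma> z) $ i = 0" "f (\<gamma> z) $ j = 0" "f (\<gamma> z) $ k = z" using d by (auto simp: axis_def)
      moreover have "\<gamma> z \<in> N" unfolding \<gamma>_def N_def using in_ball[OF z] by blast
      ultimately show ?thesis unfolding fn by (simp add: norm_eq_1)
    qed
  qed (use oN pN N0 s in \<open>auto simp: N_eq\<close>)
qed

lemma holder_taylor:
  fixes F :: "real^3 \<Rightarrow> real"
  assumes B: "convex B" "x \<in> B" "y \<in> B" and der: "\<And>x. x \<in> B \<Longrightarrow> GDERIV F x :> G x"
    and hol: "\<And>x y. x \<in> B \<Longrightarrow> y \<in> B \<Longrightarrow> dist (G x) (G y) \<le> C * dist x y powr \<alpha>" and "C \<ge> 0" "\<alpha> > 0"
  shows "\<bar>F x - F y - G y \<bullet> (x - y)\<bar> \<le> C * norm (x - y) powr (1 + \<alpha>)"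
proof -
  define l where "l = (\<lambda>t. y + t *\<^sub>R (x - y))"
  have lB: "l t \<in> B" if "0 \<le> t" "t \<le> 1" for t
  proof -
    have "l t = (1 - t) *\<^sub>R y + t *\<^sub>R x" by (simp add: l_def algebra_simps)
    then show ?thesis using convexD[OF B(1) B(3,2), of "1 - t" t] that by simp
  qed
  have d: "((\<lambda>t. F (l t)) has_real_derivative G (l t) \<bullet> (x - y)) (at t)" if "0 \<le> t" "t \<le> 1" for t
  proof -
    have F': "(F has_derivative (\<lambda>h. h \<bullet> G (l t))) (at (l t))"
      using der[OF lB[OF that]] by (simp add: gderiv_def)
    have "(l has_derivative (\<lambda>h. h *\<^sub>R (x - y))) (at t)"
      unfolding l_def by (auto intro!: derivative_eq_intros)
    from diff_chain_at[OF this F']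
    have "((\<lambda>t. F (l t)) has_derivative (\<lambda>h. (h *\<^sub>R (x - y)) \<bullet> G (l t))) (at t)"
      by (simp add: o_def)
    moreover have "(\<lambda>h. (h *\<^sub>R (x - y)) \<bullet> G (l t)) = (*) (G (l t) \<bullet> (x - y))"
      by (simp add: fun_eq_iff inner_commute)
    ultimately show ?thesis by (simp only: has_field_derivative_def)
  qed
  obtain t where t: "0 < t" "t < 1" "F (l 1) - F (l 0) = (1 - 0) * (G (l t) \<bullet> (x - y))"
    using MVT2[of 0 1 "\<lambda>t. F (l t)" "\<lambda>t. G (l t) \<bullet> (x - y)"] d by auto
  then have "F x - F y - G y \<bullet> (x - y) = (G (l t) - G y) \<bullet> (x - y)"
    by (simp add: l_def inner_diff_left)
  also have "\<bar>\<dots>\<bar> \<le> dist (G (l t)) (G y) * norm (x - y)"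
    by (simp add: Cauchy_Schwarz_ineq2 dist_norm)
  also have "\<dots> \<le> (C * norm (x - y) powr \<alpha>) * norm (x - y)"
  proof (rule mult_right_mono)
    have "dist (l t) y = t * norm (x - y)" using t by (simp add: l_def dist_norm)
    also have "\<dots> \<le> norm (x - y)" using t by (simp add: mult_left_le_one_le)
    finally have "dist (l t) y powr \<alpha> \<le> norm (x - y) powr \<alpha>" using \<open>\<alpha> > 0\<close> by (intro powr_mono2) auto
    then show "dist (G (l t)) (G y) \<le> C * norm (x - y) powr \<alpha>"
      using hol[OF lB B(3), of t] t \<open>C \<ge> 0\<close> by (meson less_imp_le mult_left_mono order_trans)
  qed simp
  also have "\<dots> = C * norm (x - y) powr (1 + \<alpha>)"
    by (cases "x = y") (simp_all add: powr_add)
  finally show ?thesis .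
qed

text \<open>
  Here \<open>c\<close> is the crossing in the slice of \<open>x\<close>, \<open>u\<close> and \<open>\<tau>\<close> are the coordinates of \<open>x - c\<close> along and off the tangent line
  of slope \<open>m\<close>. Since \<open>\<bar>\<tau>\<bar>\<close> is a small multiple of \<open>norm (x - c)\<close>, that norm is controlled by \<open>\<bar>u\<bar>\<close>, and
  \<open>1 - x \<bullet> x = c \<bullet> c - x \<bullet> x\<close> is, up to sign, \<open>u\<close> times a quantity bounded away from zero plus a multiple of \<open>\<tau>\<close>.
\<close>

lemma wedge_estimate:
  fixes x c :: "real^3"
  assumes d: "distinct [i, j, k]" and xk: "x $ k = c $ k" and c: "norm c = 1" and x: "norm x \<le> 2"
    and m: "\<bar>m\<bar> \<le> M" and H: "H > 0" "3 / 2 * H \<le> \<bar>(x $ i + m * x $ j) + (c $ i + m * c $ j)\<bar>"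
  defines "u \<equiv> x $ i - c $ i" and "\<tau> \<equiv> (x $ j - c $ j) - m * (x $ i - c $ i)"
  assumes \<tau>: "\<bar>\<tau>\<bar> \<le> \<theta> * norm (x - c)" "\<bar>\<tau>\<bar> \<le> K * norm (x - c) powr (1 + \<alpha>)" and "K \<ge> 0" "\<alpha> > 0"
    and \<theta>: "\<theta> \<le> 1 / 2" "\<theta> * (16 * (1 + M)) \<le> H" "\<theta> \<ge> 0"
  shows "norm (x - c) \<le> 2 * (1 + M) * \<bar>u\<bar>" "\<bar>\<tau>\<bar> \<le> K * (2 * (1 + M)) powr (1 + \<alpha>) * \<bar>u\<bar> powr (1 + \<alpha>)"
    "H * \<bar>u\<bar> \<le> \<bar>1 - x \<bullet> x\<bar>"
proof -
  let ?n = "norm (x - c)"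
  have M: "M \<ge> 0" using m by linarith
  have xj: "x $ j - c $ j = m * u + \<tau>" by (simp add: u_def \<tau>_def)
  have dec: "x - c = u *\<^sub>R axis i 1 + (m * u + \<tau>) *\<^sub>R axis j 1"
  proof -
    have "(x - c) $ n = (u *\<^sub>R axis i 1 + (m * u + \<tau>) *\<^sub>R axis j 1 :: real^3) $ n" for n
      using d xk xj u_def UNIV_3_distinct[OF d] UNIV_I[of n] by (auto simp: axis_def)
    then show ?thesis by (simp add: vec_eq_iff)
  qed
  have "?n \<le> \<bar>u\<bar> + \<bar>m * u + \<tau>\<bar>"
    unfolding dec by (rule norm_triangle_le) (simp add: norm_axis_1)
  also have "\<dots> \<le> \<bar>u\<bar> + (M * \<bar>u\<bar> + \<bar>\<tau>\<bar>)"
    using mult_right_mono[OF m, of "\<bar>u\<bar>"] abs_triangle_ineq[of "m * u" \<tau>] by (simp add: abs_mult)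
  finally have n: "?n \<le> (1 + M) * \<bar>u\<bar> + \<bar>\<tau>\<bar>" by (simp add: algebra_simps)
  moreover have "\<theta> * ?n \<le> 1 / 2 * ?n" using \<theta> by (intro mult_right_mono) auto
  ultimately show n2: "?n \<le> 2 * (1 + M) * \<bar>u\<bar>" using \<tau>(1) by linarith
  have "?n powr (1 + \<alpha>) \<le> (2 * (1 + M) * \<bar>u\<bar>) powr (1 + \<alpha>)"
    using n2 \<open>\<alpha> > 0\<close> by (intro powr_mono2) auto
  also have "\<dots> = (2 * (1 + M)) powr (1 + \<alpha>) * \<bar>u\<bar> powr (1 + \<alpha>)"
    using M by (simp add: powr_mult)
  finally have "K * ?n powr (1 + \<alpha>) \<le> K * ((2 * (1 + M)) powr (1 + \<alpha>) * \<bar>u\<bar> powr (1 + \<alpha>))"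
    using \<open>K \<ge> 0\<close> by (rule mult_left_mono)
  then show "\<bar>\<tau>\<bar> \<le> K * (2 * (1 + M)) powr (1 + \<alpha>) * \<bar>u\<bar> powr (1 + \<alpha>)"
    using \<tau>(2) by (simp add: mult.assoc)
  have "\<bar>\<tau>\<bar> \<le> \<theta> * (2 * (1 + M) * \<bar>u\<bar>)" using \<tau>(1) mult_left_mono[OF n2 \<theta>(3)] by linarith
  also have "\<dots> = (\<theta> * (16 * (1 + M))) * \<bar>u\<bar> / 8" by simp
  also have "\<dots> \<le> H * \<bar>u\<bar> / 8" using mult_right_mono[OF \<theta>(2), of "\<bar>u\<bar>"] by simp
  finally have t8: "\<bar>\<tau>\<bar> \<le> H * \<bar>u\<bar> / 8" .
  have "\<bar>x $ j + c $ j\<bar> \<le> 4"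
    using component_le_norm_cart[of x j] component_le_norm_cart[of c j] x c by linarith
  then have "\<bar>\<tau> * (x $ j + c $ j)\<bar> \<le> H * \<bar>u\<bar> / 8 * 4"
    unfolding abs_mult using t8 H by (intro mult_mono) auto
  moreover have "3 / 2 * H * \<bar>u\<bar> \<le> \<bar>u * ((x $ i + m * x $ j) + (c $ i + m * c $ j))\<bar>"
    unfolding abs_mult using mult_right_mono[OF H(2), of "\<bar>u\<bar>"] by (simp add: mult.commute)
  moreover have "1 - x \<bullet> x = - (u * ((x $ i + m * x $ j) + (c $ i + m * c $ j)) + \<tau> * (x $ j + c $ j))"
  proof -
    have "1 - x \<bullet> x = c \<bullet> c - x \<bullet> x" using c by (simp add: norm_eq_1)
    also have "\<dots> = - ((x - c) \<bullet> (x + c))" by (simp add: inner_diff_left inner_diff_right inner_add_right inner_commute[of c x])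
    also have "\<dots> = - (u * (x $ i + c $ i) + (m * u + \<tau>) * (x $ j + c $ j))"
      unfolding dec by (simp add: inner_add_left inner_axis')
    finally show ?thesis by (simp add: algebra_simps)
  qed
  ultimately show "H * \<bar>u\<bar> \<le> \<bar>1 - x \<bullet> x\<bar>" by linarith
qed

text \<open>
  The ruled set consists of the lines parallel to the tangent of the frontier at the crossing with the sphere, on
  those sides of the tangent on which \<open>U\<close> lies. The tangent line approximates the frontier to order \<open>1 + \<alpha>\<close> by the
  Hoelder condition on the gradient.
\<close>

lemma straightened_at_frontier:
  assumes "\<alpha> > 0" "open U" "C1_holder_transversal \<alpha> U" "p \<in> frontier U" "norm p = 1"
  obtains r i j k m S where "r > 0" "straightened_on U (ball p r) i j k m S"
proof -
  have pf: "p \<in> frontier U \<inter> sphere 0 1" using assms(4,5) by simp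
  from bspec[OF assms(3)[unfolded C1_holder_transversal_def] pf]
  obtain V F G where V: "open V" "p \<in> V" and C1: "C1_holder_on \<alpha> V F G" and fr: "frontier U \<inter> V = {x \<in> V. F x = 0}"
    and Gnz: "\<forall>x\<in>V. F x = 0 \<longrightarrow> G x \<noteq> 0"
    and tr: "\<forall>q\<in>V \<inter> sphere 0 1. F q = 0 \<longrightarrow> {u + v | u v. G q \<bullet> u = 0 \<and> q \<bullet> v = 0} = UNIV"
    by (elim exE conjE) (rule that)
  have Fp: "F p = 0" using fr V(2) assms(4) by blast
  have der: "GDERIV F x :> G x" if "x \<in> V" for x using C1 that unfolding C1_holder_on_def by blast
  have Gc: "continuous_on V G" using C1 unfolding C1_holder_on_def by blast
  obtain C' where C': "\<And>x y. x \<in> V \<Longrightarrow> y \<in> V \<Longrightarrow> dist (G x) (G y) \<le> C' * dist x y powr \<alpha>"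
    using C1 unfolding C1_holder_on_def by blast
  define C where "C = \<bar>C'\<bar>"
  have C: "C \<ge> 0" "\<And>x y. x \<in> V \<Longrightarrow> y \<in> V \<Longrightarrow> dist (G x) (G y) \<le> C * dist x y powr \<alpha>"
  proof -
    show "C \<ge> 0" by (simp add: C_def)
    fix x y assume "x \<in> V" "y \<in> V"
    note C'[OF this]
    also have "C' * dist x y powr \<alpha> \<le> C * dist x y powr \<alpha>" by (intro mult_right_mono) (auto simp: C_def)
    finally show "dist (G x) (G y) \<le> C * dist x y powr \<alpha>" .
  qed
  have "G p \<noteq> 0" using Gnz V(2) Fp by blast
  moreover have "{u + v | u v. G p \<bullet> u = 0 \<and> p \<bullet> v = 0} = UNIV" using tr V(2) Fp assms(5) by simp
  ultimately obtain i j where ij: "i \<noteq> j" "G p $ j \<noteq> 0" "p $ i * G p $ j - p $ j * G p $ i \<noteq> 0"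
    by (rule transversal_plane[OF assms(5)])
  obtain k where d: "distinct [i, j, k]" using third_index[OF ij(1)] by blast
  obtain N \<gamma> \<delta> where N: "open N" "p \<in> N" "N \<subseteq> V" and \<delta>: "\<delta> > 0"
    and con: "connected (N \<inter> {x. F x < 0})" "connected (N \<inter> {x. F x > 0})"
    and \<gamma>: "continuous_on {p$k - \<delta> <..< p$k + \<delta>} \<gamma>" "\<gamma> (p$k) = p"
    and \<gamma>z: "\<And>z. z \<in> {p$k - \<delta> <..< p$k + \<delta>} \<Longrightarrow> \<gamma> z \<in> N \<and> norm (\<gamma> z) = 1 \<and> F (\<gamma> z) = 0 \<and> \<gamma> z $ k = z"
  proof (rule crossing_chart[OF V der Gc assms(5) Fp d ij(3)])
    fix N \<delta> \<gamma>
    assume "open N" "p \<in> N" "N \<subseteq> V" "\<delta> > 0"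
      "connected (N \<inter> {x. F x < 0})" "connected (N \<inter> {x. F x > 0})"
      "continuous_on {p$k - \<delta> <..< p$k + \<delta>} \<gamma>" "\<gamma> (p$k) = p"
      "\<And>z. z \<in> {p$k - \<delta> <..< p$k + \<delta>} \<Longrightarrow> \<gamma> z \<in> N \<and> norm (\<gamma> z) = 1 \<and> F (\<gamma> z) = 0 \<and> \<gamma> z $ k = z"
    then show thesis by (rule that)
  qed
  \<comment> \<open>near \<open>p\<close> each of the two connected sides of the frontier lies entirely inside or entirely outside \<open>U\<close>;
    \<open>P\<close> records which, as a condition on the sign of \<open>F\<close>\<close>
  define P where "P = (\<lambda>t::real. (t < 0 \<and> N \<inter> {x. F x < 0} \<subseteq> U) \<or> (t > 0 \<and> N \<inter> {x. F x > 0} \<subseteq> U))"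
  have side: "Q \<subseteq> U" if "connected Q" "Q \<subseteq> N" "\<And>x. x \<in> Q \<Longrightarrow> F x \<noteq> 0" "x \<in> Q" "x \<in> U" for Q x
  proof (rule ccontr)
    assume "\<not> Q \<subseteq> U"
    then have "Q \<inter> frontier U \<noteq> {}" using that by (intro connected_Int_frontier) auto
    then obtain y where "y \<in> Q" "y \<in> frontier U" by blast
    then have "F y = 0" using fr N(3) that(2) by blast
    then show False using that(3) \<open>y \<in> Q\<close> by blast
  qed
  have UP: "x \<in> U \<longleftrightarrow> P (F x)" if "x \<in> N" for x
  proof
    assume xU: "x \<in> U"
    have "x \<notin> frontier U" using xU assms(2) by (simp add: frontier_def interior_open)
    then have "F x \<noteq> 0" using fr N(3) that by blast
    then consider "F x < 0" | "F x > 0" by linarith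
    then show "P (F x)"
    proof cases
      case 1
      then show ?thesis using side[OF con(1), of x] that xU by (auto simp: P_def)
    next
      case 2
      then show ?thesis using side[OF con(2), of x] that xU by (auto simp: P_def)
    qed
  qed (use that in \<open>auto simp: P_def\<close>)
  \<comment> \<open>\<open>mm\<close> is the slope of the tangent line to the frontier in the slice plane; \<open>H\<close> measures the angle
    between that line and the sphere at \<open>p\<close>, and \<open>\<theta>\<close> is the largest relative deviation from the tangent
    line for which this angle survives\<close>
  define mm where "mm = (\<lambda>y. - (G y $ i / G y $ j))"
  define H where "H = \<bar>p $ i + mm p * p $ j\<bar>"
  have H: "H > 0"
  proof -
    have "p $ i + mm p * p $ j = (p $ i * G p $ j - p $ j * G p $ i) / G p $ j"
      using ij(2) by (simp add: mm_def field_simps)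
    then show ?thesis using ij(2,3) by (simp add: H_def)
  qed
  define M where "M = \<bar>mm p\<bar> + 1"
  define b where "b = \<bar>G p $ j\<bar> / 2"
  define \<theta> where "\<theta> = min (1 / 2) (H / (16 * (1 + M)))"
  have M: "M \<ge> 1" by (simp add: M_def)
  have b: "b > 0" using ij(2) by (simp add: b_def)
  have \<theta>: "\<theta> > 0" "\<theta> \<le> 1 / 2" "\<theta> * (16 * (1 + M)) \<le> H"
  proof -
    show "\<theta> > 0" using H M by (simp add: \<theta>_def)
    show "\<theta> \<le> 1 / 2" unfolding \<theta>_def by (rule min.cobounded1)
    have "\<theta> \<le> H / (16 * (1 + M))" by (simp add: \<theta>_def)
    then show "\<theta> * (16 * (1 + M)) \<le> H" using M by (simp add: pos_le_divide_eq)
  qed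
  have Gj: "isCont (\<lambda>y. G y $ n) p" for n
    using Gc V by (auto simp: continuous_on_eq_continuous_at intro!: continuous_intros)
  have mmc: "isCont mm p" unfolding mm_def by (intro continuous_intros Gj ij(2))
  have nh: "\<forall>\<^sub>F y in nhds p. \<bar>f y - f p\<bar> < e" if "isCont f p" "e > 0" for f :: "real^3 \<Rightarrow> real" and e
    using that unfolding continuous_at_eps_delta eventually_nhds_metric dist_real_def by blast
  have "\<forall>\<^sub>F y in nhds p. y \<in> N \<and> \<bar>G y $ j - G p $ j\<bar> < b \<and> \<bar>mm y - mm p\<bar> < min 1 (H / 8)"
  proof (intro eventually_conj)
    show "\<forall>\<^sub>F y in nhds p. y \<in> N" by (rule eventually_nhds_in_open[OF N(1,2)])
    show "\<forall>\<^sub>F y in nhds p. \<bar>G y $ j - G p $ j\<bar> < b"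
      by (rule nh[OF Gj b])
    show "\<forall>\<^sub>F y in nhds p. \<bar>mm y - mm p\<bar> < min 1 (H / 8)"
      by (rule nh[OF mmc]) (use H in simp)
  qed
  then obtain e where e: "e > 0"
    "\<And>y. dist y p < e \<Longrightarrow> y \<in> N \<and> \<bar>G y $ j - G p $ j\<bar> < b \<and> \<bar>mm y - mm p\<bar> < min 1 (H / 8)"
    unfolding eventually_nhds_metric by blast
  \<comment> \<open>the last bound makes the Hoelder remainder at most \<open>\<theta> * b * norm (x - c)\<close> for points of \<open>ball p r0\<close>\<close>
  define r0 where "r0 = min (min e 1) (min (H / (8 * (1 + M))) ((\<theta> * b / (C + 1)) powr (1 / \<alpha>) / 2))"
  have r0: "r0 > 0" "r0 \<le> e" "r0 \<le> 1" "r0 \<le> H / (8 * (1 + M))" "r0 \<le> (\<theta> * b / (C + 1)) powr (1 / \<alpha>) / 2"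
  proof -
    show "r0 > 0" using e(1) H M \<theta>(1) b C(1) by (simp add: r0_def)
    have "min (min A B) (min C D) \<le> A \<and> min (min A B) (min C D) \<le> B \<and> min (min A B) (min C D) \<le> C
      \<and> min (min A B) (min C D) \<le> D" for A B C D :: real by auto
    then show "r0 \<le> e" "r0 \<le> 1" "r0 \<le> H / (8 * (1 + M))" "r0 \<le> (\<theta> * b / (C + 1)) powr (1 / \<alpha>) / 2"
      unfolding r0_def by blast+
  qed
  have n0: "norm q < r0 + r0 \<Longrightarrow> C * norm q powr \<alpha> \<le> \<theta> * b" for q :: "real^3"
  proof -
    assume "norm q < r0 + r0"
    then have "norm q \<le> (\<theta> * b / (C + 1)) powr (1 / \<alpha>)" using r0(5) by linarith
    then have "norm q powr \<alpha> \<le> ((\<theta> * b / (C + 1)) powr (1 / \<alpha>)) powr \<alpha>"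
      using assms(1) by (intro powr_mono2) auto
    also have "\<dots> = \<theta> * b / (C + 1)" using assms(1) \<theta>(1) b C(1) by (simp add: powr_powr)
    finally have "(C + 1) * norm q powr \<alpha> \<le> \<theta> * b" using C(1) by (simp add: pos_le_divide_eq mult.commute)
    moreover have "C * norm q powr \<alpha> \<le> (C + 1) * norm q powr \<alpha>" by (intro mult_right_mono) auto
    ultimately show ?thesis by linarith
  qed
  have B0: "y \<in> N" "\<bar>mm y\<bar> \<le> M" "b \<le> \<bar>G y $ j\<bar>" "G p $ j * G y $ j > 0" if "y \<in> ball p r0" for y
  proof -
    have ey: "y \<in> N" "\<bar>G y $ j - G p $ j\<bar> < b" "\<bar>mm y - mm p\<bar> < 1"
      using e(2)[of y] that r0(2) by (auto simp: dist_commute)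
    then show "y \<in> N" "\<bar>mm y\<bar> \<le> M" by (auto simp: M_def)
    show "b \<le> \<bar>G y $ j\<bar>" using ey(2) unfolding b_def by linarith
    show "G p $ j * G y $ j > 0"
    proof -
      have "0 < G p $ j \<and> 0 < G y $ j \<or> G p $ j < 0 \<and> G y $ j < 0"
        using ey(2) ij(2) unfolding b_def by linarith
      then show ?thesis unfolding zero_less_mult_iff .
    qed
  qed
  have h0: "\<bar>(x $ i + mm y * x $ j) - (p $ i + mm p * p $ j)\<bar> \<le> H / 4" if "x \<in> ball p r0" "y \<in> ball p r0" for x y
  proof -
    have xp: "\<bar>x $ n - p $ n\<bar> \<le> r0" for n
      using component_le_norm_cart[of "x - p" n] that(1) by (simp add: dist_norm norm_minus_commute)
    have my: "\<bar>mm y - mm p\<bar> \<le> H / 8" using e(2)[of y] that(2) r0(2) by (auto simp: dist_commute)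
    have pj: "\<bar>p $ j\<bar> \<le> 1" using component_le_norm_cart[of p j] assms(5) by simp
    have 1: "\<bar>mm y * (x $ j - p $ j)\<bar> \<le> M * r0"
      unfolding abs_mult using B0(2)[OF that(2)] xp by (intro mult_mono) (use M in auto)
    have 2: "\<bar>(mm y - mm p) * p $ j\<bar> \<le> H / 8 * 1"
      unfolding abs_mult using my pj by (intro mult_mono) (use H in auto)
    have "(x $ i + mm y * x $ j) - (p $ i + mm p * p $ j)
      = (x $ i - p $ i) + (mm y * (x $ j - p $ j) + (mm y - mm p) * p $ j)" by (simp add: algebra_simps)
    moreover have "r0 + M * r0 \<le> H / 8" using r0(4) M by (simp add: pos_le_divide_eq algebra_simps)
    ultimately show ?thesis using 1 2 xp[of i] by linarith
  qed
  \<comment> \<open>the crossing curve stays in the small ball\<close>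
  obtain r where r: "r > 0" "r \<le> r0" "r \<le> \<delta>" "\<And>z. \<bar>z - p $ k\<bar> < r \<Longrightarrow> \<gamma> z \<in> ball p r0"
  proof -
    have "isCont \<gamma> (p $ k)" using \<gamma>(1) \<delta> by (simp add: continuous_on_eq_continuous_at)
    then obtain e' where e': "e' > 0" "\<And>z. \<bar>z - p $ k\<bar> < e' \<Longrightarrow> dist (\<gamma> z) (\<gamma> (p $ k)) < r0"
      using r0(1) unfolding continuous_at_eps_delta dist_real_def by blast
    show ?thesis
      by (rule that[of "min e' (min r0 \<delta>)"]) (use e' r0(1) \<delta> \<gamma>(2) in \<open>auto simp: dist_commute\<close>)
  qed
  define I where "I = {p$k - r <..< p$k + r}"
  have I: "z \<in> I \<longleftrightarrow> \<bar>z - p $ k\<bar> < r" for z by (auto simp: I_def abs_less_iff)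
  have \<gamma>I: "\<gamma> z \<in> ball p r0" "norm (\<gamma> z) = 1" "F (\<gamma> z) = 0" "\<gamma> z $ k = z" if "z \<in> I" for z
    using r(3,4) \<gamma>z[of z] that by (auto simp: I abs_less_iff)
  define m where "m = (\<lambda>z. if z \<in> I then mm (\<gamma> z) else 0)"
  define \<xi> where "\<xi> = (\<lambda>z. if z \<in> I then \<gamma> z $ i else 0)"
  define \<beta> where "\<beta> = (\<lambda>z. if z \<in> I then \<gamma> z $ j - mm (\<gamma> z) * \<gamma> z $ i else 0)"
  have c\<gamma>: "continuous_on I \<gamma>" by (rule continuous_on_subset[OF \<gamma>(1)]) (use r in \<open>auto simp: I_def\<close>)
  have cmm: "continuous_on I (\<lambda>z. mm (\<gamma> z))"
  proof -
    have "continuous_on I (\<lambda>z. G (\<gamma> z))"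
      by (rule continuous_on_compose2[OF Gc c\<gamma>]) (use \<gamma>I(1) B0(1) N(3) in blast)
    then show ?thesis unfolding mm_def
      by (intro continuous_intros) (use B0(3)[OF \<gamma>I(1)] b in force)+
  qed
  have meas: "m \<in> borel_measurable borel" "\<xi> \<in> borel_measurable borel" "\<beta> \<in> borel_measurable borel"
    unfolding m_def \<xi>_def \<beta>_def
    by (intro borel_measurable_continuous_on_if continuous_intros cmm c\<gamma>; simp add: I_def)+
  have mM: "\<bar>m z\<bar> \<le> M" for z using B0(2)[OF \<gamma>I(1)] M by (auto simp: m_def)
  define S where "S = {q. P (G p $ j * (snd q - \<beta> (fst q)))}"
  have S: "S \<in> sets borel"
  proof -
    note [measurable] = meas
    have "Measurable.pred (borel \<Otimes>\<^sub>M borel) (\<lambda>q. P (G p $ j * (snd q - \<beta> (fst q))))"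
      unfolding P_def by measurable
    then show ?thesis unfolding S_def borel_prod[symmetric] pred_def by (simp add: space_pair_measure)
  qed
  define D where "D = ball p r \<inter> {x. x \<in> U \<longleftrightarrow> x \<notin> ruled i j k m S}"
  have Db: "D \<in> sets borel"
  proof -
    have "D = ball p r \<inter> ((U - ruled i j k m S) \<union> (ruled i j k m S - U))" by (auto simp: D_def)
    moreover have "U \<in> sets borel" using assms(2) by simp
    ultimately show ?thesis using sets_ruled[OF meas(1) S] by auto
  qed
  have xk: "x $ k \<in> I" if "x \<in> ball p r" for x
    using component_le_norm_cart[of "x - p" k] that by (simp add: I dist_norm norm_minus_commute)
  have xr0: "x \<in> ball p r0" if "x \<in> ball p r" for x using that r(2) by auto
  have nx: "norm x \<le> 2" if "x \<in> ball p r" for x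
    using norm_triangle_ineq2[of x p] xr0[OF that] r0(3) assms(5) by (simp add: dist_norm norm_minus_commute)
  have est: "\<bar>x $ k - p $ k\<bar> \<le> r \<and> \<bar>x $ i - \<xi> (x $ k)\<bar> \<le> 3
      \<and> \<bar>x $ j - m (x $ k) * x $ i - \<beta> (x $ k)\<bar> \<le> C / b * (2 * (1 + M)) powr (1 + \<alpha>) * \<bar>x $ i - \<xi> (x $ k)\<bar> powr (1 + \<alpha>)
      \<and> H * \<bar>x $ i - \<xi> (x $ k)\<bar> \<le> \<bar>1 - x \<bullet> x\<bar> \<and> (x $ i = \<xi> (x $ k) \<longrightarrow> x \<bullet> x = 1)" if xD: "x \<in> D" for x
  proof -
    have xB: "x \<in> ball p r" and diff: "x \<in> U \<longleftrightarrow> x \<notin> ruled i j k m S" using xD by (auto simp: D_def)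
    define z c where "z = x $ k" and "c = \<gamma> z"
    have z: "z \<in> I" using xk[OF xB] by (simp add: z_def)
    note cz = \<gamma>I[OF z, folded c_def]
    have mz: "m z = mm c" "\<xi> z = c $ i" "\<beta> z = c $ j - mm c * c $ i"
      using z by (auto simp: m_def \<xi>_def \<beta>_def c_def)
    define \<tau> where "\<tau> = (x $ j - c $ j) - mm c * (x $ i - c $ i)"
    have \<tau>: "x $ j - m z * x $ i - \<beta> z = \<tau>" by (simp add: mz \<tau>_def algebra_simps)
    define T where "T = G c $ j * \<tau>"
    have Gcj: "G c $ j \<noteq> 0" using B0(3)[OF cz(1)] b by auto
    have dotT: "G c \<bullet> (x - c) = T"
    proof -
      have "G c \<bullet> (x - c) = (\<Sum>n\<in>{i, j, k}. G c $ n * (x - c) $ n)"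
        unfolding UNIV_3_distinct[OF d, symmetric] by (simp add: inner_vec_def)
      also have "\<dots> = G c $ i * (x $ i - c $ i) + G c $ j * (x $ j - c $ j)"
        using d cz(4) by (simp add: z_def)
      also have "\<dots> = T" using Gcj by (simp add: T_def \<tau>_def mm_def field_simps)
      finally show ?thesis .
    qed
    have ball_V: "ball p r0 \<subseteq> V" using B0(1) N(3) by blast
    have "\<bar>F x - F c - G c \<bullet> (x - c)\<bar> \<le> C * norm (x - c) powr (1 + \<alpha>)"
    proof (rule holder_taylor[OF convex_ball xr0[OF xB] cz(1) _ _ C(1) assms(1)])
      show "GDERIV F q :> G q" if "q \<in> ball p r0" for q using der that ball_V by blast
      show "dist (G q) (G q') \<le> C * dist q q' powr \<alpha>" if "q \<in> ball p r0" "q' \<in> ball p r0" for q q'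
        using C(2) that ball_V by blast
    qed
    then have tay: "\<bar>F x - T\<bar> \<le> C * norm (x - c) powr (1 + \<alpha>)" by (simp add: cz(3) dotT)
    have ru: "x \<in> ruled i j k m S \<longleftrightarrow> P (G p $ j * \<tau>)"
      using \<tau> by (simp add: ruled_def S_def z_def)
    have sg: "sgn (G p $ j * \<tau>) = sgn T"
    proof -
      have "sgn (G p $ j) = sgn (G c $ j)" using B0(4)[OF cz(1)] by (auto simp: zero_less_mult_iff)
      then show ?thesis by (simp add: T_def sgn_mult)
    qed
    have Psgn: "P s \<longleftrightarrow> P t" if "sgn s = sgn t" for s t using that by (auto simp: P_def sgn_if split: if_splits)
    \<comment> \<open>membership in \<open>U\<close> is governed by the sign of \<open>F x\<close>, membership in the ruled set by that of its linear
      part \<open>T\<close>; where the two sets disagree, \<open>T\<close> is therefore at most the Taylor remainder\<close>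
    have "F x * T \<le> 0"
    proof (rule ccontr)
      assume "\<not> F x * T \<le> 0"
      then have "sgn (F x) = sgn T" by (auto simp: zero_less_mult_iff not_le)
      then have "P (F x) \<longleftrightarrow> P (G p $ j * \<tau>)" using sg Psgn by metis
      then show False using diff ru UP[OF B0(1)[OF xr0[OF xB]]] by blast
    qed
    then have "\<bar>T\<bar> \<le> \<bar>F x - T\<bar>" by (auto simp: mult_le_0_iff abs_if)
    then have T: "\<bar>T\<bar> \<le> C * norm (x - c) powr (1 + \<alpha>)" using tay by linarith
    have "b * \<bar>\<tau>\<bar> \<le> \<bar>T\<bar>" unfolding T_def abs_mult using B0(3)[OF cz(1)] by (intro mult_right_mono) auto
    then have bt: "b * \<bar>\<tau>\<bar> \<le> C * norm (x - c) powr (1 + \<alpha>)" using T by linarith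
    then have t2: "\<bar>\<tau>\<bar> \<le> C / b * norm (x - c) powr (1 + \<alpha>)" using b by (simp add: field_simps)
    have t1: "\<bar>\<tau>\<bar> \<le> \<theta> * norm (x - c)"
    proof -
      have "dist x c < r0 + r0" using xr0[OF xB] cz(1) dist_triangle2[of x c p] by (simp add: dist_commute)
      then have "C * norm (x - c) powr \<alpha> \<le> \<theta> * b" by (intro n0) (simp add: dist_norm)
      then have "(C * norm (x - c) powr \<alpha>) * norm (x - c) \<le> \<theta> * b * norm (x - c)" by (rule mult_right_mono) simp
      moreover have "norm (x - c) powr (1 + \<alpha>) = norm (x - c) powr \<alpha> * norm (x - c)"
        by (cases "x = c") (simp_all add: powr_add)
      ultimately have "b * \<bar>\<tau>\<bar> \<le> b * (\<theta> * norm (x - c))" using bt by (simp add: mult_ac)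
      then show ?thesis using b by simp
    qed
    have Hh: "3 / 2 * H \<le> \<bar>(x $ i + mm c * x $ j) + (c $ i + mm c * c $ j)\<bar>"
    proof -
      have "3 / 2 * \<bar>h\<bar> \<le> \<bar>s + t\<bar>" if "\<bar>s - h\<bar> \<le> \<bar>h\<bar> / 4" "\<bar>t - h\<bar> \<le> \<bar>h\<bar> / 4" for s t h :: real
      proof -
        have "3 / 2 * h \<le> s + t" if "h \<ge> 0" using that \<open>\<bar>s - h\<bar> \<le> \<bar>h\<bar> / 4\<close> \<open>\<bar>t - h\<bar> \<le> \<bar>h\<bar> / 4\<close> by linarith
        moreover have "s + t \<le> 3 / 2 * h" if "h < 0" using that \<open>\<bar>s - h\<bar> \<le> \<bar>h\<bar> / 4\<close> \<open>\<bar>t - h\<bar> \<le> \<bar>h\<bar> / 4\<close> by linarith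
        ultimately show ?thesis by (cases "h \<ge> 0") linarith+
      qed
      then show ?thesis
        using h0[OF xr0[OF xB] cz(1)] h0[OF cz(1) cz(1)] unfolding H_def by blast
    qed
    note we = wedge_estimate[OF d _ cz(2) nx[OF xB] B0(2)[OF cz(1)] H Hh t1[unfolded \<tau>_def] t2[unfolded \<tau>_def] _ assms(1) \<theta>(2,3)]
    have we': "norm (x - c) \<le> 2 * (1 + M) * \<bar>x $ i - c $ i\<bar>"
      "\<bar>\<tau>\<bar> \<le> C / b * (2 * (1 + M)) powr (1 + \<alpha>) * \<bar>x $ i - c $ i\<bar> powr (1 + \<alpha>)"
      "H * \<bar>x $ i - c $ i\<bar> \<le> \<bar>1 - x \<bullet> x\<bar>"
      using we cz(4) C(1) b \<theta>(1) by (auto simp: z_def \<tau>_def)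
    have "x = c" if "x $ i = c $ i" using we'(1) that by simp
    moreover have "c \<bullet> c = 1" using cz(2) by (simp add: norm_eq_1)
    moreover have "\<bar>x $ i - c $ i\<bar> \<le> 3"
      using component_le_norm_cart[of x i] component_le_norm_cart[of c i] nx[OF xB] cz(2) by linarith
    moreover have "\<bar>x $ k - p $ k\<bar> \<le> r" using xk[OF xB] by (simp add: I)
    ultimately show ?thesis using we' \<tau> by (auto simp: z_def[symmetric] mz)
  qed
  have int: "integrable lborel (\<lambda>x. indicator D x / (1 - x \<bullet> x)^2 :: real)"
    by (rule wedge_integrable[OF meas Db d assms(1), of "C / b * (2 * (1 + M)) powr (1 + \<alpha>)" H 3 r "p $ k"])
       (use est H r(1) C(1) b in auto)
  have "\<exists>c0>0. \<forall>x\<in>ball p r. c0 \<le> \<bar>x \<bullet> slice_dir i j k m x\<bar>"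
  proof (intro exI[of _ "H / 2"] conjI ballI)
    fix x assume x: "x \<in> ball p r"
    have sd: "x \<bullet> slice_dir i j k m x = x $ i + mm (\<gamma> (x $ k)) * x $ j"
      using xk[OF x] by (simp add: slice_dir_def m_def inner_add_right inner_axis)
    show "H / 2 \<le> \<bar>x \<bullet> slice_dir i j k m x\<bar>"
    proof -
      have "\<bar>h\<bar> / 2 \<le> \<bar>s\<bar>" if "\<bar>s - h\<bar> \<le> \<bar>h\<bar> / 4" for s h :: real using that by linarith
      from this[OF h0[OF xr0[OF x] \<gamma>I(1)[OF xk[OF x]], unfolded H_def]] show ?thesis
        unfolding sd H_def .
    qed
  qed (use H in simp)
  then have "straightened_on U (ball p r) i j k m S"
    unfolding straightened_on_def using d meas(1) mM S int unfolding D_def by (auto simp: bounded_iff)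
  then show ?thesis using that r(1) by blast
qed

section \<open>A spline partition of unity\<close>

definition C2_real :: "(real \<Rightarrow> real) \<Rightarrow> (real \<Rightarrow> real) \<Rightarrow> (real \<Rightarrow> real) \<Rightarrow> bool" where
  "C2_real h h1 h2 \<longleftrightarrow> (\<forall>t. (h has_real_derivative h1 t) (at t)) \<and> (\<forall>t. (h1 has_real_derivative h2 t) (at t))
     \<and> continuous_on UNIV h2"

lemma C2_real_affine:
  assumes "C2_real h h1 h2"
  shows "C2_real (\<lambda>t. h (c * t + e)) (\<lambda>t. c * h1 (c * t + e)) (\<lambda>t. c^2 * h2 (c * t + e))"
proof -
  have aff: "((\<lambda>t. c * t + e) has_real_derivative c) (at t)" for t by (auto intro!: derivative_eq_intros)
  have 1: "((\<lambda>t. h (c * t + e)) has_real_derivative h1 (c * t + e) * c) (at t)"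
    "((\<lambda>t. h1 (c * t + e)) has_real_derivative h2 (c * t + e) * c) (at t)" for t
    using assms unfolding C2_real_def by (auto intro!: DERIV_chain2[OF _ aff])
  have 2: "continuous_on UNIV (\<lambda>t. h2 (c * t + e))"
    using assms unfolding C2_real_def by (auto intro!: continuous_on_compose2[of UNIV h2] continuous_intros)
  show ?thesis
    unfolding C2_real_def using 1 2 DERIV_cmult[OF 1(2), of c]
    by (auto intro!: continuous_intros simp: mult_ac power2_eq_square)
qed

lemma C2_real_lincomb:
  assumes "C2_real h h1 h2" "C2_real g g1 g2"
  shows "C2_real (\<lambda>t. a * h t + b * g t) (\<lambda>t. a * h1 t + b * g1 t) (\<lambda>t. a * h2 t + b * g2 t)"
  using assms unfolding C2_real_def by (auto intro!: DERIV_add DERIV_cmult continuous_intros)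

lemma C2_real_positive_part_cubed: "C2_real (\<lambda>t. (max 0 t)^3) (\<lambda>t. 3 * (max 0 t)^2) (\<lambda>t. 6 * max 0 t)"
proof -
  have sq: "((\<lambda>t::real. (max 0 t)^2) has_real_derivative 2 * max 0 t) (at t)" for t
  proof -
    consider "t > 0" | "t < 0" | "t = 0" by linarith
    then show ?thesis
    proof cases
      case 1
      have "((\<lambda>t. t^2) has_real_derivative 2 * t) (at t)" by (auto intro!: derivative_eq_intros)
      then have "((\<lambda>t::real. (max 0 t)^2) has_real_derivative 2 * t) (at t)"
        by (rule has_field_derivative_transform_within_open[of _ _ _ "{0<..}"]) (use 1 in auto)
      then show ?thesis using 1 by simp
    next
      case 2
      have "((\<lambda>t::real. (max 0 t)^2) has_real_derivative 0) (at t)"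
        by (rule has_field_derivative_transform_within_open[of "\<lambda>_. 0" _ _ "{..<0}"]) (use 2 in auto)
      then show ?thesis using 2 by simp
    next
      case 3
      have "((\<lambda>h::real. (max 0 h)^2 / h) \<longlongrightarrow> 0) (at 0)"
      proof (rule Lim_null_comparison)
        show "\<forall>\<^sub>F h::real in at 0. norm ((max 0 h)^2 / h) \<le> \<bar>h\<bar>"
          by (intro always_eventually allI) (auto simp: max_def power2_eq_square)
        show "((\<lambda>h::real. \<bar>h\<bar>) \<longlongrightarrow> 0) (at 0)" by (rule tendsto_rabs_zero) (rule tendsto_ident_at)
      qed
      then show ?thesis using 3 by (simp add: has_field_derivative_iff)
    qed
  qed
  have cube: "(max 0 t)^3 = t * (max 0 t)^2" for t :: real by (auto simp: max_def power3_eq_cube power2_eq_square)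
  have "((\<lambda>t::real. (max 0 t)^3) has_real_derivative 3 * (max 0 t)^2) (at t)" for t
    unfolding cube using DERIV_mult[OF DERIV_ident sq, of t]
    by (auto simp: max_def power2_eq_square elim: back_subst[where P="\<lambda>x. (_ has_real_derivative x) _"])
  moreover have "((\<lambda>t::real. 3 * (max 0 t)^2) has_real_derivative 6 * max 0 t) (at t)" for t
    using DERIV_cmult[OF sq, of 3 t] by simp
  moreover have "continuous_on UNIV (\<lambda>t::real. 6 * max 0 t)" by (intro continuous_intros)
  ultimately show ?thesis unfolding C2_real_def by blast
qed

text \<open>The integrated quadratic B-spline.\<close>
definition spline_step :: "real \<Rightarrow> real" where
  "spline_step t = ((max 0 t)^3 - 3 * (max 0 (t - 1))^3 + 3 * (max 0 (t - 2))^3 - (max 0 (t - 3))^3) / 6"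

lemma spline_step_values:
  "t \<le> 0 \<Longrightarrow> spline_step t = 0" "t \<ge> 3 \<Longrightarrow> spline_step t = 1"
  by (simp_all add: spline_step_def max_def power3_eq_cube algebra_simps)

lemma C2_real_spline_step: "\<exists>h1 h2. C2_real spline_step h1 h2"
proof -
  note C = C2_real_positive_part_cubed
  note s = C2_real_affine[OF C, where c=1]
  note l = C2_real_lincomb[OF C2_real_lincomb[OF s[of 0] s[of "-1"], of "1/6" "-3/6"]
      C2_real_lincomb[OF s[of "-2"] s[of "-3"], of "3/6" "-1/6"], of 1 1]
  have "spline_step = (\<lambda>t. 1 * (1/6 * (max 0 (1 * t + 0))^3 + -3/6 * (max 0 (1 * t + -1))^3) +
       1 * (3/6 * (max 0 (1 * t + -2))^3 + -1/6 * (max 0 (1 * t + -3))^3))"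
    by (auto simp: spline_step_def fun_eq_iff field_simps)
  with l show ?thesis by (metis (no_types, lifting))
qed

text \<open>
  The bumps at consecutive integers \<open>e\<close> add up to \<open>1\<close> because their sum telescopes.
\<close>

definition spline_bump :: "real \<Rightarrow> real \<Rightarrow> real \<Rightarrow> real" where
  "spline_bump \<eta> e t = spline_step (t / \<eta> - e) - spline_step (t / \<eta> - e - 1)"

lemma spline_bump_support:
  assumes "\<eta> > 0" "t \<notin> {\<eta> * e .. \<eta> * (e + 4)}"
  shows "spline_bump \<eta> e t = 0"
proof -
  have "t / \<eta> < e \<or> t / \<eta> > e + 4"
    using assms by (auto simp: pos_divide_less_eq pos_less_divide_eq mult.commute)
  then show ?thesis by (auto simp: spline_bump_def spline_step_values)
qed

lemma sum_spline_bump: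
  assumes "\<eta> > 0" "\<bar>t\<bar> \<le> \<eta> * (real K - 3)"
  shows "(\<Sum>n<2*K. spline_bump \<eta> (real n - real K) t) = 1"
proof -
  have "\<bar>t / \<eta>\<bar> \<le> real K - 3" using assms by (simp add: pos_divide_le_eq mult.commute)
  then have q: "t / \<eta> \<le> real K - 3" "- (real K - 3) \<le> t / \<eta>" by linarith+
  have "(\<Sum>n<2*K. spline_bump \<eta> (real n - real K) t)
     = (\<Sum>n<2*K. spline_step (t / \<eta> - real n + real K) - spline_step (t / \<eta> - real (Suc n) + real K))"
    by (simp add: spline_bump_def algebra_simps)
  also have "\<dots> = spline_step (t / \<eta> - real 0 + real K) - spline_step (t / \<eta> - real (2 * K) + real K)"
    by (rule sum_lessThan_telescope')
  also have "spline_step (t / \<eta> - real 0 + real K) = 1"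
    by (rule spline_step_values(2)) (use q(2) in simp)
  also have "spline_step (t / \<eta> - real (2 * K) + real K) = 0"
    by (rule spline_step_values(1)) (use q(1) in simp)
  finally show ?thesis by simp
qed

lemma C2_real_spline_bump: "\<exists>h1 h2. C2_real (spline_bump \<eta> e) h1 h2"
proof -
  obtain h1 h2 where h: "C2_real spline_step h1 h2" using C2_real_spline_step by blast
  have "spline_bump \<eta> e = (\<lambda>t. 1 * spline_step (1 / \<eta> * t + - e) + -1 * spline_step (1 / \<eta> * t + (- e - 1)))"
    by (auto simp: spline_bump_def fun_eq_iff algebra_simps)
  with C2_real_lincomb[OF C2_real_affine[OF h] C2_real_affine[OF h], of 1 "1 / \<eta>" "- e" "-1" "1 / \<eta>" "- e - 1"]
  show ?thesis by (metis (no_types, lifting))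
qed

lemma C2_along_lines_coordinate:
  assumes "C2_real h h1 h2"
  shows "C2_along_lines (\<lambda>x. h (x $ l)) (\<lambda>x v. h1 (x $ l) * v $ l) (\<lambda>x v. h2 (x $ l) * (v $ l)^2)"
proof -
  have d: "(h has_real_derivative h1 t) (at t)" "(h1 has_real_derivative h2 t) (at t)" for t
    using assms unfolding C2_real_def by auto
  have c: "continuous_on UNIV h" "continuous_on UNIV h1" "continuous_on UNIV h2"
    using d assms unfolding C2_real_def by (auto intro!: continuous_at_imp_continuous_on DERIV_isCont)
  have aff: "((\<lambda>s. (q + s *\<^sub>R v) $ l) has_real_derivative v $ l) (at s)" for q v s
    by (auto intro!: derivative_eq_intros)
  have "((\<lambda>s. h ((q + s *\<^sub>R v) $ l)) has_real_derivative h1 ((q + s *\<^sub>R v) $ l) * v $ l) (at s)" for q v s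
    by (rule DERIV_chain2[OF d(1) aff])
  moreover have "((\<lambda>s. h1 ((q + s *\<^sub>R v) $ l) * v $ l) has_real_derivative h2 ((q + s *\<^sub>R v) $ l) * (v $ l)^2) (at s)" for q v s
    using DERIV_cmult_right[OF DERIV_chain2[OF d(2) aff[of q v s]], of "v $ l"] by (simp add: power2_eq_square mult.assoc)
  ultimately show ?thesis
    unfolding C2_along_lines_def case_prod_beta
    by (auto intro!: continuous_intros continuous_on_compose2[OF c(1)] continuous_on_compose2[OF c(2)] continuous_on_compose2[OF c(3)])
qed

lemma C2_along_lines_mult:
  assumes "C2_along_lines \<phi> \<phi>1 \<phi>2" "C2_along_lines \<psi> \<psi>1 \<psi>2"
  shows "C2_along_lines (\<lambda>x. \<phi> x * \<psi> x) (\<lambda>x v. \<phi>1 x v * \<psi> x + \<phi> x * \<psi>1 x v)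
     (\<lambda>x v. \<phi>2 x v * \<psi> x + 2 * (\<phi>1 x v * \<psi>1 x v) + \<phi> x * \<psi>2 x v)"
proof -
  have A: "((\<lambda>s. \<phi> (q + s *\<^sub>R v)) has_real_derivative \<phi>1 (q + s *\<^sub>R v) v) (at s)"
    "((\<lambda>s. \<phi>1 (q + s *\<^sub>R v) v) has_real_derivative \<phi>2 (q + s *\<^sub>R v) v) (at s)" for q v s
    using assms(1) unfolding C2_along_lines_def by blast+
  have B: "((\<lambda>s. \<psi> (q + s *\<^sub>R v)) has_real_derivative \<psi>1 (q + s *\<^sub>R v) v) (at s)"
    "((\<lambda>s. \<psi>1 (q + s *\<^sub>R v) v) has_real_derivative \<psi>2 (q + s *\<^sub>R v) v) (at s)" for q v s
    using assms(2) unfolding C2_along_lines_def by blast+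
  have c: "continuous_on UNIV \<phi>" "continuous_on UNIV \<psi>" using assms by (auto intro: C2_along_lines_continuous)
  have c2: "continuous_on UNIV (\<lambda>p. \<phi> (fst p))" "continuous_on UNIV (\<lambda>p. \<psi> (fst p))"
    by (auto intro!: continuous_on_compose2[OF c(1)] continuous_on_compose2[OF c(2)] continuous_intros)
  have c12: "continuous_on UNIV (\<lambda>p. \<phi>1 (fst p) (snd p))" "continuous_on UNIV (\<lambda>p. \<phi>2 (fst p) (snd p))"
     "continuous_on UNIV (\<lambda>p. \<psi>1 (fst p) (snd p))" "continuous_on UNIV (\<lambda>p. \<psi>2 (fst p) (snd p))"
    using assms unfolding C2_along_lines_def case_prod_beta by auto
  show ?thesis
    unfolding C2_along_lines_def case_prod_beta
  proof (intro conjI allI)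
    fix q v s
    show "((\<lambda>s. \<phi> (q + s *\<^sub>R v) * \<psi> (q + s *\<^sub>R v)) has_real_derivative
        \<phi>1 (q + s *\<^sub>R v) v * \<psi> (q + s *\<^sub>R v) + \<phi> (q + s *\<^sub>R v) * \<psi>1 (q + s *\<^sub>R v) v) (at s)"
      using DERIV_mult[OF A(1)[of q v s] B(1)[of q v s]] by (simp add: algebra_simps)
    show "((\<lambda>s. \<phi>1 (q + s *\<^sub>R v) v * \<psi> (q + s *\<^sub>R v) + \<phi> (q + s *\<^sub>R v) * \<psi>1 (q + s *\<^sub>R v) v) has_real_derivative
        \<phi>2 (q + s *\<^sub>R v) v * \<psi> (q + s *\<^sub>R v) + 2 * (\<phi>1 (q + s *\<^sub>R v) v * \<psi>1 (q + s *\<^sub>R v) v) + \<phi> (q + s *\<^sub>R v) * \<psi>2 (q + s *\<^sub>R v) v) (at s)"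
      using DERIV_add[OF DERIV_mult[OF A(2)[of q v s] B(1)[of q v s]] DERIV_mult[OF A(1)[of q v s] B(2)[of q v s]]] by (simp add: algebra_simps)
  qed (intro continuous_intros c c2 c12)+
qed

text \<open>
  The density decays like the fourth power of the distance, which is integrable in dimension three.
\<close>

lemma integrable_density_at_infinity:
  "integrable lborel (\<lambda>x::real^3. indicator (- cball 0 2) x / (1 - x \<bullet> x)^2 :: real)"
proof (rule integrableI_bounded)
  show "(\<lambda>x::real^3. indicator (- cball 0 2) x / (1 - x \<bullet> x)^2 :: real) \<in> borel_measurable lborel"
    using borel_measurable_indicator[OF borel_open[OF open_Compl[OF closed_cball]]] by measurable
  define w where "w = (\<lambda>t::real. ennreal ((1 + t^2) powr (-2/3)))"
  have J: "(\<integral>\<^sup>+t. w t \<partial>lborel) < \<infinity>"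
  proof -
    let ?f = "\<lambda>t. ennreal (indicator {1..} t * t powr (-4/3))"
    have hi: "((\<lambda>t. t powr (-4/3)) has_integral - (1 powr (-4/3 + 1)) / (-4/3 + 1)) {1::real..}"
      by (rule has_integral_powr_to_inf) auto
    have f: "(\<integral>\<^sup>+t. ?f t \<partial>lborel) = ennreal (- (1 powr (-4/3 + 1)) / (-4/3 + 1))"
    proof (rule nn_integral_has_integral_lborel)
      have "(\<lambda>t. indicator {1..} t * t powr (-4/3)) = (\<lambda>t::real. if t \<in> {1..} then t powr (-4/3) else 0)"
        by (auto simp: indicator_def)
      then show "((\<lambda>t. indicator {1..} t * t powr (-4/3)) has_integral - (1 powr (-4/3 + 1)) / (-4/3 + 1)) (UNIV :: real set)"
        using hi by (simp only: has_integral_restrict_UNIV)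
    qed (auto simp: indicator_def)
    have "(\<integral>\<^sup>+t. w t \<partial>lborel) \<le> (\<integral>\<^sup>+t. indicator {-1..1} t + (?f t + ?f (- t)) \<partial>lborel)"
    proof (intro nn_integral_mono)
      fix t :: real
      have a: "(1 + t^2) powr (-2/3) \<le> 1" using powr_mono2'[of "-2/3" 1 "1 + t^2"] by simp
      have b: "(1 + t^2) powr (-2/3) \<le> \<bar>t\<bar> powr (-4/3)" if "\<bar>t\<bar> \<ge> 1"
      proof -
        have "(1 + t^2) powr (-2/3) \<le> (t^2) powr (-2/3)" using that by (intro powr_mono2') auto
        also have "\<dots> = \<bar>t\<bar> powr (-4/3)" using powr_powr[of "\<bar>t\<bar>" 2 "-2/3"] that by simp
        finally show ?thesis .
      qed
      show "w t \<le> indicator {-1..1} t + (?f t + ?f (- t))"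
      proof (cases "\<bar>t\<bar> \<le> 1")
        case True
        then have "w t \<le> indicator {-1..1} t" using a by (simp add: w_def indicator_def abs_le_iff)
        then show ?thesis by (simp add: add_increasing2)
      next
        case False
        then have "w t \<le> ?f t + ?f (- t)"
          using b by (cases "t \<ge> 0") (auto simp: w_def indicator_def intro!: ennreal_leI)
        then show ?thesis by (simp add: add_increasing)
      qed
    qed
    also have "\<dots> = (\<integral>\<^sup>+t. indicator {-1..1::real} t \<partial>lborel) + ((\<integral>\<^sup>+t. ?f t \<partial>lborel) + (\<integral>\<^sup>+t. ?f (- t) \<partial>lborel))"
      by (subst nn_integral_add, simp, simp, subst nn_integral_add) simp_all
    also have "(\<integral>\<^sup>+t. ?f (- t) \<partial>lborel) = (\<integral>\<^sup>+t. ?f t \<partial>lborel)"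
      using nn_integral_real_affine[of ?f "-1" 0] by simp
    also have "(\<integral>\<^sup>+t. indicator {-1..1::real} t \<partial>lborel) + ((\<integral>\<^sup>+t. ?f t \<partial>lborel) + (\<integral>\<^sup>+t. ?f t \<partial>lborel)) < \<infinity>"
      unfolding f by (simp add: ennreal_add_eq_top less_top[symmetric])
    finally show ?thesis .
  qed
  have d: "distinct [1, 2, 3::3]" by simp
  have dot: "x \<bullet> x = (x$3)^2 + (x$1)^2 + (x$2)^2" for x :: "real^3"
    by (simp add: inner_vec_def sum_3 power2_eq_square)
  \<comment> \<open>outside \<open>cball 0 2\<close> one has \<open>(x \<bullet> x - 1)\<^sup>2 \<ge> (1 + x \<bullet> x)\<^sup>2 / 4\<close>, and \<open>(1 + x \<bullet> x)\<^sup>2\<close> is at least the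
    product of the three factors \<open>(1 + (x $ n)\<^sup>2) powr (2/3)\<close>\<close>
  have "(\<integral>\<^sup>+(x::real^3). ennreal (norm (indicator (- cball 0 2) x / (1 - x \<bullet> x)^2 :: real)) \<partial>lborel)
    \<le> (\<integral>\<^sup>+(x::real^3). 4 * (w (x $ 3) * (w (x $ 1) * w (x $ 2))) \<partial>lborel)"
  proof (intro nn_integral_mono)
    fix x :: "real^3"
    show "ennreal (norm (indicator (- cball 0 2) x / (1 - x \<bullet> x)^2 :: real)) \<le> 4 * (w (x $ 3) * (w (x $ 1) * w (x $ 2)))"
    proof (cases "x \<in> cball 0 2")
      case False
      let ?T = "1 + x \<bullet> x"
      have x4: "x \<bullet> x \<ge> 4"
        using False power_mono[of 2 "norm x" 2] by (simp add: dot_square_norm)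
      have c: "?T powr (-2/3) \<le> (1 + (x $ n)^2) powr (-2/3)" for n
      proof (rule powr_mono2')
        have "(x $ n)^2 \<le> x \<bullet> x"
          using component_le_norm_cart[of x n] abs_le_square_iff[of "x $ n" "norm x"] by (simp add: dot_square_norm)
        then show "1 + (x $ n)^2 \<le> ?T" by simp
      qed (auto intro!: add_pos_nonneg)
      have "?T / 2 \<le> x \<bullet> x - 1" using x4 by simp
      then have "(?T / 2)^2 \<le> (1 - x \<bullet> x)^2" using x4 by (subst power2_commute, intro power_mono) auto
      then have "1 / (1 - x \<bullet> x)^2 \<le> 1 / (?T / 2)^2" using x4 by (intro frac_le) auto
      also have "\<dots> = 4 * ?T powr (-2)"
        using x4 powr_minus_divide[of ?T 2] by (simp add: power_divide)
      also have "?T powr (-2) = ?T powr (-2/3) * (?T powr (-2/3) * ?T powr (-2/3))"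
        by (simp only: powr_add[symmetric]) simp
      also have "4 * \<dots> \<le> 4 * ((1 + (x $ 3)^2) powr (-2/3) * ((1 + (x $ 1)^2) powr (-2/3) * (1 + (x $ 2)^2) powr (-2/3)))"
        by (intro mult_left_mono mult_mono c) auto
      finally have "ennreal (1 / (1 - x \<bullet> x)^2) \<le> ennreal (4 * ((1 + (x $ 3)^2) powr (-2/3) * ((1 + (x $ 1)^2) powr (-2/3) * (1 + (x $ 2)^2) powr (-2/3))))"
        by (rule ennreal_leI)
      also have "\<dots> = 4 * (w (x $ 3) * (w (x $ 1) * w (x $ 2)))"
        unfolding w_def by (simp add: ennreal_mult)
      finally show ?thesis using False by (simp add: indicator_def)
    qed simp
  qed
  also have "\<dots> = (\<integral>\<^sup>+z. \<integral>\<^sup>+s. \<integral>\<^sup>+t. 4 * (w z * (w s * w t)) \<partial>lborel \<partial>lborel \<partial>lborel)"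
    by (subst nn_integral_slice[of "\<lambda>_. 0" 1 2 3]) (simp_all add: slice_nth[OF d] w_def)
  also have "\<dots> = 4 * ((\<integral>\<^sup>+z. w z \<partial>lborel) * ((\<integral>\<^sup>+z. w z \<partial>lborel) * (\<integral>\<^sup>+z. w z \<partial>lborel)))"
    by (simp add: nn_integral_cmult nn_integral_multc w_def)
  also have "\<dots> < \<infinity>" using J by (simp add: ennreal_mult_less_top)
  finally show "(\<integral>\<^sup>+(x::real^3). ennreal (norm (indicator (- cball 0 2) x / (1 - x \<bullet> x)^2 :: real)) \<partial>lborel) < \<infinity>" .
qed

section \<open>Independence of the gauge\<close>

text \<open>
  Integrability is part of the notion because the limit has to be additive in \<open>\<phi>\<close>.
\<close>

definition has_common_limit :: "(real^3) set \<Rightarrow> real \<Rightarrow> real^3 \<Rightarrow> (real^3 \<Rightarrow> real) \<Rightarrow> bool" where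
  "has_common_limit U a c \<phi> \<longleftrightarrow> (\<exists>L. \<forall>(b, e) \<in> {(1, 0), (a, c)}.
     (\<forall>\<^sub>F \<epsilon> in at_right 0. integrable lborel (\<lambda>x. indicator U x *\<^sub>R (integrand \<phi> \<epsilon> b e x))) \<and>
     (regularized U \<phi> b e \<longlongrightarrow> L) (at_right 0))"

lemma has_common_limit_add:
  assumes "has_common_limit U a c \<phi>" "has_common_limit U a c \<psi>"
  shows "has_common_limit U a c (\<lambda>x. \<phi> x + \<psi> x)"
proof -
  let ?f = "\<lambda>\<phi> b e \<epsilon> x. indicator U x *\<^sub>R (integrand \<phi> \<epsilon> b e x)"
  obtain L1 where L1: "\<And>b e. (b, e) \<in> {(1, 0), (a, c)} \<Longrightarrow>
      (\<forall>\<^sub>F \<epsilon> in at_right 0. integrable lborel (?f \<phi> b e \<epsilon>)) \<and> (regularized U \<phi> b e \<longlongrightarrow> L1) (at_right 0)"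
    using assms(1) unfolding has_common_limit_def by blast
  obtain L2 where L2: "\<And>b e. (b, e) \<in> {(1, 0), (a, c)} \<Longrightarrow>
      (\<forall>\<^sub>F \<epsilon> in at_right 0. integrable lborel (?f \<psi> b e \<epsilon>)) \<and> (regularized U \<psi> b e \<longlongrightarrow> L2) (at_right 0)"
    using assms(2) unfolding has_common_limit_def by blast
  have split: "?f (\<lambda>x. \<phi> x + \<psi> x) b e \<epsilon> = (\<lambda>x. ?f \<phi> b e \<epsilon> x + ?f \<psi> b e \<epsilon> x)" for b e \<epsilon>
    by (simp add: fun_eq_iff add_divide_distrib scaleR_add_right)
  have "(\<forall>\<^sub>F \<epsilon> in at_right 0. integrable lborel (?f (\<lambda>x. \<phi> x + \<psi> x) b e \<epsilon>)) \<and>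
      (regularized U (\<lambda>x. \<phi> x + \<psi> x) b e \<longlongrightarrow> L1 + L2) (at_right 0)" if be: "(b, e) \<in> {(1, 0), (a, c)}" for b e
  proof
    have ev: "\<forall>\<^sub>F \<epsilon> in at_right 0. integrable lborel (?f \<phi> b e \<epsilon>) \<and> integrable lborel (?f \<psi> b e \<epsilon>)"
      using L1[OF be] L2[OF be] by (simp add: eventually_conj_iff)
    then show "\<forall>\<^sub>F \<epsilon> in at_right 0. integrable lborel (?f (\<lambda>x. \<phi> x + \<psi> x) b e \<epsilon>)"
      unfolding split by eventually_elim (simp only: Bochner_Integration.integrable_add)
    have "((\<lambda>\<epsilon>. regularized U \<phi> b e \<epsilon> + regularized U \<psi> b e \<epsilon>) \<longlongrightarrow> L1 + L2) (at_right 0)"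
      using L1[OF be] L2[OF be] by (intro tendsto_add) auto
    moreover have "\<forall>\<^sub>F \<epsilon> in at_right 0. regularized U \<phi> b e \<epsilon> + regularized U \<psi> b e \<epsilon> = regularized U (\<lambda>x. \<phi> x + \<psi> x) b e \<epsilon>"
      using ev
    proof eventually_elim
      case (elim \<epsilon>)
      show ?case unfolding regularized_def split
        using Bochner_Integration.integral_add[of lborel "?f \<phi> b e \<epsilon>" "?f \<psi> b e \<epsilon>"] elim by simp
    qed
    ultimately show "(regularized U (\<lambda>x. \<phi> x + \<psi> x) b e \<longlongrightarrow> L1 + L2) (at_right 0)"
      by (rule Lim_transform_eventually)
  qed
  then show ?thesis unfolding has_common_limit_def by blast
qed

lemma has_common_limit_zero: "has_common_limit U a c (\<lambda>_. 0)"
  unfolding has_common_limit_def regularized_def by (auto intro!: exI[of _ 0])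

lemma has_common_limit_sum:
  assumes "\<And>n. n \<in> I \<Longrightarrow> has_common_limit U a c (\<phi> n)"
  shows "has_common_limit U a c (\<lambda>x. \<Sum>n\<in>I. \<phi> n x)"
  using assms
  by (induction I rule: infinite_finite_induct) (auto intro: has_common_limit_zero has_common_limit_add)

lemma has_common_limit_shell:
  assumes "A \<in> sets borel" "U \<in> sets borel" "continuous_on UNIV \<phi>" "\<And>x. \<bar>\<phi> x\<bar> \<le> B" "\<And>x. x \<notin> A \<Longrightarrow> \<phi> x = 0"
    and int: "integrable lborel (\<lambda>x. indicator A x / (1 - x \<bullet> x)^2 :: real)"
  shows "has_common_limit U a c \<phi>"
proof -
  define s where "s = (\<lambda>x. indicator (U \<inter> A) x :: real)"
  have s_m: "s \<in> borel_measurable borel" unfolding s_def using assms(1,2) by (intro borel_measurable_indicator) auto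
  have s_int: "integrable lborel (\<lambda>x. s x / (1 - x \<bullet> x)^2)"
    by (rule Bochner_Integration.integrable_bound[OF int])
       (use s_m in \<open>auto simp: s_def indicator_def intro!: AE_I2\<close>)
  note lim = tendsto_integral_dominated_by_shell[OF s_m borel_measurable_continuous_onI[OF assms(3)] assms(4) s_int]
  have eq: "s x *\<^sub>R (integrand \<phi> \<epsilon> b e x) = indicator U x *\<^sub>R (integrand \<phi> \<epsilon> b e x)" for b e \<epsilon> x
    using assms(5)[of x] by (auto simp: s_def indicator_def)
  show ?thesis
    unfolding has_common_limit_def regularized_def using lim[unfolded eq] by blast
qed

lemma has_common_limit_straightened:
  assumes st: "straightened_on U W i j k m S" and C2: "C2_along_lines \<phi> \<phi>1 \<phi>2" and W: "open W" "bounded W"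
    and C: "compact C" "C \<subseteq> W" and supp: "\<And>x. x \<notin> C \<Longrightarrow> \<phi> x = 0" and U: "U \<in> sets borel"
    and nz: "\<And>x. x \<in> W \<Longrightarrow> a + c \<bullet> x \<noteq> 0"
  shows "has_common_limit U a c \<phi>"
proof -
  obtain L where L: "\<And>b e. (\<forall>x\<in>W. b + e \<bullet> x \<noteq> 0) \<Longrightarrow> (regularized U \<phi> b e \<longlongrightarrow> L) (at_right 0)"
    using straightened_limit[OF st C2 W C supp U] by blast
  have "\<forall>\<^sub>F \<epsilon> in at_right 0. integrable lborel (\<lambda>x. indicator U x *\<^sub>R (integrand \<phi> \<epsilon> b e x))"
    if "\<forall>x\<in>W. b + e \<bullet> x \<noteq> 0" for b e
    using eventually_at_right_less[of 0]
  proof eventually_elim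
    case (elim \<epsilon>)
    show ?case by (rule integrable_test_div_den[OF C2 elim W(1) C supp _ U]) (use that in auto)
  qed
  with L nz show ?thesis unfolding has_common_limit_def by (intro exI[of _ L]) auto
qed

lemma straightened_near_sphere:
  assumes "\<alpha> > 0" "open U" "C1_holder_transversal \<alpha> U" "norm p = 1" "a + c \<bullet> p \<noteq> 0"
  obtains r i j k m S where "r > 0" "straightened_on U (ball p r) i j k m S" "\<And>x. x \<in> ball p r \<Longrightarrow> a + c \<bullet> x \<noteq> 0"
proof -
  obtain r1 i j k m S where r1: "r1 > 0" "straightened_on U (ball p r1) i j k m S"
  proof (cases "p \<in> frontier U")
    case True
    then show ?thesis using straightened_at_frontier[OF assms(1-3) _ assms(4)] that by blast
  next
    case False
    then show ?thesis using straightened_off_frontier[OF assms(4)] that by blast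
  qed
  have "open {x. a + c \<bullet> x \<noteq> 0}" by (intro open_Collect_neq continuous_intros)
  then obtain r2 where r2: "r2 > 0" "ball p r2 \<subseteq> {x. a + c \<bullet> x \<noteq> 0}"
    using assms(5) unfolding open_contains_ball by blast
  show ?thesis
  proof (rule that[of "min r1 r2"])
    show "straightened_on U (ball p (min r1 r2)) i j k m S"
      by (rule straightened_on_subset[OF r1(2)]) auto
  qed (use r1 r2 in auto)
qed

text \<open>
  By compactness of the sphere there is a scale below which every cell of the spline partition that meets the sphere lies
  in a ball on which \<open>U\<close> can be straightened and the gauge has no zero. The other cells and the complement of the whole
  partition stay away from the sphere.
\<close>

theorem has_common_limit_one:
  assumes "\<alpha> > 0" "open U" "C1_holder_transversal \<alpha> U" "\<And>x. norm x = 1 \<Longrightarrow> a + c \<bullet> x \<noteq> 0"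
  shows "has_common_limit U a c (\<lambda>_. 1)"
proof -
  have U: "U \<in> sets borel" using assms(2) by simp
  define \<G> where "\<G> = {B. \<exists>p r i j k m S. B = ball p r \<and> straightened_on U B i j k m S \<and> (\<forall>x\<in>B. a + c \<bullet> x \<noteq> 0)}"
  have "sphere 0 1 \<subseteq> \<Union>\<G>"
  proof
    fix p :: "real^3" assume "p \<in> sphere 0 1"
    then have p: "norm p = 1" by simp
    obtain r i j k m S where "r > 0" "straightened_on U (ball p r) i j k m S" "\<And>x. x \<in> ball p r \<Longrightarrow> a + c \<bullet> x \<noteq> 0"
      using straightened_near_sphere[OF assms(1-3) p assms(4)[OF p]] by blast
    then have "\<exists>p' r' i j k m S. ball p r = ball p' r' \<and> straightened_on U (ball p r) i j k m S \<and> (\<forall>x\<in>ball p r. a + c \<bullet> x \<noteq> 0)"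
      by (intro exI conjI ballI) (rule refl | assumption)+
    then have "ball p r \<in> \<G>" unfolding \<G>_def by simp
    moreover have "p \<in> ball p r" using \<open>r > 0\<close> by simp
    ultimately show "p \<in> \<Union>\<G>" by blast
  qed
  then obtain e where e: "e > 0" "\<And>x. x \<in> sphere 0 1 \<Longrightarrow> \<exists>B\<in>\<G>. ball x e \<subseteq> B"
  proof (rule Heine_Borel_lemma[OF compact_sphere])
    show "open B" if "B \<in> \<G>" for B using that unfolding \<G>_def by auto
    fix e assume "0 < e" "\<And>x. x \<in> sphere 0 1 \<Longrightarrow> \<exists>B\<in>\<G>. ball x e \<subseteq> B"
    then show thesis by (rule that)
  qed
  \<comment> \<open>two points of a brick of side \<open>4 * \<eta>\<close> are at distance at most \<open>12 * \<eta> < e\<close>\<close>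
  define \<eta> where "\<eta> = e / 16"
  have \<eta>: "\<eta> > 0" using e by (simp add: \<eta>_def)
  obtain K :: nat where "2 / \<eta> \<le> real K" using real_arch_simple by blast
  then have K: "2 \<le> \<eta> * (real (K + 3) - 3)" using \<eta> by (simp add: pos_divide_le_eq mult.commute)
  define b where "b = (\<lambda>n::nat. spline_bump \<eta> (real n - real (K + 3)))"
  define cell where "cell = (\<lambda>n1 n2 n3 (x::real^3). b n1 (x$1) * (b n2 (x$2) * b n3 (x$3)))"
  define \<Phi> where "\<Phi> = (\<lambda>x. \<Sum>n1<2*(K+3). \<Sum>n2<2*(K+3). \<Sum>n3<2*(K+3). cell n1 n2 n3 x)"
  define lo where "lo = (\<lambda>n::nat. \<eta> * (real n - real (K + 3)))"
  define brick where "brick = (\<lambda>n1 n2 n3. {x::real^3. x$1 \<in> {lo n1..lo n1 + 4 * \<eta>} \<and> x$2 \<in> {lo n2..lo n2 + 4 * \<eta>} \<and> x$3 \<in> {lo n3..lo n3 + 4 * \<eta>}})"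
  have brick_cbox: "brick n1 n2 n3 = cbox (vector [lo n1, lo n2, lo n3]) (vector [lo n1 + 4 * \<eta>, lo n2 + 4 * \<eta>, lo n3 + 4 * \<eta>])" for n1 n2 n3
    by (auto simp: brick_def mem_box_cart forall_3)
  have compact_brick: "compact (brick n1 n2 n3)" for n1 n2 n3 unfolding brick_cbox by (rule compact_cbox)
  have cell_supp: "cell n1 n2 n3 x = 0" if "x \<notin> brick n1 n2 n3" for n1 n2 n3 x
  proof -
    have "b n t = 0" if "t \<notin> {lo n..lo n + 4 * \<eta>}" for n t
      unfolding b_def by (rule spline_bump_support[OF \<eta>]) (use that in \<open>simp add: lo_def algebra_simps\<close>)
    then show ?thesis using that unfolding brick_def cell_def by auto
  qed
  have cell_C2: "\<exists>\<phi>1 \<phi>2. C2_along_lines (cell n1 n2 n3) \<phi>1 \<phi>2" for n1 n2 n3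
  proof -
    have b: "\<exists>h1 h2. C2_real (b n) h1 h2" for n unfolding b_def by (rule C2_real_spline_bump)
    obtain f1 f2 where f: "C2_real (b n1) f1 f2" using b by blast
    obtain g1 g2 where g: "C2_real (b n2) g1 g2" using b by blast
    obtain h1 h2 where h: "C2_real (b n3) h1 h2" using b by blast
    show ?thesis unfolding cell_def
      by (rule exI, rule exI, rule C2_along_lines_mult[OF C2_along_lines_coordinate[OF f]
            C2_along_lines_mult[OF C2_along_lines_coordinate[OF g] C2_along_lines_coordinate[OF h]]])
  qed
  have cell_cont: "continuous_on UNIV (cell n1 n2 n3)" for n1 n2 n3
    using cell_C2[of n1 n2 n3] C2_along_lines_continuous by blast
  have cell_lim: "has_common_limit U a c (cell n1 n2 n3)" for n1 n2 n3
  proof (cases "brick n1 n2 n3 \<inter> sphere 0 1 = {}")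
    case True
    have "continuous_on (brick n1 n2 n3) (\<lambda>x. 1 / (1 - x \<bullet> x)^2)"
      using True by (intro continuous_intros) (auto simp: norm_eq_1)
    from borel_integrable_compact[OF compact_brick this]
    have int: "integrable lborel (\<lambda>x. indicator (brick n1 n2 n3) x / (1 - x \<bullet> x)^2 :: real)" by simp
    obtain B where "\<And>x. \<bar>cell n1 n2 n3 x\<bar> \<le> B"
      using supported_bounded[OF cell_cont compact_brick cell_supp] by blast
    then show ?thesis
      using has_common_limit_shell[OF _ U cell_cont _ cell_supp int] compact_brick borel_compact by blast
  next
    case False
    then obtain q where q: "q \<in> brick n1 n2 n3" "q \<in> sphere 0 1" by blast
    obtain B where B: "B \<in> \<G>" "ball q e \<subseteq> B" using e(2)[OF q(2)] by blast
    then obtain p r i j k m S where pr: "B = ball p r" "straightened_on U B i j k m S" "\<And>x. x \<in> B \<Longrightarrow> a + c \<bullet> x \<noteq> 0"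
      unfolding \<G>_def by blast
    have sub: "brick n1 n2 n3 \<subseteq> B"
    proof
      fix x assume x: "x \<in> brick n1 n2 n3"
      have "norm (x - q) \<le> (\<Sum>l\<in>UNIV. \<bar>(x - q) $ l\<bar>)" by (rule norm_le_l1_cart)
      also have "\<dots> \<le> 12 * \<eta>" using x q(1) by (auto simp: sum_3 brick_def abs_le_iff)
      also have "\<dots> < e" using e(1) by (simp add: \<eta>_def)
      finally show "x \<in> B" using B(2) by (auto simp: dist_norm norm_minus_commute)
    qed
    obtain \<phi>1 \<phi>2 where C2: "C2_along_lines (cell n1 n2 n3) \<phi>1 \<phi>2" using cell_C2 by blast
    show ?thesis
      by (rule has_common_limit_straightened[OF pr(2) C2 _ _ compact_brick sub cell_supp U pr(3)]) (simp_all add: pr(1))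
  qed
  have \<Phi>_lim: "has_common_limit U a c \<Phi>"
    unfolding \<Phi>_def by (intro has_common_limit_sum cell_lim)
  have \<Phi>_prod: "\<Phi> x = (\<Sum>n<2*(K+3). b n (x$1)) * ((\<Sum>n<2*(K+3). b n (x$2)) * (\<Sum>n<2*(K+3). b n (x$3)))" for x
    unfolding \<Phi>_def cell_def by (simp add: sum_distrib_left[symmetric] sum_distrib_right[symmetric])
  have \<Phi>1: "\<Phi> x = 1" if "norm x \<le> 2" for x
  proof -
    have "(\<Sum>n<2*(K+3). b n (x$l)) = 1" for l
      unfolding b_def
    proof (rule sum_spline_bump[OF \<eta>])
      show "\<bar>x $ l\<bar> \<le> \<eta> * (real (K + 3) - 3)" using component_le_norm_cart[of x l] that K by linarith
    qed
    then show ?thesis by (simp add: \<Phi>_prod)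
  qed
  have \<Phi>_cont: "continuous_on UNIV \<Phi>" unfolding \<Phi>_def by (intro continuous_intros cell_cont)
  define Q where "Q = (\<Union>n1<2*(K+3). \<Union>n2<2*(K+3). \<Union>n3<2*(K+3). brick n1 n2 n3)"
  have Q: "compact Q" unfolding Q_def by (intro compact_UN compact_brick finite_lessThan)
  have \<Phi>_supp: "\<Phi> x = 0" if "x \<notin> Q" for x
    unfolding \<Phi>_def using that by (intro sum.neutral ballI cell_supp) (auto simp: Q_def)
  obtain B where B: "\<And>x. \<bar>\<Phi> x\<bar> \<le> B"
    using supported_bounded[OF \<Phi>_cont Q \<Phi>_supp] by blast
  have "has_common_limit U a c (\<lambda>x. 1 - \<Phi> x)"
  proof (rule has_common_limit_shell[OF _ U _ _ _ integrable_density_at_infinity])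
    show "continuous_on UNIV (\<lambda>x. 1 - \<Phi> x)" by (intro continuous_intros \<Phi>_cont)
    show "\<bar>1 - \<Phi> x\<bar> \<le> 1 + B" for x using B[of x] by linarith
  qed (use \<Phi>1 in auto)
  from has_common_limit_add[OF \<Phi>_lim this] show ?thesis by simp
qed

section \<open>The projective action of a Lorentz map\<close>

text \<open>
  This is \<open>(1 - x \<bullet> x)\<^sup>2\<close> times the Klein metric of hyperbolic space. Unlike the metric it is defined on both sides of the
  sphere.
\<close>

definition klein_matrix :: "real^3 \<Rightarrow> real^3^3" where
  "klein_matrix x = (\<chi> i j. (1 - x \<bullet> x) * (if i = j then 1 else 0) + x $ i * x $ j)"

lemma klein_matrix_form: "h \<bullet> (klein_matrix x *v k) = (1 - x \<bullet> x) * (h \<bullet> k) + (x \<bullet> h) * (x \<bullet> k)"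
  by (simp add: klein_matrix_def inner_vec_def matrix_vector_mult_def sum_3 algebra_simps)

lemma det_klein_matrix: "det (klein_matrix x) = (1 - x \<bullet> x)^2"
  by (simp add: klein_matrix_def det_3 inner_vec_def sum_3 power2_eq_square algebra_simps)

lemma det_scaleR_3: "det (c *\<^sub>R A) = c^3 * det (A :: real^3^3)"
  by (simp add: det_3 power3_eq_cube algebra_simps)

locale lorentz_map =
  fixes g :: "real \<times> (real^3) \<Rightarrow> real \<times> (real^3)"
  assumes lorentz: "lorentz g"
begin

definition lam :: "real^3 \<Rightarrow> real" where "lam x = fst (g (1, x))"
definition num :: "real^3 \<Rightarrow> real^3" where "num x = snd (g (1, x))"
definition dlam :: "real^3 \<Rightarrow> real" where "dlam h = fst (g (0, h))"
definition dnum :: "real^3 \<Rightarrow> real^3" where "dnum h = snd (g (0, h))"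
definition proj :: "real^3 \<Rightarrow> real^3" where "proj x = num x /\<^sub>R lam x"
definition dproj :: "real^3 \<Rightarrow> real^3 \<Rightarrow> real^3" where
  "dproj x h = dnum h /\<^sub>R lam x - (dlam h / (lam x)^2) *\<^sub>R num x"

lemma g_linear: "linear g" and g_form: "minkowski (g X) (g Y) = minkowski X Y"
  using lorentz unfolding lorentz_def by blast+

lemma relations:
  "num x \<bullet> num x = (lam x)^2 - (1 - x \<bullet> x)"
  "dnum h \<bullet> num x = x \<bullet> h + dlam h * lam x"
  "dnum h \<bullet> dnum k = h \<bullet> k + dlam h * dlam k"
  using g_form[of "(1, x)" "(1, x)"] g_form[of "(0, h)" "(1, x)"] g_form[of "(0, h)" "(0, k)"]
  by (simp_all add: minkowski_def lam_def num_def dlam_def dnum_def power2_eq_square inner_commute)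

lemma g_affine: "g (1, x + h) = g (1, x) + g (0, h)"
  using linear_add[OF g_linear, of "(1, x)" "(0, h)"] by simp

lemma g_inj: "inj g"
proof -
  have "X = 0" if "g X = 0" for X
  proof -
    have "minkowski X Y = 0" for Y using g_form[of X Y] that by (simp add: minkowski_def)
    from this[of "(- fst X, snd X)"] have "fst X * fst X + snd X \<bullet> snd X = 0" by (simp add: minkowski_def)
    then have "fst X = 0" "snd X = 0"
      by (metis add_nonneg_eq_0_iff inner_eq_zero_iff inner_ge_zero mult_eq_0_iff zero_le_square)+
    then show ?thesis by (simp add: prod_eq_iff)
  qed
  then show ?thesis using linear_injective_0[OF g_linear] by blast
qed

lemma linear_parts: "linear dlam" "linear dnum"
proof -
  have "linear (\<lambda>h::real^3. (0::real, h))" by (auto intro!: linearI)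
  then have l: "linear (\<lambda>h. g (0, h))" using linear_compose[OF _ g_linear] by (auto simp: o_def)
  have "dlam = fst \<circ> (\<lambda>h. g (0, h))" "dnum = snd \<circ> (\<lambda>h. g (0, h))"
    by (simp_all add: fun_eq_iff dlam_def dnum_def)
  then show "linear dlam" "linear dnum"
    using linear_compose[OF l linear_fst] linear_compose[OF l linear_snd] by simp_all
qed

lemma lam_affine: "lam x = lam 0 + (\<chi> l. dlam (axis l 1)) \<bullet> x"
proof -
  have "dlam x = (\<Sum>l\<in>UNIV. x $ l * dlam (axis l 1))"
  proof -
    have "x = (\<Sum>l\<in>UNIV. x $ l *\<^sub>R axis l 1)"
      using basis_expansion[of x] by (simp add: scalar_mult_eq_scaleR)
    then have "dlam x = dlam (\<Sum>l\<in>UNIV. x $ l *\<^sub>R axis l 1)" by (rule arg_cong)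
    also have "\<dots> = (\<Sum>l\<in>UNIV. x $ l * dlam (axis l 1))"
      by (simp add: linear_sum[OF linear_parts(1)] linear_scale[OF linear_parts(1)])
    finally show ?thesis .
  qed
  then show ?thesis using g_affine[of 0 x] by (simp add: lam_def dlam_def inner_vec_def mult.commute)
qed

lemma lam_nonzero_sphere:
  assumes "norm x = 1"
  shows "lam x \<noteq> 0"
proof
  assume l: "lam x = 0"
  then have "num x = 0" using relations(1)[of x] assms by (simp add: norm_eq_1)
  then have "g (1, x) = g 0" using l linear_0[OF g_linear] by (simp add: lam_def num_def prod_eq_iff)
  then have "(1, x) = (0 :: real \<times> (real^3))" using g_inj by (simp add: inj_eq)
  then show False by (simp add: zero_prod_def)
qed

lemma has_derivative_parts:
  "(lam has_derivative dlam) (at x)" "(num has_derivative dnum) (at x)"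
proof -
  have e: "(\<lambda>x. lam 0 + dlam x) = lam" "(\<lambda>x. num 0 + dnum x) = num"
  proof -
    have "lam 0 + dlam x = lam x \<and> num 0 + dnum x = num x" for x
      using g_affine[of 0 x] by (simp add: lam_def dlam_def num_def dnum_def)
    then show "(\<lambda>x. lam 0 + dlam x) = lam" "(\<lambda>x. num 0 + dnum x) = num" by auto
  qed
  have d: "(dlam has_derivative dlam) (at x)" "(dnum has_derivative dnum) (at x)"
    using linear_parts by (auto intro!: bounded_linear_imp_has_derivative simp: linear_conv_bounded_linear)
  show "(lam has_derivative dlam) (at x)" "(num has_derivative dnum) (at x)"
    using has_derivative_add[OF has_derivative_const[of "lam 0"] d(1)]
      has_derivative_add[OF has_derivative_const[of "num 0"] d(2)] unfolding e add_0 .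
qed

lemma has_derivative_proj:
  assumes "lam x \<noteq> 0"
  shows "(proj has_derivative dproj x) (at x)"
  unfolding proj_def dproj_def
  by (rule has_derivative_eq_rhs, rule has_derivative_scaleR, rule Deriv.has_derivative_inverse[OF assms has_derivative_parts(1)],
      rule has_derivative_parts(2))
     (auto simp: fun_eq_iff power2_eq_square divide_simps assms)

lemma form_proj: "lam x \<noteq> 0 \<Longrightarrow> 1 - proj x \<bullet> proj x = (1 - x \<bullet> x) / (lam x)^2"
  by (simp add: proj_def relations(1) power2_eq_square field_simps)

text \<open>
  The Klein metric is the pullback of the Minkowski form to the affine chart, and the projective map preserves it.
\<close>

lemma klein_form_invariant:
  assumes "lam x \<noteq> 0"
  shows "(1 - proj x \<bullet> proj x) * (dproj x h \<bullet> dproj x k) + (proj x \<bullet> dproj x h) * (proj x \<bullet> dproj x k)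
     = ((1 - x \<bullet> x) * (h \<bullet> k) + (x \<bullet> h) * (x \<bullet> k)) / (lam x)^4"
proof -
  define l r b where "l = lam x" and "r = 1 - x \<bullet> x" and "b = inverse l"
  have bl: "1 - b * l = 0" using assms by (simp add: b_def l_def)
  have dp: "dproj x h = b *\<^sub>R dnum h - (dlam h * b^2) *\<^sub>R num x" for h
    by (simp add: dproj_def b_def l_def divide_inverse power_inverse)
  have nd: "num x \<bullet> dnum h = dnum h \<bullet> num x" for h by (rule inner_commute)
  have A: "dproj x h \<bullet> dproj x k = b^2 * (h \<bullet> k) - b^3 * (dlam k * (x \<bullet> h) + dlam h * (x \<bullet> k)) - b^4 * r * dlam h * dlam k"
  proof -
    have "dproj x h \<bullet> dproj x k = b^2 * (dnum h \<bullet> dnum k) - b^3 * (dlam k * (dnum h \<bullet> num x)) - b^3 * (dlam h * (dnum k \<bullet> num x))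
        + b^4 * (dlam h * dlam k * (num x \<bullet> num x))"
      by (simp add: dp inner_diff_left inner_diff_right nd power2_eq_square power3_eq_cube power4_eq_xxxx algebra_simps)
    also have "\<dots> = b^2 * (h \<bullet> k) - b^3 * (dlam k * (x \<bullet> h) + dlam h * (x \<bullet> k)) - b^4 * r * dlam h * dlam k
        + b^2 * dlam h * dlam k * (1 - b * l)^2"
      unfolding relations l_def[symmetric] r_def[symmetric]
      by (simp add: power2_eq_square power3_eq_cube power4_eq_xxxx algebra_simps)
    finally show ?thesis unfolding bl by simp
  qed
  have B: "proj x \<bullet> dproj x h = b^2 * (x \<bullet> h) + b^3 * r * dlam h" for h
  proof -
    have "proj x \<bullet> dproj x h = b^2 * (dnum h \<bullet> num x) - b^3 * (dlam h * (num x \<bullet> num x))"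
      by (simp add: dp proj_def b_def l_def inner_diff_right nd power2_eq_square power3_eq_cube algebra_simps)
    also have "\<dots> = b^2 * (x \<bullet> h) + b^3 * r * dlam h + b^2 * dlam h * l * (1 - b * l)"
      unfolding relations l_def[symmetric] r_def[symmetric]
      by (simp add: power2_eq_square power3_eq_cube algebra_simps)
    finally show ?thesis unfolding bl by simp
  qed
  have P: "1 - proj x \<bullet> proj x = r * b^2"
    using form_proj[OF assms] by (simp add: r_def b_def l_def divide_inverse power_inverse)
  have "(1 - proj x \<bullet> proj x) * (dproj x h \<bullet> dproj x k) + (proj x \<bullet> dproj x h) * (proj x \<bullet> dproj x k)
     = (r * (h \<bullet> k) + (x \<bullet> h) * (x \<bullet> k)) * b^4"
    unfolding P A B by (simp add: power2_eq_square power3_eq_cube power4_eq_xxxx algebra_simps)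
  then show ?thesis by (simp add: r_def b_def l_def divide_inverse power_inverse)
qed

text \<open>
  Taking determinants in the invariance of the Klein form gives the square of the Jacobian. The sphere has to be excluded because the form degenerates there.
\<close>

lemma abs_det_dproj:
  assumes "lam x \<noteq> 0" "x \<bullet> x \<noteq> 1"
  shows "\<bar>det (matrix (dproj x))\<bar> = 1 / (lam x)^4"
proof -
  let ?J = "matrix (dproj x)" and ?l = "lam x"
  have lin: "linear (dproj x)" using has_derivative_linear[OF has_derivative_proj[OF assms(1)]] .
  have J: "?J *v h = dproj x h" for h by (rule fun_cong[OF matrix_vector_mul(2)[OF lin]])
  have adj: "h \<bullet> (transpose ?J *v w) = (?J *v h) \<bullet> w" for h w
    using dot_lmul_matrix[of w ?J h] by (simp add: inner_commute)
  have M: "transpose ?J ** (klein_matrix (proj x) ** ?J) = (1 / ?l^4) *\<^sub>R klein_matrix x"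
  proof (subst matrix_eq, intro allI)
    fix k
    have "h \<bullet> ((transpose ?J ** (klein_matrix (proj x) ** ?J)) *v k) = h \<bullet> (((1 / ?l^4) *\<^sub>R klein_matrix x) *v k)" for h
    proof -
      have "h \<bullet> ((transpose ?J ** (klein_matrix (proj x) ** ?J)) *v k) = dproj x h \<bullet> (klein_matrix (proj x) *v dproj x k)"
        by (simp only: matrix_vector_mul_assoc[symmetric] adj J)
      also have "\<dots> = (h \<bullet> (klein_matrix x *v k)) / ?l^4"
        unfolding klein_matrix_form by (rule klein_form_invariant[OF assms(1)])
      also have "\<dots> = h \<bullet> (((1 / ?l^4) *\<^sub>R klein_matrix x) *v k)"
        by (simp add: scaleR_matrix_vector_assoc[symmetric])
      finally show ?thesis .
    qed
    then show "(transpose ?J ** (klein_matrix (proj x) ** ?J)) *v k = ((1 / ?l^4) *\<^sub>R klein_matrix x) *v k"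
      by (subst vector_eq_rdot[symmetric]) (simp add: inner_commute)
  qed
  have D: "det ?J * (((1 - x \<bullet> x) / ?l^2)^2 * det ?J) = (1 / ?l^4)^3 * (1 - x \<bullet> x)^2"
    using arg_cong[OF M, of det]
    unfolding det_mul det_transpose det_klein_matrix form_proj[OF assms(1)] det_scaleR_3 .
  have "(j * l^4)^2 = 1" if "l \<noteq> 0" "r \<noteq> 0" "j * ((r / l^2)^2 * j) = (1 / l^4)^3 * r^2" for j l r :: real
  proof -
    have l12: "l^12 = l^4 * l^8" and l8: "l^8 = l^4 * l^4" by (simp_all flip: power_add)
    have e: "(r / l^2)^2 = r^2 / l^4" by (simp add: power_divide flip: power_mult)
    have "(j * (r^2 / p * j)) * (p * (p * p)) = r^2 * (j * p)^2" if "p \<noteq> 0" for p :: real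
      using that by (simp add: power2_eq_square)
    from this[of "l^4"] have "(j * ((r / l^2)^2 * j)) * l^12 = r^2 * (j * l^4)^2"
      using that(1) unfolding e l12 l8 by simp
    moreover have "((1 / l^4)^3 * r^2) * l^12 = r^2"
      using that(1) by (simp add: power_divide flip: power_mult)
    ultimately have "r^2 * (j * l^4)^2 = r^2" using that(3) by simp
    then show ?thesis using that(2) by simp
  qed
  from this[OF assms(1) _ D] have "(det ?J * ?l^4)^2 = 1" using assms(2) by simp
  then have "\<bar>det ?J * ?l^4\<bar> = 1" by (auto simp: power2_eq_1_iff)
  then have "\<bar>det ?J\<bar> * ?l^4 = 1" by (simp add: abs_mult)
  then show ?thesis using assms(1) by (simp add: eq_divide_eq)
qed

lemma isometry_image_eq: "isometry_image g U = proj ` (U \<inter> {x. lam x \<noteq> 0})"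
proof -
  have "g ` proj_point x = proj_point y \<longleftrightarrow> lam x \<noteq> 0 \<and> y = proj x" for x y
  proof -
    have im: "g ` proj_point x = range (\<lambda>k. k *\<^sub>R g (1, x))"
      unfolding proj_point_def span_singleton by (simp only: image_image linear_scale[OF g_linear])
    have y: "proj_point y = range (\<lambda>k. k *\<^sub>R (1, y))" unfolding proj_point_def span_singleton ..
    have gx: "g (1, x) = (lam x, num x)" by (simp add: lam_def num_def)
    show ?thesis
    proof
      assume "g ` proj_point x = proj_point y"
      then have "(1, y) \<in> range (\<lambda>k. k *\<^sub>R (lam x, num x))"
        unfolding im y gx by (metis rangeI scaleR_one)
      then obtain t where "1 = t * lam x" "y = t *\<^sub>R num x" by auto
      moreover from this have "lam x \<noteq> 0" "inverse (lam x) = t"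
        using inverse_unique[of "lam x" t] by (auto simp: mult.commute)
      ultimately show "lam x \<noteq> 0 \<and> y = proj x" by (simp add: proj_def)
    next
      assume a: "lam x \<noteq> 0 \<and> y = proj x"
      then have e: "(lam x, num x) = lam x *\<^sub>R (1, y)" by (simp add: proj_def)
      have "range (\<lambda>k. k *\<^sub>R lam x *\<^sub>R (1::real, y)) = range (\<lambda>k. k *\<^sub>R (1, y))"
      proof (intro equalityI subsetI)
        fix v assume "v \<in> range (\<lambda>k. k *\<^sub>R (1::real, y))"
        then obtain k where "v = k *\<^sub>R (1::real, y)" by blast
        then have "v = (k / lam x) *\<^sub>R lam x *\<^sub>R (1::real, y)" using a by simp
        then show "v \<in> range (\<lambda>k. k *\<^sub>R lam x *\<^sub>R (1::real, y))" by blast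
      qed (auto simp del: scaleR_Pair)
      then show "g ` proj_point x = proj_point y" unfolding im y gx e .
    qed
  qed
  then show ?thesis unfolding isometry_image_def by blast
qed

lemma inj_on_proj: "inj_on proj {x. lam x \<noteq> 0}"
proof (rule inj_onI)
  fix x y assume l: "x \<in> {x. lam x \<noteq> 0}" "y \<in> {x. lam x \<noteq> 0}" and e: "proj x = proj y"
  have s: "g (1, z) = lam z *\<^sub>R (1, proj z)" if "lam z \<noteq> 0" for z
    using that by (simp add: proj_def lam_def num_def prod_eq_iff)
  have "g ((1 / lam x) *\<^sub>R (1::real, x)) = g ((1 / lam y) *\<^sub>R (1::real, y))"
    using l s[of x] s[of y] e by (simp only: linear_scale[OF g_linear]) simp
  then have "(1 / lam x) *\<^sub>R (1::real, x) = (1 / lam y) *\<^sub>R (1::real, y)" by (rule injD[OF g_inj])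
  then show "x = y" using l by auto
qed

lemma open_isometry_image:
  assumes "open U"
  shows "open (isometry_image g U)"
proof -
  have cont: "continuous_on {x. lam x \<noteq> 0} proj"
    using has_derivative_proj by (intro has_derivative_continuous_on) (auto intro: has_derivative_at_withinI)
  have "continuous_on UNIV lam" using has_derivative_parts(1) by (intro has_derivative_continuous_on)
  then have o: "open {x. lam x \<noteq> 0}" by (intro open_Collect_neq continuous_on_const)
  show ?thesis unfolding isometry_image_eq
  proof (rule invariance_of_domain_gen)
    show "open (U \<inter> {x. lam x \<noteq> 0})" using assms o by blast
    show "continuous_on (U \<inter> {x. lam x \<noteq> 0}) proj" by (rule continuous_on_subset[OF cont]) blast
    show "inj_on proj (U \<inter> {x. lam x \<noteq> 0})" by (rule inj_on_subset[OF inj_on_proj]) blast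
  qed simp
qed

end

section \<open>Invariance of the volume\<close>

text \<open>
  A reduction to integrands with values in \<open>real^2\<close>.
\<close>

lemma complex_change_of_variables:
  fixes \<phi> :: "real^3 \<Rightarrow> real^3" and f :: "real^3 \<Rightarrow> complex"
  assumes S: "S \<in> sets lebesgue" and der: "\<And>x. x \<in> S \<Longrightarrow> (\<phi> has_derivative \<phi>' x) (at x within S)" and inj: "inj_on \<phi> S"
    and h: "h absolutely_integrable_on S" "\<And>x. x \<in> S \<Longrightarrow> \<bar>det (matrix (\<phi>' x))\<bar> *\<^sub>R f (\<phi> x) = h x"
  shows "f absolutely_integrable_on (\<phi> ` S)" "integral (\<phi> ` S) f = integral S h"
proof -
  define V where "V = (\<lambda>z. vector [Re z, Im z] :: real^2)"
  define Z where "Z = (\<lambda>v :: real^2. Complex (v $ 1) (v $ 2))"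
  have V: "bounded_linear V" and Z: "bounded_linear Z"
    unfolding linear_conv_bounded_linear[symmetric] V_def Z_def
    by (auto intro!: linearI simp: vec_eq_iff forall_2 complex_eq_iff)
  have ZV: "Z (V z) = z" for z by (simp add: V_def Z_def)
  have hV: "(V \<circ> h) absolutely_integrable_on S" by (rule absolutely_integrable_linear[OF h(1) V])
  have D: "\<bar>det (matrix (\<phi>' x))\<bar> *\<^sub>R (V \<circ> f) (\<phi> x) = (V \<circ> h) x" if "x \<in> S" for x
    using h(2)[OF that] linear_scale[OF bounded_linear.linear[OF V]] by (metis comp_apply)
  have "(\<lambda>x. \<bar>det (matrix (\<phi>' x))\<bar> *\<^sub>R (V \<circ> f) (\<phi> x)) absolutely_integrable_on S"
    using hV by (rule absolutely_integrable_spike[OF _ negligible_empty]) (use D in auto)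
  moreover have "integral S (\<lambda>x. \<bar>det (matrix (\<phi>' x))\<bar> *\<^sub>R (V \<circ> f) (\<phi> x)) = integral S (V \<circ> h)"
    by (rule integral_cong) (rule D)
  ultimately have *: "(V \<circ> f) absolutely_integrable_on (\<phi> ` S) \<and> integral (\<phi> ` S) (V \<circ> f) = integral S (V \<circ> h)"
    using has_absolute_integral_change_of_variables[OF S der inj, of "V \<circ> f" "integral S (V \<circ> h)"] by blast
  have ZVf: "Z \<circ> (V \<circ> f) = f" "Z \<circ> (V \<circ> h) = h" by (simp_all add: fun_eq_iff ZV)
  show "f absolutely_integrable_on (\<phi> ` S)"
    using absolutely_integrable_linear[OF conjunct1[OF *] Z] unfolding ZVf .
  have "integral (\<phi> ` S) f = Z (integral (\<phi> ` S) (V \<circ> f))"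
    using integral_linear[OF set_lebesgue_integral_eq_integral(1)[OF conjunct1[OF *]] Z] unfolding ZVf .
  also have "\<dots> = Z (integral S (V \<circ> h))" using * by simp
  also have "\<dots> = integral S h"
    using integral_linear[OF set_lebesgue_integral_eq_integral(1)[OF hV] Z] unfolding ZVf by simp
  finally show "integral (\<phi> ` S) f = integral S h" .
qed

lemma borel_set_integral:
  fixes f :: "real^3 \<Rightarrow> complex"
  assumes "f \<in> borel_measurable borel" "A \<in> sets borel"
  shows "integrable lborel (\<lambda>x. indicator A x *\<^sub>R f x) \<longleftrightarrow> f absolutely_integrable_on A"
    and "integrable lborel (\<lambda>x. indicator A x *\<^sub>R f x) \<Longrightarrow> (LINT x|lborel. indicator A x *\<^sub>R f x) = integral A f"
proof -
  have "(\<lambda>x. indicator A x *\<^sub>R f x) \<in> borel_measurable lborel" using assms by measurable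
  then show "integrable lborel (\<lambda>x. indicator A x *\<^sub>R f x) \<longleftrightarrow> f absolutely_integrable_on A"
    unfolding set_integrable_def by (rule integrable_completion[symmetric])
  show "(LINT x|lborel. indicator A x *\<^sub>R f x) = integral A f" if "integrable lborel (\<lambda>x. indicator A x *\<^sub>R f x)"
    using set_borel_integral_eq_integral(2)[of A f] that unfolding set_integrable_def set_lebesgue_integral_def by blast
qed

lemma approx_volume_eq: "approx_volume A \<epsilon> = d_eps \<epsilon> * regularized A (\<lambda>_. 1) 1 0 \<epsilon>"
proof -
  have "indicator A x *\<^sub>R vol_density \<epsilon> x = d_eps \<epsilon> * (indicator A x *\<^sub>R (of_real 1 / (den (delta_eps \<epsilon>) 1 0 x)^2))" for x
    by (simp add: vol_density_def den_def delta_eps_def dot_square_norm)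
  then show ?thesis
    unfolding approx_volume_def regularized_def set_lebesgue_integral_def by (simp only: integral_mult_right_zero)
qed

context lorentz_map
begin

definition dlam_vec :: "real^3" where "dlam_vec = (\<chi> l. dlam (axis l 1))"

lemma lam_eq: "lam x = lam 0 + dlam_vec \<bullet> x"
  unfolding dlam_vec_def by (rule lam_affine)

lemma negligible_degenerate: "negligible ({x. lam x = 0} \<union> sphere 0 1)"
proof (rule negligible_Un)
  have "dlam_vec \<noteq> 0 \<or> - lam 0 \<noteq> 0"
  proof (rule ccontr)
    assume "\<not> ?thesis"
    then have "lam (axis 1 1) = 0" using lam_eq[of "axis 1 1"] by simp
    then show False using lam_nonzero_sphere[of "axis 1 1"] by (simp add: norm_axis_1)
  qed
  from negligible_hyperplane[OF this] have "negligible {x. dlam_vec \<bullet> x = - lam 0}" .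
  moreover have "dlam_vec \<bullet> x = - lam 0 \<longleftrightarrow> lam x = 0" for x using lam_eq[of x] by linarith
  ultimately show "negligible {x. lam x = 0}" by simp
qed (rule negligible_sphere)

lemma den_proj:
  assumes "lam x \<noteq> 0"
  shows "den \<delta> 1 0 (proj x) = den \<delta> (lam 0) dlam_vec x / of_real ((lam x)^2)"
proof -
  have "den \<delta> 1 0 (proj x) = of_real (1 - proj x \<bullet> proj x) - \<delta>" by (simp add: den_def)
  also have "\<dots> = of_real (1 - x \<bullet> x) / of_real ((lam x)^2) - \<delta>"
    unfolding form_proj[OF assms] of_real_divide ..
  also have "\<dots> = (of_real (1 - x \<bullet> x) - \<delta> * of_real ((lam x)^2)) / of_real ((lam x)^2)"
    using assms by (simp add: diff_divide_distrib)
  finally show ?thesis unfolding den_def lam_eq[symmetric] .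
qed

text \<open>
  Points with \<open>lam x = 0\<close> are sent to infinity, and on the sphere the Jacobian was not computed; both sets are null.
\<close>

lemma regularized_isometry_image:
  assumes "open U"
    and int: "integrable lborel (\<lambda>x. indicator U x *\<^sub>R (of_real 1 / (den (delta_eps \<epsilon>) (lam 0) dlam_vec x)^2))"
  shows "regularized (isometry_image g U) (\<lambda>_. 1) 1 0 \<epsilon> = regularized U (\<lambda>_. 1) (lam 0) dlam_vec \<epsilon>"
proof -
  let ?\<delta> = "delta_eps \<epsilon>"
  define f where "f = (\<lambda>y. of_real 1 / (den ?\<delta> 1 0 y)^2)"
  define h where "h = (\<lambda>x. of_real 1 / (den ?\<delta> (lam 0) dlam_vec x)^2)"
  define S where "S = U - ({x. lam x = 0} \<union> sphere 0 1)"
  have fm: "f \<in> borel_measurable borel" and hm: "h \<in> borel_measurable borel"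
    unfolding f_def h_def by (rule measurable_test_div_den; simp)+
  have Ub: "U \<in> sets borel" using assms(1) by simp
  have hU: "h absolutely_integrable_on U" using int borel_set_integral(1)[OF hm Ub] unfolding h_def by blast
  have neg: "negligible {x \<in> S - U. h x \<noteq> 0}" "negligible {x \<in> U - S. h x \<noteq> 0}"
    by (rule negligible_subset[OF negligible_degenerate]; auto simp: S_def)+
  have hS: "h absolutely_integrable_on S"
    using absolutely_integrable_spike_set_eq[OF neg] hU by blast
  have ihS: "integral S h = integral U h" by (rule integral_spike_set[OF neg])
  have S_leb: "S \<in> sets lebesgue"
    unfolding S_def using Ub negligible_degenerate by (intro sets.Diff) (auto intro: negligible_imp_sets)
  have Sl: "lam x \<noteq> 0" "x \<bullet> x \<noteq> 1" if "x \<in> S" for x using that by (auto simp: S_def norm_eq_1)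
  have der: "(proj has_derivative dproj x) (at x within S)" if "x \<in> S" for x
    using has_derivative_proj[OF Sl(1)[OF that]] by (rule has_derivative_at_withinI)
  have inj: "inj_on proj S" by (rule inj_on_subset[OF inj_on_proj]) (use Sl in auto)
  have pw: "\<bar>det (matrix (dproj x))\<bar> *\<^sub>R f (proj x) = h x" if "x \<in> S" for x
    unfolding abs_det_dproj[OF Sl[OF that]] f_def h_def den_proj[OF Sl(1)[OF that]]
    using Sl(1)[OF that] by (simp add: power_divide scaleR_conv_of_real flip: power_mult)
  note cov = complex_change_of_variables[OF S_leb der inj hS pw]
  have im: "proj ` S = isometry_image g U - sphere 0 1"
  proof -
    have "proj x \<in> sphere 0 1 \<longleftrightarrow> x \<in> sphere 0 1" if "lam x \<noteq> 0" for x
      using form_proj[OF that] that by (auto simp: norm_eq_1)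
    then show ?thesis unfolding isometry_image_eq S_def by blast
  qed
  have neg2: "negligible {x \<in> proj ` S - isometry_image g U. f x \<noteq> 0}" "negligible {x \<in> isometry_image g U - proj ` S. f x \<noteq> 0}"
    by (rule negligible_subset[OF negligible_sphere[of "0::real^3" 1]]; auto simp: im)+
  have "f absolutely_integrable_on isometry_image g U"
    using absolutely_integrable_spike_set_eq[OF neg2] cov(1) by blast
  moreover have Ib: "isometry_image g U \<in> sets borel" using open_isometry_image[OF assms(1)] by simp
  ultimately have "(LINT x|lborel. indicator (isometry_image g U) x *\<^sub>R f x) = integral (isometry_image g U) f"
    using borel_set_integral[OF fm Ib] by blast
  also have "\<dots> = integral (proj ` S) f" by (rule integral_spike_set[OF neg2, symmetric])
  also have "\<dots> = integral U h" by (rule trans[OF cov(2) ihS])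
  also have "\<dots> = (LINT x|lborel. indicator U x *\<^sub>R h x)"
    using borel_set_integral(2)[OF hm Ub] int unfolding h_def by simp
  finally show ?thesis unfolding regularized_def f_def h_def .
qed

end

theorem theorem3p6:
  fixes \<alpha> :: real and U :: "(real^3) set" and g :: "real \<times> (real^3) \<Rightarrow> real \<times> (real^3)"
  assumes "\<alpha> > 0"
    and "open U" and "connected U" and "U \<noteq> {}"
    and "C1_holder_transversal \<alpha> U"
    and "lorentz g"
  shows "has_ext_volume U \<and> has_ext_volume (isometry_image g U) \<and>
         ext_volume (isometry_image g U) = ext_volume U"
proof -
  interpret lorentz_map g by (unfold_locales) (rule assms(6))
  have "has_common_limit U (lam 0) dlam_vec (\<lambda>_. 1)"
    using lam_nonzero_sphere by (intro has_common_limit_one[OF assms(1,2,5)]) (simp flip: lam_eq)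
  then obtain L where L: "(regularized U (\<lambda>_. 1) 1 0 \<longlongrightarrow> L) (at_right 0)"
      "(regularized U (\<lambda>_. 1) (lam 0) dlam_vec \<longlongrightarrow> L) (at_right 0)"
    and int: "\<forall>\<^sub>F \<epsilon> in at_right 0. integrable lborel (\<lambda>x. indicator U x *\<^sub>R (of_real 1 / (den (delta_eps \<epsilon>) (lam 0) dlam_vec x)^2))"
    unfolding has_common_limit_def by auto
  have "(d_eps \<longlongrightarrow> d_eps 0) (at_right 0)" unfolding d_eps_def by (intro tendsto_intros)
  then have d: "(d_eps \<longlongrightarrow> 1) (at_right 0)" by (simp add: d_eps_def)
  have "(approx_volume U \<longlongrightarrow> 1 * L) (at_right 0)"
    unfolding approx_volume_eq by (intro tendsto_mult d L(1))
  moreover have "(approx_volume (isometry_image g U) \<longlongrightarrow> 1 * L) (at_right 0)"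
  proof (rule Lim_transform_eventually)
    show "((\<lambda>\<epsilon>. d_eps \<epsilon> * regularized U (\<lambda>_. 1) (lam 0) dlam_vec \<epsilon>) \<longlongrightarrow> 1 * L) (at_right 0)"
      by (intro tendsto_mult d L(2))
    show "\<forall>\<^sub>F \<epsilon> in at_right 0. d_eps \<epsilon> * regularized U (\<lambda>_. 1) (lam 0) dlam_vec \<epsilon> = approx_volume (isometry_image g U) \<epsilon>"
      using int
    proof eventually_elim
      case (elim \<epsilon>)
      show ?case unfolding approx_volume_eq regularized_isometry_image[OF assms(2) elim] ..
    qed
  qed
  moreover have "at_right (0::real) \<noteq> bot" by simp
  ultimately show ?thesis
    unfolding has_ext_volume_def ext_volume_def using tendsto_Lim by metis
qed

end
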